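(* Consider scale-free percolation (SFP) on $\mathbb{Z}^d$ with parameters $\alpha\in(1,2)$, $\tau$ and $\lambda>0$ such that $\alpha<\tau-2$. Let $\Delta=\Delta(\alpha)$, fix $\varepsilon>0$ and a vertex $x\in\mathbb{Z}^d$, and for $k\in\mathbb{N}$ let $\mathcal{X}_{low}$ and $\mathcal{X}_{upp}$ be the sets of vertices at Euclidean distance at most $q(k)=e^{k^{1/\Delta-\varepsilon}}$ and at most $r(k)=e^{k^{1/\Delta+\varepsilon}}$ from $x$, respectively. Then $$\text{(A)}\qquad \lim_{k\to\infty}\mathbb{P}\left(\mathcal{X}_{low}\subseteq\mathcal{B}(x,k)\subseteq\mathcal{X}_{upp}\right)=1.$$ In particular, $$\text{(B)}\qquad \lim_{k\to\infty}\mathbb{P}\left(e^{k^{1/\Delta-\varepsilon}}\le|\mathcal{B}(x,k)|\le e^{k^{1/\Delta+\varepsilon}}\right)=1.$$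
   Context: Scale-free percolation (SFP) with parameters $d\ge 1$, $\alpha>1$, $\tau>1$, $\lambda>0$: the vertex set is $\mathbb{Z}^d$, and $|\cdot|$ is the Euclidean norm. Each vertex $x$ independently draws a weight $w_x$ with $\mathbb{P}(w_x\ge z)=z^{1-\tau}$ for $z\ge1$. All nearest-neighbour grid edges of $\mathbb{Z}^d$ are present. In addition, conditionally on the weights, each pair $x\ne y$ is joined independently by a (long-range) edge with probability $\min\{1,\lambda(w_xw_y/|x-y|^d)^{\alpha}\}$. $d_G(x,y)$ is the graph distance in the resulting random graph $G$. For a vertex $x$, $\mathcal{B}(x,k)=\{y\in\mathbb{Z}^d: d_G(x,y)\le k\}$. For $\beta\in(1,2)$, $\Delta(\beta)=1/\log_2(2/\beta)$. *)

theory Defs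
  imports "HOL-Probability.Probability"
begin

text \<open>
  The vertex set \<open>\<int>\<^sup>d\<close> is the type \<open>int ^ 'd\<close>, with \<open>d = CARD('d)\<close>; it is embedded into
  \<open>real ^ 'd\<close> in order to measure Euclidean distances.
\<close>

definition real_point :: "int ^ 'd \<Rightarrow> real ^ 'd" where
  "real_point x = (\<chi> i. real_of_int (x $ i))"

definition euclid_dist :: "int ^ 'd \<Rightarrow> int ^ 'd \<Rightarrow> real" where
  "euclid_dist x y = norm (real_point x - real_point y)"

definition grid_edges :: "(int ^ 'd) rel" where
  "grid_edges = {(x, y). euclid_dist x y = 1}"

definition connection_prob ::
  "real \<Rightarrow> real \<Rightarrow> (int ^ 'd \<Rightarrow> real) \<Rightarrow> int ^ 'd \<Rightarrow> int ^ 'd \<Rightarrow> real" where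
  "connection_prob \<alpha> lam w x y =
     min 1 (lam * (w x * w y / euclid_dist x y ^ CARD('d)) powr \<alpha>)"

text \<open>
  \<open>W x\<close> is the weight of the vertex \<open>x\<close>, and \<open>L \<omega>\<close> is the set of long-range edges, as a
  symmetric and irreflexive relation. In the last assumption, the requirement
  \<open>S \<inter> S\<inverse> = {}\<close> says that \<open>S\<close> contains no loops and at most one orientation of every
  pair of vertices. Singletons \<open>S\<close> give the conditional probabilities of the individual edges,
  and the product formula for all finite \<open>S\<close> is conditional independence of the edges given
  the \<open>\<sigma>\<close>-algebra generated by all the weights.
\<close>

locale scale_free_percolation = prob_space M
  for M :: "'a measure" and \<alpha> \<tau> lam :: real
    and W :: "int ^ 'd \<Rightarrow> 'a \<Rightarrow> real" and L :: "'a \<Rightarrow> (int ^ 'd) rel" +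
  assumes params: "\<alpha> > 1" "\<tau> > 1" "lam > 0"
    and weights_indep: "indep_vars (\<lambda>_. borel) W UNIV"
    and weights_tail: "\<And>x z. z \<ge> 1 \<Longrightarrow> prob {\<omega> \<in> space M. W x \<omega> \<ge> z} = z powr (1 - \<tau>)"
    and edges_measurable: "\<And>x y. {\<omega> \<in> space M. (x, y) \<in> L \<omega>} \<in> events"
    and edges_sym: "\<And>\<omega>. \<omega> \<in> space M \<Longrightarrow> sym (L \<omega>)"
    and edges_irrefl: "\<And>\<omega>. \<omega> \<in> space M \<Longrightarrow> irrefl (L \<omega>)"
    and edges_cond_indep: "\<And>S. finite S \<Longrightarrow> S \<inter> S\<inverse> = {} \<Longrightarrow>
      AE \<omega> in M.
        real_cond_exp M
          (vimage_algebra (space M) (\<lambda>\<omega> x. W x \<omega>) (Pi\<^sub>M UNIV (\<lambda>_. borel)))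
          (indicator {\<omega> \<in> space M. S \<subseteq> L \<omega>}) \<omega>
        = (\<Prod>(x, y)\<in>S. connection_prob \<alpha> lam (\<lambda>v. W v \<omega>) x y)"

definition sfp_graph :: "('a \<Rightarrow> (int ^ 'd) rel) \<Rightarrow> 'a \<Rightarrow> (int ^ 'd) rel" where
  "sfp_graph L \<omega> = grid_edges \<union> L \<omega>"

text \<open>Here \<open>(x, y) \<in> E ^^ n\<close> says that there is a walk with \<open>n\<close> edges from \<open>x\<close> to \<open>y\<close>.\<close>

definition graph_dist :: "'v rel \<Rightarrow> 'v \<Rightarrow> 'v \<Rightarrow> enat" where
  "graph_dist E x y = (INF n\<in>{n. (x, y) \<in> E ^^ n}. enat n)"

definition graph_ball :: "'v rel \<Rightarrow> 'v \<Rightarrow> nat \<Rightarrow> 'v set" where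
  "graph_ball E x k = {y. graph_dist E x y \<le> enat k}"

definition euclid_ball :: "int ^ 'd \<Rightarrow> real \<Rightarrow> (int ^ 'd) set" where
  "euclid_ball x r = {y. euclid_dist x y \<le> r}"

definition Delta :: "real \<Rightarrow> real" where
  "Delta \<beta> = 1 / log 2 (2 / \<beta>)"

end

theory Submission
  imports Defs "HOL-Real_Asymp.Real_Asymp"
begin

text \<open>
  Write \<open>\<theta> = log 2 (2 / \<alpha>) = 1 / Delta \<alpha>\<close>.

  Upper bound on the ball. A self-avoiding path of length \<open>k\<close> contains an edge that is at least
  \<open>1 / k\<close> times as long as the distance of its endpoints. Splitting there, and splitting the two
  halves again as long as their endpoints are more than \<open>R k\<close> apart, leaves a skeleton of long
  edges, and the expected number of skeletons can be computed exactly like a path count. With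
  \<open>D k\<close> the sum of the weights of all skeletons that start at a given vertex, this yields
  roughly \<open>D k \<le> (max (D i * D j)) powr (1 / \<alpha>)\<close> over \<open>i + j = k - 1\<close>, whose solution is
  \<open>exp (k powr \<theta>')\<close> for every \<open>\<theta>' > \<theta>\<close>. Two consecutive skeleton edges would give the
  moment \<open>W powr (2 * \<alpha>)\<close>, which may be infinite; using \<open>min 1 s \<le> s powr (\<alpha>' / \<alpha>)\<close> for one of
  them replaces it by \<open>W powr (\<alpha> + \<alpha>')\<close>, and \<open>\<alpha> < \<tau> - 2\<close> is exactly what allows
  \<open>\<alpha>' > 1\<close>, so that this edge is still summable.

  Lower bound on the ball. All weights are at least \<open>1\<close>, so the edges dominate independent edges with
  probabilities of order \<open>|x - y| powr (- d * \<alpha>)\<close>. Two cells of side \<open>N powr \<gamma>\<close> at distance \<open>N\<close> are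
  then linked as soon as \<open>\<gamma> > \<alpha> / 2\<close>, except with a stretched exponentially small probability.
  Descending through the scales costs a factor \<open>2\<close> per step and reaches constant size after
  \<open>log (log N) / log (1 / \<gamma>)\<close> steps, provided that one passes only through good cells; a cell is good
  if half of its subcells are good and these are all linked. Since not every small cell is
  good, each vertex is first led into the good part by a second hierarchy with a bounded number
  of scales, which starts from completely connected cells of a side slightly below \<open>k\<close>. This is
  affordable because \<open>\<theta> \<le> 2 - \<alpha>\<close>.
\<close>

section \<open>The Euclidean geometry of the lattice\<close>

text \<open>Where \<open>\<theta>\<close> comes from. Upper side: with
  \<open>D k = exp (A * k powr \<theta>')\<close> the worst split is the balanced one, and there
  \<open>D i * D j\<close> has \<open>2 powr (1 - \<theta>') * k powr \<theta>'\<close> in its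
  exponent. The recursion closes if this factor stays below \<alpha>, that is, if
  \<open>\<theta>' > \<theta>\<close>. Lower side: if the logarithm of the cell side grows by a
  factor \<open>g\<close> per level, side \<open>exp (g ^ t)\<close> costs \<open>2 ^ t\<close>
  steps, and cores remain linked as long as \<open>g < 2 / \<alpha>\<close>. So distance
  \<open>exp (k powr s)\<close> costs about \<open>k powr (s * log g 2)\<close>, which is sublinear
  for a suitable \<open>g\<close> exactly if \<open>s < \<theta>\<close>.

  The obstacle on the lower side is that every vertex of the box must be reached, although a small
  cell may well be bad. Hence only cells whose side is a power of \<open>k\<close> are required to
  be good without exception, because there a failure has probability at most
  \<open>exp (- c * k powr p)\<close>. A union bound over the \<open>exp (O (k powr s))\<close>
  vertices of the box needs \<open>s < p\<close>. Completely connected cells built from sides almost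
  \<open>k\<close> have \<open>p\<close> close to \<open>2 - \<alpha>\<close>, and this is how
  \<open>\<theta> \<le> 2 - \<alpha>\<close> enters.\<close>

lemma euclid_dist_commute: "euclid_dist x y = euclid_dist y x"
  by (simp add: euclid_dist_def norm_minus_commute)

lemma euclid_dist_nonneg [simp]: "0 \<le> euclid_dist x y"
  by (simp add: euclid_dist_def)

lemma euclid_dist_self [simp]: "euclid_dist x x = 0"
  by (simp add: euclid_dist_def)

lemma euclid_dist_triangle: "euclid_dist x z \<le> euclid_dist x y + euclid_dist y z"
  unfolding euclid_dist_def by (metis dist_norm dist_triangle)

lemma component_le_euclid_dist: "real_of_int \<bar>x $ i - y $ i\<bar> \<le> euclid_dist x y"
proof -
  have "\<bar>(real_point x - real_point y) $ i\<bar> \<le> norm (real_point x - real_point y)"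
    by (rule component_le_norm_cart)
  then show ?thesis
    by (simp add: euclid_dist_def real_point_def)
qed

lemma euclid_dist_ge_1:
  assumes "x \<noteq> y" shows "1 \<le> euclid_dist x y"
proof -
  obtain i where "x $ i \<noteq> y $ i" using assms by (auto simp: vec_eq_iff)
  then have "1 \<le> \<bar>x $ i - y $ i\<bar>" by linarith
  then have "1 \<le> real_of_int \<bar>x $ i - y $ i\<bar>" by linarith
  also have "\<dots> \<le> euclid_dist x y" by (rule component_le_euclid_dist)
  finally show ?thesis .
qed

lemma euclid_dist_le_sum: "euclid_dist x y \<le> (\<Sum>i\<in>UNIV. real_of_int \<bar>x $ i - y $ i\<bar>)"
proof -
  have "norm (real_point x - real_point y) \<le> (\<Sum>i\<in>UNIV. \<bar>(real_point x - real_point y) $ i\<bar>)"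
    by (rule norm_le_l1_cart)
  then show ?thesis by (simp add: euclid_dist_def real_point_def)
qed

lemma bij_betw_int_vec_box:
  "bij_betw (\<lambda>f. \<chi> i. f i) (PiE UNIV A) {v::int ^ 'd. \<forall>i. v $ i \<in> A i}"
  by (rule bij_betwI[where g = "\<lambda>v i. v $ i"]) (auto simp: PiE_def extensional_def vec_eq_iff)

lemma card_int_vec_box: "card {v::int ^ 'd. \<forall>i. v $ i \<in> A i} = (\<Prod>i\<in>UNIV. card (A i))"
  using bij_betw_same_card[OF bij_betw_int_vec_box[of A]] by (simp add: card_PiE)

lemma finite_int_vec_box:
  assumes "\<And>i. finite (A i)" shows "finite {v::int ^ 'd. \<forall>i. v $ i \<in> A i}"
  using bij_betw_finite[OF bij_betw_int_vec_box[of A]] assms by (simp add: finite_PiE)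

lemma
  fixes x :: "int ^ 'd"
  assumes "1 \<le> r"
  shows finite_euclid_ball: "finite (euclid_ball x r)"
    and card_euclid_ball_le: "real (card (euclid_ball x r)) \<le> (3 * r) ^ CARD('d)"
proof -
  define A where "A = (\<lambda>i. {x $ i - \<lfloor>r\<rfloor> .. x $ i + \<lfloor>r\<rfloor>})"
  have sub: "euclid_ball x r \<subseteq> {v. \<forall>i. v $ i \<in> A i}"
  proof (clarsimp simp: euclid_ball_def A_def)
    fix v i assume "euclid_dist x v \<le> r"
    then have "real_of_int \<bar>x $ i - v $ i\<bar> \<le> r"
      using component_le_euclid_dist[of x i v] by linarith
    then have "\<bar>x $ i - v $ i\<bar> \<le> \<lfloor>r\<rfloor>" by linarith
    then show "x $ i - \<lfloor>r\<rfloor> \<le> v $ i \<and> v $ i \<le> x $ i + \<lfloor>r\<rfloor>" by linarith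
  qed
  have fin: "finite {v. \<forall>i. v $ i \<in> A i}"
    by (rule finite_int_vec_box) (simp add: A_def)
  show "finite (euclid_ball x r)" using sub fin by (rule finite_subset)
  have 1: "real (card (A i)) \<le> 3 * r" for i
  proof -
    have "card (A i) = nat (2 * \<lfloor>r\<rfloor> + 1)" by (simp add: A_def)
    moreover have "1 \<le> \<lfloor>r\<rfloor>" using assms by simp
    ultimately show ?thesis by linarith
  qed
  have "card (euclid_ball x r) \<le> (\<Prod>i\<in>UNIV. card (A i))"
    using card_mono[OF fin sub] by (simp add: card_int_vec_box)
  then have "real (card (euclid_ball x r)) \<le> (\<Prod>i\<in>UNIV. real (card (A i)))"
    by (metis of_nat_le_iff of_nat_prod)
  also have "\<dots> \<le> (\<Prod>i\<in>(UNIV::'d set). 3 * r)"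
    by (rule prod_mono) (use 1 in auto)
  finally show "real (card (euclid_ball x r)) \<le> (3 * r) ^ CARD('d)" by simp
qed

text \<open>The points on one axis suffice: on the scale \<open>exp (k powr s)\<close> the true
  power \<open>d\<close> of the volume is immaterial.\<close>

lemma card_euclid_ball_ge:
  fixes x :: "int ^ 'd"
  assumes "1 \<le> r"
  shows "r \<le> real (card (euclid_ball x r))"
proof -
  obtain i :: 'd where True by simp
  define f where "f = (\<lambda>j::int. (\<chi> l. if l = i then x $ l + j else x $ l) :: int ^ 'd)"
  have inj: "inj f"
  proof (rule injI)
    fix a b assume "f a = f b"
    then have "f a $ i = f b $ i" by simp
    then show "a = b" by (simp add: f_def)
  qed
  have "f ` {-\<lfloor>r\<rfloor>..\<lfloor>r\<rfloor>} \<subseteq> euclid_ball x r"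
  proof (clarsimp simp: euclid_ball_def)
    fix j assume j: "- \<lfloor>r\<rfloor> \<le> j" "j \<le> \<lfloor>r\<rfloor>"
    have "euclid_dist x (f j) \<le> (\<Sum>l\<in>UNIV. real_of_int \<bar>x $ l - f j $ l\<bar>)"
      by (rule euclid_dist_le_sum)
    also have "\<dots> = (\<Sum>l\<in>UNIV. if l = i then real_of_int \<bar>j\<bar> else 0)"
      by (rule sum.cong) (auto simp: f_def)
    also have "\<dots> \<le> r" using j by simp linarith
    finally show "euclid_dist x (f j) \<le> r" .
  qed
  then have "card (f ` {-\<lfloor>r\<rfloor>..\<lfloor>r\<rfloor>}) \<le> card (euclid_ball x r)"
    using finite_euclid_ball[OF assms] by (rule card_mono[rotated])
  then have "nat (2 * \<lfloor>r\<rfloor> + 1) \<le> card (euclid_ball x r)"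
    using card_image[OF inj_on_subset[OF inj], of "{-\<lfloor>r\<rfloor>..\<lfloor>r\<rfloor>}"] by simp
  moreover have "1 \<le> \<lfloor>r\<rfloor>" using assms by simp
  ultimately show ?thesis by linarith
qed

text \<open>Dyadic shells: at most \<open>(6 * 2 ^ j * r) ^ d\<close> points have distance between
  \<open>2 ^ j * r\<close> and \<open>2 ^ (j + 1) * r\<close>, so shell \<open>j\<close> contributes
  a multiple of \<open>r powr (- d * (\<beta> - 1))\<close> times \<open>\<rho> ^ j\<close>. The
  constant does not depend on the finite set \<open>U\<close>, so no infinite sum is needed.\<close>

lemma lattice_sum_outside:
  fixes \<beta> :: real
  assumes "1 < \<beta>"
  obtains C where "0 < C"
    and "\<And>(x::int ^ 'd) U r. \<lbrakk>finite U; 1 \<le> r; \<And>u. u \<in> U \<Longrightarrow> r < euclid_dist x u\<rbrakk>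
      \<Longrightarrow> (\<Sum>u\<in>U. euclid_dist x u powr (- (CARD('d) * \<beta>))) \<le> C * r powr (- (CARD('d) * (\<beta> - 1)))"
proof -
  define d where "d = real CARD('d)"
  have d: "d \<ge> 1" unfolding d_def by (simp add: Suc_le_eq)
  define \<rho> where "\<rho> = 2 powr (- (d * (\<beta> - 1)))"
  have \<rho>: "0 < \<rho>" "\<rho> < 1"
    using assms d by (auto simp: \<rho>_def powr_less_one)
  define C where "C = 6 powr d * (1 / (1 - \<rho>))"
  have "0 < C" using \<rho> by (simp add: C_def)
  moreover have "(\<Sum>u\<in>U. euclid_dist x u powr (- (CARD('d) * \<beta>))) \<le> C * r powr (- (CARD('d) * (\<beta> - 1)))"
    if U: "finite U" "1 \<le> r" "\<And>u. u \<in> U \<Longrightarrow> r < euclid_dist x u" for x :: "int ^ 'd" and U r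
  proof -
    define j where "j = (\<lambda>u. nat \<lfloor>log 2 (euclid_dist x u / r)\<rfloor>)"
    have j: "2 ^ j u * r \<le> euclid_dist x u" "euclid_dist x u \<le> 2 ^ Suc (j u) * r" if "u \<in> U" for u
    proof -
      have q: "1 < euclid_dist x u / r" using U(2) U(3)[OF that] by simp
      then have l0: "0 \<le> log 2 (euclid_dist x u / r)" by simp
      have "real (j u) \<le> log 2 (euclid_dist x u / r)" using l0 by (simp add: j_def)
      then have "2 powr real (j u) \<le> euclid_dist x u / r"
        using q by (simp add: le_log_iff)
      then show "2 ^ j u * r \<le> euclid_dist x u"
        using U(2) by (simp add: powr_realpow field_simps)
      have "log 2 (euclid_dist x u / r) \<le> real (Suc (j u))" using l0 unfolding j_def by linarith
      then have "euclid_dist x u / r \<le> 2 powr real (Suc (j u))"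
        using q by (simp add: log_le_iff)
      then show "euclid_dist x u \<le> 2 ^ Suc (j u) * r"
        using U(2) by (subst (asm) powr_realpow) (auto simp: field_simps)
    qed
    define J where "J = j ` U"
    have finJ: "finite J" using U by (simp add: J_def)
    have "(\<Sum>u\<in>U. euclid_dist x u powr (- (d * \<beta>)))
        = (\<Sum>i\<in>J. \<Sum>u\<in>{u\<in>U. j u = i}. euclid_dist x u powr (- (d * \<beta>)))"
      using U(1) by (simp add: J_def sum.image_gen[symmetric])
    also have "\<dots> \<le> (\<Sum>i\<in>J. 6 powr d * r powr (- (d * (\<beta> - 1))) * \<rho> ^ i)"
    proof (rule sum_mono)
      fix i assume "i \<in> J"
      have r2: "1 \<le> 2 ^ Suc i * r"
      proof -
        have "(1::real) * 1 \<le> 2 ^ Suc i * r" by (rule mult_mono) (use U(2) in \<open>auto simp: one_le_power simp del: power_Suc\<close>)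
        then show ?thesis by simp
      qed
      have "(\<Sum>u\<in>{u\<in>U. j u = i}. euclid_dist x u powr (- (d * \<beta>)))
         \<le> (\<Sum>u\<in>{u\<in>U. j u = i}. (2 ^ i * r) powr (- (d * \<beta>)))"
        using j U(2) d assms by (intro sum_mono powr_mono2') auto
      also have "\<dots> = card {u\<in>U. j u = i} * (2 ^ i * r) powr (- (d * \<beta>))" by simp
      also have "\<dots> \<le> (3 * (2 ^ Suc i * r)) ^ CARD('d) * (2 ^ i * r) powr (- (d * \<beta>))"
      proof (rule mult_right_mono)
        have "{u\<in>U. j u = i} \<subseteq> euclid_ball x (2 ^ Suc i * r)"
          using j(2) by (auto simp: euclid_ball_def)
        then have "real (card {u\<in>U. j u = i}) \<le> real (card (euclid_ball x (2 ^ Suc i * r)))"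
          using card_mono[OF finite_euclid_ball[OF r2]] by simp
        also have "\<dots> \<le> (3 * (2 ^ Suc i * r)) ^ CARD('d)" using card_euclid_ball_le[OF r2] .
        finally show "real (card {u\<in>U. j u = i}) \<le> (3 * (2 ^ Suc i * r)) ^ CARD('d)" .
      qed simp
      also have "(3 * (2 ^ Suc i * r)) ^ CARD('d) = (6 * (2 ^ i * r)) powr d"
        using U(2) by (simp add: d_def powr_realpow mult.assoc mult.left_commute)
      also have "(6 * (2 ^ i * r)) powr d * (2 ^ i * r) powr (- (d * \<beta>))
          = 6 powr d * (2 ^ i * r) powr (- (d * (\<beta> - 1)))"
        using U(2) by (simp add: powr_mult powr_add[symmetric] algebra_simps)
      also have "\<dots> = 6 powr d * r powr (- (d * (\<beta> - 1))) * \<rho> ^ i"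
        using U(2) by (simp add: powr_mult \<rho>_def powr_power powr_powr powr_realpow[symmetric] mult.commute)
      finally show "(\<Sum>u\<in>{u\<in>U. j u = i}. euclid_dist x u powr (- (d * \<beta>)))
          \<le> 6 powr d * r powr (- (d * (\<beta> - 1))) * \<rho> ^ i" .
    qed
    also have "\<dots> = 6 powr d * r powr (- (d * (\<beta> - 1))) * (\<Sum>i\<in>J. \<rho> ^ i)"
      by (simp add: sum_distrib_left)
    also have "\<dots> \<le> 6 powr d * r powr (- (d * (\<beta> - 1))) * (1 / (1 - \<rho>))"
    proof (rule mult_left_mono)
      have "(\<Sum>i\<in>J. \<rho> ^ i) \<le> (\<Sum>i. \<rho> ^ i)"
        using \<rho> finJ by (intro sum_le_suminf) (auto simp: summable_geometric)
      then show "(\<Sum>i\<in>J. \<rho> ^ i) \<le> 1 / (1 - \<rho>)" using \<rho> by (simp add: suminf_geometric)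
    qed simp
    finally show ?thesis by (simp add: C_def d_def mult_ac)
  qed
  ultimately show ?thesis by (rule that)
qed

section \<open>Skeletons of self-avoiding paths\<close>

text \<open>In \<open>Node i a b l r\<close> the edge \<open>(a, b)\<close> is the long edge of a
  path piece, \<open>i\<close> is the number of edges before it, and \<open>l\<close>,
  \<open>r\<close> describe the pieces on its two sides. The length \<open>k\<close> and the
  endpoints of the whole piece are not stored but passed as arguments, so the right piece has length
  \<open>k - 1 - i\<close>.\<close>

datatype 'v skeleton = Leaf | Node nat 'v 'v "'v skeleton" "'v skeleton"

text \<open>Makes the union over all skeletons of a path a countable one.\<close>

instance skeleton :: (countable) countable by countable_datatype

primrec skeleton_edges :: "'v skeleton \<Rightarrow> 'v rel" where
  "skeleton_edges Leaf = {}"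
| "skeleton_edges (Node i a b l r) = insert (a, b) (skeleton_edges l \<union> skeleton_edges r)"

text \<open>Interior vertices only: for \<open>i = 0\<close> the vertex \<open>a\<close> is the
  start of the piece, and for \<open>Suc i = k\<close> the vertex \<open>b\<close> is its end.
  Endpoints are accounted for separately, because an edge of a shallower node may use them as
  well.\<close>

primrec skeleton_verts :: "'v skeleton \<Rightarrow> nat \<Rightarrow> 'v set" where
  "skeleton_verts Leaf k = {}"
| "skeleton_verts (Node i a b l r) k =
     skeleton_verts l i \<union> skeleton_verts r (k - 1 - i) \<union>
     (if i = 0 then {} else {a}) \<union> (if Suc i = k then {} else {b})"

text \<open>The exceptional cases are the splits with an empty half, where the long edge touches an
  endpoint of the piece.\<close>

abbreviation split_exponent :: "real \<Rightarrow> real \<Rightarrow> nat \<Rightarrow> nat \<Rightarrow> real" where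
  "split_exponent \<alpha> \<alpha>' k i \<equiv> if i = 0 \<or> Suc i = k then \<alpha>' else \<alpha>"

text \<open>What remains of the probability of a skeleton once the vertex weights are integrated
  out: a power of the length per edge, with all constants collected in \<open>C\<close>. The value
  is 0 for inadmissible skeletons, so sums may run over arbitrary finite sets of trees.\<close>

primrec skeleton_weight ::
  "(nat \<Rightarrow> real) \<Rightarrow> real \<Rightarrow> real \<Rightarrow> real \<Rightarrow> (int ^ 'd) skeleton \<Rightarrow> nat \<Rightarrow> int ^ 'd \<Rightarrow> int ^ 'd \<Rightarrow> real"
where
  "skeleton_weight R C \<alpha> \<alpha>' Leaf k x u = (if euclid_dist x u \<le> R k then 1 else 0)"
| "skeleton_weight R C \<alpha> \<alpha>' (Node i a b l r) k x u =
     (if R k < euclid_dist x u \<and> i < k \<and> euclid_dist x u \<le> real k * euclid_dist a b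
      then skeleton_weight R C \<alpha> \<alpha>' l i x a *
           (C * euclid_dist a b powr (- (real CARD('d) * split_exponent \<alpha> \<alpha>' k i))) *
           skeleton_weight R C \<alpha> \<alpha>' r (k - 1 - i) b u
      else 0)"

inductive skeleton_of :: "(nat \<Rightarrow> real) \<Rightarrow> (int ^ 'd) list \<Rightarrow> (int ^ 'd) skeleton \<Rightarrow> bool"
  for R where
  leaf: "vs \<noteq> [] \<Longrightarrow> euclid_dist (hd vs) (last vs) \<le> R (length vs - 1) \<Longrightarrow> skeleton_of R vs Leaf"
| node: "ps \<noteq> [] \<Longrightarrow> qs \<noteq> [] \<Longrightarrow> R (length (ps @ qs) - 1) < euclid_dist (hd ps) (last qs) \<Longrightarrow>
    euclid_dist (hd ps) (last qs) \<le> real (length (ps @ qs) - 1) * euclid_dist (last ps) (hd qs) \<Longrightarrow>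
    skeleton_of R ps l \<Longrightarrow> skeleton_of R qs r \<Longrightarrow>
    skeleton_of R (ps @ qs) (Node (length ps - 1) (last ps) (hd qs) l r)"

lemma skeleton_weight_nonneg: "0 \<le> C \<Longrightarrow> 0 \<le> skeleton_weight R C \<alpha> \<alpha>' t k x u"
  by (induction t arbitrary: k x u) auto

lemma split_at_long_edge:
  fixes vs :: "(int ^ 'd) list"
  assumes "2 \<le> length vs"
  shows "\<exists>ps qs. vs = ps @ qs \<and> ps \<noteq> [] \<and> qs \<noteq> [] \<and>
    euclid_dist (hd vs) (last vs) \<le> real (length vs - 1) * euclid_dist (last ps) (hd qs)"
  using assms
proof (induction vs)
  case Nil
  then show ?case by simp
next
  case (Cons v vs)
  show ?case
  proof (cases "2 \<le> length vs")
    case False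
    with Cons.prems have "length vs = 1" by simp
    then obtain w where w: "vs = [w]" by (auto simp: length_Suc_conv)
    show ?thesis
      by (rule exI[of _ "[v]"], rule exI[of _ "[w]"]) (simp add: w)
  next
    case True
    with Cons.IH obtain ps qs where pq: "vs = ps @ qs" "ps \<noteq> []" "qs \<noteq> []"
      "euclid_dist (hd vs) (last vs) \<le> real (length vs - 1) * euclid_dist (last ps) (hd qs)" by blast
    have ne: "vs \<noteq> []" using True by auto
    have tri: "euclid_dist v (last vs) \<le> euclid_dist v (hd vs) + euclid_dist (hd vs) (last vs)"
      by (rule euclid_dist_triangle)
    have len: "real (length vs) = 1 + real (length vs - 1)" using True by simp
    show ?thesis
    proof (cases "euclid_dist v (hd vs) \<le> euclid_dist (last ps) (hd qs)")
      case True
      have "euclid_dist v (last vs) \<le> real (length vs) * euclid_dist (last ps) (hd qs)"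
        unfolding len using tri pq(4) True by (simp add: algebra_simps)
      then show ?thesis
        using pq ne by (intro exI[of _ "v # ps"] exI[of _ qs]) auto
    next
      case False
      then have "real (length vs - 1) * euclid_dist (last ps) (hd qs) \<le> real (length vs - 1) * euclid_dist v (hd vs)"
        by (intro mult_left_mono) auto
      then have "euclid_dist v (last vs) \<le> real (length vs) * euclid_dist v (hd vs)"
        unfolding len using tri pq(4) by (simp add: algebra_simps)
      then show ?thesis
        using ne by (intro exI[of _ "[v]"] exI[of _ vs]) auto
    qed
  qed
qed

lemma skeleton_exists:
  assumes "vs \<noteq> []" and "R 0 = 0"
  shows "\<exists>t. skeleton_of R vs t"
  using assms(1)
proof (induction "length vs" arbitrary: vs rule: less_induct)
  case less
  show ?case
  proof (cases "euclid_dist (hd vs) (last vs) \<le> R (length vs - 1)")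
    case True
    then show ?thesis using less.prems by (blast intro: skeleton_of.leaf)
  next
    case False
    \<comment> \<open>\<open>R 0 = 0\<close> makes a single vertex a leaf, so whatever is split has
      an edge.\<close>
    have "length vs \<noteq> 1"
    proof
      assume "length vs = 1"
      then obtain w where "vs = [w]" by (auto simp: length_Suc_conv)
      with False assms(2) show False by simp
    qed
    with less.prems have "2 \<le> length vs" by (cases vs) (auto simp: Suc_le_eq)
    from split_at_long_edge[OF this] obtain ps qs where pq: "vs = ps @ qs" "ps \<noteq> []" "qs \<noteq> []"
      "euclid_dist (hd vs) (last vs) \<le> real (length vs - 1) * euclid_dist (last ps) (hd qs)" by blast
    obtain l r where lr: "skeleton_of R ps l" "skeleton_of R qs r"
      using less.hyps[of ps] less.hyps[of qs] pq by auto
    have "skeleton_of R (ps @ qs) (Node (length ps - 1) (last ps) (hd qs) l r)"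
      by (rule skeleton_of.node) (use False pq lr in auto)
    then show ?thesis using pq by blast
  qed
qed

lemma skeleton_of_nonempty: "skeleton_of R vs t \<Longrightarrow> vs \<noteq> []"
  by (induction rule: skeleton_of.induct) auto

lemma zip_tl_append:
  "ps \<noteq> [] \<Longrightarrow> qs \<noteq> [] \<Longrightarrow>
    zip (ps @ qs) (tl (ps @ qs)) = zip ps (tl ps) @ (last ps, hd qs) # zip qs (tl qs)"
proof (induction ps)
  case (Cons p ps)
  then show ?case
    by (cases "ps = []"; cases qs; cases ps) (auto simp: neq_Nil_conv)
qed simp

lemma skeleton_edges_subset:
  assumes "skeleton_of R vs t"
  shows "skeleton_edges t \<subseteq> set (zip vs (tl vs))"
  using assms
proof (induction rule: skeleton_of.induct)
  case (leaf vs)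
  then show ?case by simp
next
  case (node ps qs l r)
  show ?case using node.IH by (auto simp: zip_tl_append[OF node.hyps(1,2)])
qed

lemma skeleton_edges_field:
  assumes "skeleton_of R vs t"
  shows "skeleton_edges t \<subseteq> set vs \<times> set vs"
proof -
  have "set (zip vs (tl vs)) \<subseteq> set vs \<times> set vs"
    by (cases vs) (auto dest: set_zip_leftD set_zip_rightD)
  with skeleton_edges_subset[OF assms] show ?thesis by blast
qed

lemma finite_skeleton_edges [simp]: "finite (skeleton_edges t)"
  by (induction t) auto

lemma finite_skeleton_verts [simp]: "finite (skeleton_verts t k)"
  by (induction t arbitrary: k) auto

lemma hd_neq_last: "distinct vs \<Longrightarrow> 2 \<le> length vs \<Longrightarrow> hd vs \<noteq> last vs"
  by (cases vs) (auto split: if_splits)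

lemma skeleton_verts_subset:
  assumes "skeleton_of R vs t" "distinct vs" "R 0 = 0"
  shows "skeleton_verts t (length vs - 1) \<subseteq> set vs - {hd vs, last vs}"
  using assms
proof (induction rule: skeleton_of.induct)
  case (leaf vs)
  then show ?case by simp
next
  case (node ps qs l r)
  have d: "distinct ps" "distinct qs" "set ps \<inter> set qs = {}" using node.prems by auto
  have len: "length (ps @ qs) - 1 - 1 - (length ps - 1) = length qs - 1"
    "Suc (length ps - 1) = length (ps @ qs) - 1 \<longleftrightarrow> length qs = 1" "length ps - 1 = 0 \<longleftrightarrow> length ps = 1"
    using node.hyps(1,2) by (cases ps; cases qs; auto)+
  have IHl: "skeleton_verts l (length ps - 1) \<subseteq> set ps - {hd ps, last ps}"
    and IHr: "skeleton_verts r (length qs - 1) \<subseteq> set qs - {hd qs, last qs}"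
    using node.IH d node.prems by auto
  have a: "last ps \<noteq> hd ps" if "length ps \<noteq> 1"
    using that d node.hyps(1) hd_neq_last[of ps] by (cases ps) (auto simp: Suc_le_eq)
  have b: "last qs \<noteq> hd qs" if "length qs \<noteq> 1"
    using that d node.hyps(2) hd_neq_last[of qs] by (cases qs) (auto simp: Suc_le_eq)
  have mem: "hd ps \<in> set ps" "last ps \<in> set ps" "hd qs \<in> set qs" "last qs \<in> set qs"
    using node.hyps(1,2) by auto
  have hl: "hd (ps @ qs) = hd ps" "last (ps @ qs) = last qs" using node.hyps(1,2) by auto
  show ?case
    unfolding skeleton_verts.simps len hl
    using IHl IHr a b mem d(3) by (auto split: if_splits)
qed

lemma skeleton_edges_antisym:
  assumes "skeleton_of R vs t" "distinct vs"
  shows "skeleton_edges t \<inter> (skeleton_edges t)\<inverse> = {}"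
  using assms
proof (induction rule: skeleton_of.induct)
  case (leaf vs)
  then show ?case by simp
next
  case (node ps qs l r)
  have d: "distinct ps" "distinct qs" "set ps \<inter> set qs = {}" using node.prems by auto
  have mem: "last ps \<in> set ps" "hd qs \<in> set qs"
    using node.hyps(1,2) by auto
  show ?case
    using node.IH(1)[OF d(1)] node.IH(2)[OF d(2)] d(3) mem
      skeleton_edges_field[OF node.hyps(5)] skeleton_edges_field[OF node.hyps(6)]
    by auto
qed

text \<open>A node adds at most two interior vertices, so a factor \<open>m\<close> per vertex is
  absorbed by a factor \<open>m\<^sup>2\<close> per edge constant.\<close>

lemma skeleton_weight_power:
  assumes "1 \<le> m" "0 \<le> C"
  shows "skeleton_weight R C \<alpha> \<alpha>' t k x u * m ^ card (skeleton_verts t k)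
    \<le> skeleton_weight R (C * m\<^sup>2) \<alpha> \<alpha>' t k x u"
proof (induction t arbitrary: k x u)
  case Leaf
  then show ?case by simp
next
  case (Node i a b l r)
  define cl where "cl = card (skeleton_verts l i)"
  define cr where "cr = card (skeleton_verts r (k - 1 - i))"
  define e where "e = euclid_dist a b powr (- (real CARD('a) * split_exponent \<alpha> \<alpha>' k i))"
  have "card (skeleton_verts (Node i a b l r) k) \<le> cl + cr + 1 + 1"
    unfolding cl_def cr_def skeleton_verts.simps
    by (intro order.trans[OF card_Un_le] add_mono) auto
  then have "m ^ card (skeleton_verts (Node i a b l r) k) \<le> m ^ (cl + cr + 1 + 1)"
    using assms by (intro power_increasing) auto
  also have "\<dots> = m ^ cl * m ^ cr * m\<^sup>2" by (simp add: power_add power2_eq_square)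
  finally have c: "m ^ card (skeleton_verts (Node i a b l r) k) \<le> m ^ cl * m ^ cr * m\<^sup>2" .
  let ?w = "skeleton_weight R C \<alpha> \<alpha>'"
  let ?w' = "skeleton_weight R (C * m\<^sup>2) \<alpha> \<alpha>'"
  have "?w l i x a * (C * e) * ?w r (k - 1 - i) b u * m ^ card (skeleton_verts (Node i a b l r) k)
      \<le> ?w l i x a * (C * e) * ?w r (k - 1 - i) b u * (m ^ cl * m ^ cr * m\<^sup>2)"
    using assms by (intro mult_left_mono[OF c] mult_nonneg_nonneg skeleton_weight_nonneg) (auto simp: e_def)
  also have "\<dots> = (?w l i x a * m ^ cl) * (C * m\<^sup>2 * e) * (?w r (k - 1 - i) b u * m ^ cr)"
    by (simp add: mult_ac)
  also have "\<dots> \<le> ?w' l i x a * (C * m\<^sup>2 * e) * ?w' r (k - 1 - i) b u"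
    unfolding cl_def cr_def using assms
    by (intro mult_mono Node.IH mult_nonneg_nonneg skeleton_weight_nonneg) (auto simp: e_def)
  finally show ?case by (simp add: e_def)
qed

text \<open>
  The exponent is \<open>\<alpha>'\<close> exactly for the edges that share a vertex with an edge of a shallower node,
  so the total exponent of an interior vertex never exceeds \<open>\<alpha> + \<alpha>'\<close>.
\<close>

lemma skeleton_prod_le:
  fixes w :: "int ^ 'd \<Rightarrow> real" and q :: "int ^ 'd \<Rightarrow> int ^ 'd \<Rightarrow> real"
  assumes "skeleton_of R vs t" "distinct vs" "R 0 = 0"
    and w: "\<And>v. 1 \<le> w v" and \<alpha>': "0 \<le> \<alpha>'" "\<alpha>' \<le> \<alpha>" and C: "0 \<le> C"
    and q0: "\<And>a b. 0 \<le> q a b"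
    and q: "\<And>a b e. a \<noteq> b \<Longrightarrow> e = \<alpha> \<or> e = \<alpha>' \<Longrightarrow>
       q a b \<le> C * euclid_dist a b powr (- (real CARD('d) * e)) * (w a powr e * w b powr e)"
  shows "(\<Prod>(a, b)\<in>skeleton_edges t. q a b)
    \<le> skeleton_weight R C \<alpha> \<alpha>' t (length vs - 1) (hd vs) (last vs) *
       (\<Prod>v\<in>skeleton_verts t (length vs - 1). w v powr (\<alpha> + \<alpha>')) *
       (if length vs = 1 then 1 else w (hd vs) powr \<alpha>' * w (last vs) powr \<alpha>')"
  using assms(1,2)
proof (induction rule: skeleton_of.induct)
  case (leaf vs)
  have "1 \<le> w v powr \<alpha>'" for v using w \<alpha>' by (simp add: ge_one_powr_ge_zero)
  then have "1 * 1 \<le> w (hd vs) powr \<alpha>' * w (last vs) powr \<alpha>'"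
    by (intro mult_mono) auto
  then show ?case using leaf by simp
next
  case (node ps qs l r)
  let ?k = "length (ps @ qs) - 1" and ?i = "length ps - 1" and ?j = "length qs - 1"
  let ?x = "hd ps" and ?a = "last ps" and ?b = "hd qs" and ?u = "last qs"
  let ?W = "skeleton_weight R C \<alpha> \<alpha>'"
  have d: "distinct ps" "distinct qs" "set ps \<inter> set qs = {}" using node.prems by auto
  have len: "?k - 1 - ?i = ?j" "Suc ?i = ?k \<longleftrightarrow> length qs = 1" "?i = 0 \<longleftrightarrow> length ps = 1" "?i < ?k"
    "length (ps @ qs) \<noteq> 1"
    using node.hyps(1,2) by (cases ps; cases qs; auto)+
  have mem: "?x \<in> set ps" "?a \<in> set ps" "?b \<in> set qs" "?u \<in> set qs"
    using node.hyps(1,2) by auto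
  have ab: "?a \<noteq> ?b" using mem d by auto
  have hl: "hd (ps @ qs) = ?x" "last (ps @ qs) = ?u" using node.hyps(1,2) by auto
  define e where "e = (if ?i = 0 \<or> Suc ?i = ?k then \<alpha>' else \<alpha>)"
  define El where "El = (if length ps = 1 then 1 else w ?x powr \<alpha>' * w ?a powr \<alpha>')"
  define Er where "Er = (if length qs = 1 then 1 else w ?b powr \<alpha>' * w ?u powr \<alpha>')"
  define Vl where "Vl = (\<Prod>v\<in>skeleton_verts l ?i. w v powr (\<alpha> + \<alpha>'))"
  define Vr where "Vr = (\<Prod>v\<in>skeleton_verts r ?j. w v powr (\<alpha> + \<alpha>'))"
  define Ql where "Ql = (\<Prod>(a, b)\<in>skeleton_edges l. q a b)"
  define Qr where "Qr = (\<Prod>(a, b)\<in>skeleton_edges r. q a b)"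
  define c where "c = C * euclid_dist ?a ?b powr (- (real CARD('d) * e))"
  have nn: "0 \<le> El" "0 \<le> Er" "0 \<le> Vl" "0 \<le> Vr" "0 \<le> Ql" "0 \<le> Qr" "0 \<le> c"
    unfolding El_def Er_def Vl_def Vr_def Ql_def Qr_def c_def
    using C q0 by (auto intro!: prod_nonneg)
  have W0: "0 \<le> ?W t k x u" for t k x u using C by (rule skeleton_weight_nonneg)
  have IHl: "Ql \<le> ?W l ?i ?x ?a * Vl * El" and IHr: "Qr \<le> ?W r ?j ?b ?u * Vr * Er"
    using node.IH d unfolding Ql_def Qr_def Vl_def Vr_def El_def Er_def by auto
  have dl: "skeleton_edges l \<subseteq> set ps \<times> set ps" and dr: "skeleton_edges r \<subseteq> set qs \<times> set qs"
    using skeleton_edges_field node.hyps by blast+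
  have nin: "(?a, ?b) \<notin> skeleton_edges l \<union> skeleton_edges r"
    using dl dr mem d(3) by blast
  have dis: "skeleton_edges l \<inter> skeleton_edges r = {}"
    using dl dr d(3) by blast
  have "(\<Prod>(a, b)\<in>skeleton_edges (Node ?i ?a ?b l r). q a b) = q ?a ?b * (Ql * Qr)"
    using nin dis by (simp add: prod.union_disjoint Ql_def Qr_def)
  also have "\<dots> \<le> (c * (w ?a powr e * w ?b powr e)) * ((?W l ?i ?x ?a * Vl * El) * (?W r ?j ?b ?u * Vr * Er))"
    unfolding c_def
    using IHl IHr nn W0 ab C
    by (intro mult_mono q mult_nonneg_nonneg) (auto simp: e_def c_def)
  also have "\<dots> = (?W l ?i ?x ?a * c * ?W r ?j ?b ?u) * (Vl * Vr * (w ?a powr e * w ?b powr e * El * Er))"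
    by (simp add: mult_ac)
  also have "\<dots> \<le> (?W l ?i ?x ?a * c * ?W r ?j ?b ?u) *
     (Vl * Vr * ((if length ps = 1 then 1 else w ?a powr (\<alpha> + \<alpha>')) *
                (if length qs = 1 then 1 else w ?b powr (\<alpha> + \<alpha>')) * (w ?x powr \<alpha>' * w ?u powr \<alpha>')))"
  proof (intro mult_left_mono mult_nonneg_nonneg nn W0)
    have mono: "w v powr (\<alpha>' + \<alpha>') \<le> w v powr (\<alpha> + \<alpha>')" for v
      using w \<alpha>' by (intro powr_mono) auto
    have ps1: "?x = ?a" if "length ps = 1" using that by (auto simp: length_Suc_conv)
    have qs1: "?b = ?u" if "length qs = 1" using that by (auto simp: length_Suc_conv)
    \<comment> \<open>If \<open>ps\<close> is a single vertex, \<open>?a\<close> is the endpoint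
      \<open>?x\<close> and carries only the \<alpha>' of the new edge. Otherwise \<open>?a\<close>
      becomes interior and joins the exponent of the new edge to the \<alpha>' that the left half
      left open at its end. The same holds for \<open>?b\<close>.\<close>
    consider "length ps = 1" "length qs = 1" | "length ps = 1" "length qs \<noteq> 1"
      | "length ps \<noteq> 1" "length qs = 1" | "length ps \<noteq> 1" "length qs \<noteq> 1" by blast
    then show "w ?a powr e * w ?b powr e * El * Er
       \<le> (if length ps = 1 then 1 else w ?a powr (\<alpha> + \<alpha>')) *
          (if length qs = 1 then 1 else w ?b powr (\<alpha> + \<alpha>')) * (w ?x powr \<alpha>' * w ?u powr \<alpha>')"
    proof cases
      case 1
      then show ?thesis using ps1 qs1 unfolding e_def El_def Er_def len by simp
    next
      case 2
      have "w ?a powr e * w ?b powr e * El * Er = w ?a powr \<alpha>' * (w ?b powr (\<alpha>' + \<alpha>') * w ?u powr \<alpha>')"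
        using 2 unfolding e_def El_def Er_def len powr_add by simp
      also have "\<dots> \<le> w ?a powr \<alpha>' * (w ?b powr (\<alpha> + \<alpha>') * w ?u powr \<alpha>')"
        by (intro mult_left_mono mult_right_mono mono) auto
      finally show ?thesis using 2 ps1 by (simp add: mult_ac)
    next
      case 3
      have "w ?a powr e * w ?b powr e * El * Er = w ?u powr \<alpha>' * (w ?a powr (\<alpha>' + \<alpha>') * w ?x powr \<alpha>')"
        using 3 qs1 unfolding e_def El_def Er_def len powr_add by simp
      also have "\<dots> \<le> w ?u powr \<alpha>' * (w ?a powr (\<alpha> + \<alpha>') * w ?x powr \<alpha>')"
        by (intro mult_left_mono mult_right_mono mono) auto
      finally show ?thesis using 3 by (simp add: mult_ac)
    next
      case 4
      have "w ?a powr e * w ?b powr e * El * Er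
         = w ?a powr (\<alpha> + \<alpha>') * w ?b powr (\<alpha> + \<alpha>') * (w ?x powr \<alpha>' * w ?u powr \<alpha>')"
        using 4 unfolding e_def El_def Er_def len powr_add by simp
      then show ?thesis using 4 by simp
    qed
  qed
  also have "?W l ?i ?x ?a * c * ?W r ?j ?b ?u = ?W (Node ?i ?a ?b l r) ?k ?x ?u"
    using node.hyps(3,4) len(1,4) by (simp add: c_def e_def)
  also have "Vl * Vr * ((if length ps = 1 then 1 else w ?a powr (\<alpha> + \<alpha>')) *
                (if length qs = 1 then 1 else w ?b powr (\<alpha> + \<alpha>')) * (w ?x powr \<alpha>' * w ?u powr \<alpha>'))
     = (\<Prod>v\<in>skeleton_verts (Node ?i ?a ?b l r) ?k. w v powr (\<alpha> + \<alpha>')) * (w ?x powr \<alpha>' * w ?u powr \<alpha>')"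
  proof -
    have vl: "skeleton_verts l ?i \<subseteq> set ps - {?x, ?a}" and vr: "skeleton_verts r ?j \<subseteq> set qs - {?b, ?u}"
      using skeleton_verts_subset node.hyps d assms(3) by blast+
    have "(\<Prod>v\<in>skeleton_verts (Node ?i ?a ?b l r) ?k. w v powr (\<alpha> + \<alpha>'))
      = Vl * Vr * (if length ps = 1 then 1 else w ?a powr (\<alpha> + \<alpha>')) *
        (if length qs = 1 then 1 else w ?b powr (\<alpha> + \<alpha>'))"
      unfolding skeleton_verts.simps len Vl_def Vr_def
    proof (subst prod.union_disjoint, goal_cases)
      case 3
      show ?case using vl vr mem d(3) by (auto split: if_splits)
    next
      case 4
      show ?case
      proof (subst prod.union_disjoint, goal_cases)
        case 3
        show ?case using vl vr mem d(3) by (auto split: if_splits)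
      next
        case 4
        show ?case
          by (subst prod.union_disjoint) (use vl vr d(3) in auto)
      qed auto
    qed auto
    then show ?thesis by (simp add: mult_ac)
  qed
  finally show ?case unfolding hl using len(5) by (simp add: mult.assoc)
qed

section \<open>Sums over skeletons\<close>

lemma mult_double_sum_product:
  fixes c :: "'r::comm_semiring_0"
  shows "c * (\<Sum>a\<in>A. \<Sum>l\<in>B. f a l) * (\<Sum>b\<in>A'. \<Sum>r\<in>B'. g b r)
    = (\<Sum>a\<in>A. \<Sum>b\<in>A'. \<Sum>l\<in>B. \<Sum>r\<in>B'. c * (f a l * g b r))"
proof -
  have "(\<Sum>a\<in>A. \<Sum>l\<in>B. f a l) * (\<Sum>b\<in>A'. \<Sum>r\<in>B'. g b r)
    = (\<Sum>a\<in>A. \<Sum>b\<in>A'. (\<Sum>l\<in>B. f a l) * (\<Sum>r\<in>B'. g b r))"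
    by (rule sum_product)
  also have "\<dots> = (\<Sum>a\<in>A. \<Sum>b\<in>A'. \<Sum>l\<in>B. \<Sum>r\<in>B'. f a l * g b r)"
    by (intro sum.cong refl) (rule sum_product)
  finally have e: "(\<Sum>a\<in>A. \<Sum>l\<in>B. f a l) * (\<Sum>b\<in>A'. \<Sum>r\<in>B'. g b r) = \<dots>" .
  have "c * (\<Sum>a\<in>A. \<Sum>l\<in>B. f a l) * (\<Sum>b\<in>A'. \<Sum>r\<in>B'. g b r)
    = c * (\<Sum>a\<in>A. \<Sum>b\<in>A'. \<Sum>l\<in>B. \<Sum>r\<in>B'. f a l * g b r)"
    unfolding e[symmetric] by (rule mult.assoc)
  then show ?thesis by (simp only: sum_distrib_left)
qed

text \<open>One step of the recursion for finite truncations. The subtrees and split edges of the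
  trees in \<open>F\<close> form finite sets \<open>G\<close> and \<open>V\<close> that do not
  depend on \<open>k\<close>, \<open>x\<close>, \<open>u\<close>. Bounding the edge length below by
  \<open>euclid_dist x u / k\<close> removes \<open>a\<close> and \<open>b\<close> from the edge
  factor, and enlarging the sum to the full product then decouples the two halves.\<close>

lemma skeleton_weight_sum_le:
  fixes F :: "(int ^ 'd) skeleton set"
  assumes "finite F" and C: "0 \<le> C"
    and \<alpha>: "0 \<le> \<alpha>'" "0 \<le> \<alpha>"
  shows "\<exists>G V. finite G \<and> finite V \<and> (\<forall>k x u. R k < euclid_dist x u \<longrightarrow> 0 < euclid_dist x u \<longrightarrow>
    (\<Sum>t\<in>F. skeleton_weight R C \<alpha> \<alpha>' t k x u) \<le>
    (\<Sum>i<k. C * (real k / euclid_dist x u) powr (real CARD('d) * split_exponent \<alpha> \<alpha>' k i) *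
       (\<Sum>a\<in>V. \<Sum>t\<in>G. skeleton_weight R C \<alpha> \<alpha>' t i x a) *
       (\<Sum>b\<in>V. \<Sum>t\<in>G. skeleton_weight R C \<alpha> \<alpha>' t (k - 1 - i) b u)))"
proof -
  let ?w = "skeleton_weight R C \<alpha> \<alpha>'"
  define N where "N = (\<lambda>(i, a, b, l, r). Node i a b l r :: (int ^ 'd) skeleton)"
  define P where "P = {p. N p \<in> F}"
  have injN: "inj N" by (rule injI) (auto simp: N_def split: prod.splits)
  have finP: "finite P"
    using finite_vimageI[OF assms(1) injN] by (simp add: P_def vimage_def)
  define V where "V = (\<lambda>(i, a, b, l, r). a) ` P \<union> (\<lambda>(i, a, b, l, r). b) ` P"
  define G where "G = (\<lambda>(i, a, b, l, r). l) ` P \<union> (\<lambda>(i, a, b, l, r). r) ` P"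
  have finV: "finite V" and finG: "finite G" using finP by (auto simp: V_def G_def)
  have w0: "0 \<le> ?w t k x u" for t k x u using C by (rule skeleton_weight_nonneg)
  have "(\<Sum>t\<in>F. ?w t k x u) \<le>
    (\<Sum>i<k. C * (real k / euclid_dist x u) powr (real CARD('d) * split_exponent \<alpha> \<alpha>' k i) *
       (\<Sum>a\<in>V. \<Sum>t\<in>G. ?w t i x a) * (\<Sum>b\<in>V. \<Sum>t\<in>G. ?w t (k - 1 - i) b u))"
    if xu: "R k < euclid_dist x u" "0 < euclid_dist x u" for k x u
  proof -
    define \<kappa> where "\<kappa> = (\<lambda>i. C * (real k / euclid_dist x u) powr (real CARD('d) * split_exponent \<alpha> \<alpha>' k i))"
    define h where "h = (\<lambda>(i, a, b, l, r). \<kappa> i * (?w l i x a * ?w r (k - 1 - i) b u))"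
    have \<kappa>0: "0 \<le> \<kappa> i" for i using C by (simp add: \<kappa>_def)
    have h0: "0 \<le> h p" for p by (auto simp: h_def split: prod.splits intro!: mult_nonneg_nonneg \<kappa>0 w0)
    have wN: "?w (N p) k x u \<le> h p \<and> (k \<le> fst p \<longrightarrow> ?w (N p) k x u = 0)" for p
    proof -
      obtain i a b l r where p: "p = (i, a, b, l, r)" by (cases p) auto
      show ?thesis
      proof (cases "i < k \<and> euclid_dist x u \<le> real k * euclid_dist a b")
        case False
        then show ?thesis using h0[of p] by (auto simp: p N_def)
      next
        case True
        define e where "e = real CARD('d) * split_exponent \<alpha> \<alpha>' k i"
        have e: "0 \<le> e" using \<alpha> by (simp add: e_def)
        have k: "0 < real k" using True by auto
        have "euclid_dist x u / real k \<le> euclid_dist a b" using True k by (simp add: field_simps)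
        then have "euclid_dist a b powr (- e) \<le> (euclid_dist x u / real k) powr (- e)"
          using xu(2) k e by (intro powr_mono2') auto
        also have "\<dots> = (real k / euclid_dist x u) powr e"
          using xu(2) k by (simp add: powr_minus powr_divide)
        finally have "C * euclid_dist a b powr (- e) \<le> \<kappa> i"
          using C by (simp add: \<kappa>_def e_def mult_left_mono)
        then have "(?w l i x a * ?w r (k - 1 - i) b u) * (C * euclid_dist a b powr (- e))
            \<le> (?w l i x a * ?w r (k - 1 - i) b u) * \<kappa> i"
          by (intro mult_left_mono mult_nonneg_nonneg w0)
        then show ?thesis using True xu by (simp add: p N_def h_def e_def mult_ac)
      qed
    qed
    have FP: "F \<subseteq> insert Leaf (N ` P)"
    proof
      fix t assume "t \<in> F"
      then show "t \<in> insert Leaf (N ` P)"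
      proof (cases t)
        case (Node i a b l r)
        then have "t = N (i, a, b, l, r)" by (simp add: N_def)
        then show ?thesis using \<open>t \<in> F\<close> by (auto simp: P_def)
      qed simp
    qed
    have "(\<Sum>t\<in>F. ?w t k x u) \<le> (\<Sum>t\<in>insert Leaf (N ` P). ?w t k x u)"
      using finP FP w0 by (intro sum_mono2) auto
    also have "\<dots> \<le> ?w Leaf k x u + (\<Sum>t\<in>N ` P. ?w t k x u)"
      using finP w0 by (subst sum.insert_if) auto
    also have "\<dots> = (\<Sum>p\<in>P. ?w (N p) k x u)"
      using xu by (simp add: sum.reindex[OF inj_on_subset[OF injN]])
    also have "\<dots> = (\<Sum>p\<in>{p\<in>P. fst p < k}. ?w (N p) k x u)"
    proof (intro sum.mono_neutral_right ballI)
      fix p assume "p \<in> P - {p\<in>P. fst p < k}"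
      then show "?w (N p) k x u = 0" using wN[of p] by auto
    qed (use finP in auto)
    also have "\<dots> \<le> (\<Sum>p\<in>{p\<in>P. fst p < k}. h p)"
      using wN by (intro sum_mono) auto
    also have "\<dots> \<le> (\<Sum>p\<in>{..<k} \<times> V \<times> V \<times> G \<times> G. h p)"
      proof (intro sum_mono2 h0)
      show "{p\<in>P. fst p < k} \<subseteq> {..<k} \<times> V \<times> V \<times> G \<times> G"
      proof
        fix p assume p: "p \<in> {p\<in>P. fst p < k}"
        obtain i a b l r where e: "p = (i, a, b, l, r)" by (cases p) auto
        have "a \<in> V" "b \<in> V" "l \<in> G" "r \<in> G"
          unfolding V_def G_def using p by (auto simp: e intro: rev_image_eqI)
        then show "p \<in> {..<k} \<times> V \<times> V \<times> G \<times> G" using p by (simp add: e)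
      qed
    qed (use finV finG in auto)
    also have "\<dots> = (\<Sum>i<k. \<Sum>a\<in>V. \<Sum>b\<in>V. \<Sum>l\<in>G. \<Sum>r\<in>G. \<kappa> i * (?w l i x a * ?w r (k - 1 - i) b u))"
      by (simp add: h_def sum.cartesian_product')
    also have "\<dots> = (\<Sum>i<k. \<kappa> i * (\<Sum>a\<in>V. \<Sum>t\<in>G. ?w t i x a) * (\<Sum>b\<in>V. \<Sum>t\<in>G. ?w t (k - 1 - i) b u))"
      by (intro sum.cong refl) (simp only: mult_double_sum_product)
    finally show ?thesis by (simp add: \<kappa>_def)
  qed
  then show ?thesis using finG finV by blast
qed

text \<open>Strong induction on \<open>k\<close>. Both totals are needed at once: in a split the
  left half is summed over its end \<open>a\<close> and the right half over its start
  \<open>b\<close>. The hypothesis on \<open>D\<close> is the resulting recursion, with the near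
  pairs counted by volume and the far pairs by the lattice sum.\<close>

lemma skeleton_weight_total:
  fixes R D :: "nat \<Rightarrow> real"
  assumes C: "0 < C" and \<alpha>: "1 < \<alpha>'" "1 < \<alpha>"
    and lat: "\<And>(x::int ^ 'd) U r \<beta>. \<lbrakk>finite U; 1 \<le> r; \<And>u. u \<in> U \<Longrightarrow> r < euclid_dist x u; \<beta> = \<alpha> \<or> \<beta> = \<alpha>'\<rbrakk>
      \<Longrightarrow> (\<Sum>u\<in>U. euclid_dist x u powr (- (real CARD('d) * \<beta>))) \<le> K * r powr (- (real CARD('d) * (\<beta> - 1)))"
    and R: "R 0 = 0" "\<And>k. 1 \<le> k \<Longrightarrow> 1 \<le> R k"
    and D0: "1 \<le> D 0"
    and D: "\<And>k e. 1 \<le> k \<Longrightarrow> e = split_exponent \<alpha> \<alpha>' k \<Longrightarrow>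
      (3 * R k) ^ CARD('d) + (\<Sum>i<k. C * real k powr (real CARD('d) * e i) * D i * D (k - 1 - i) *
        (K * R k powr (- (real CARD('d) * (e i - 1))))) \<le> D k"
  shows "\<And>F U (x::int ^ 'd). finite F \<Longrightarrow> finite U \<Longrightarrow>
            (\<Sum>u\<in>U. \<Sum>t\<in>F. skeleton_weight R C \<alpha> \<alpha>' t k x u) \<le> D k"
    and "\<And>F U (u::int ^ 'd). finite F \<Longrightarrow> finite U \<Longrightarrow>
            (\<Sum>x\<in>U. \<Sum>t\<in>F. skeleton_weight R C \<alpha> \<alpha>' t k x u) \<le> D k"
    and "\<And>F (x::int ^ 'd) u. finite F \<Longrightarrow> R k < euclid_dist x u \<Longrightarrow> 0 < euclid_dist x u \<Longrightarrow>
            (\<Sum>t\<in>F. skeleton_weight R C \<alpha> \<alpha>' t k x u) \<le>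
            (\<Sum>i<k. C * (real k / euclid_dist x u) powr (real CARD('d) * split_exponent \<alpha> \<alpha>' k i) * D i * D (k - 1 - i))"
proof -
  let ?w = "skeleton_weight R C \<alpha> \<alpha>' :: (int ^ 'd) skeleton \<Rightarrow> _"
  define S where "S = (\<lambda>F k x u. \<Sum>t\<in>F. ?w t k x u)"
  have w0: "0 \<le> ?w t k x u" for t k x u using C by (intro skeleton_weight_nonneg) simp
  have S0: "0 \<le> S F k x u" for F k x u unfolding S_def by (intro sum_nonneg w0)
  define A where "A = (\<lambda>k. (\<forall>F U x. finite F \<longrightarrow> finite U \<longrightarrow> (\<Sum>u\<in>U. S F k x u) \<le> D k) \<and>
     (\<forall>F U u. finite F \<longrightarrow> finite U \<longrightarrow> (\<Sum>x\<in>U. S F k x u) \<le> D k))"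
  have A1: "(\<Sum>u\<in>U. S F k x u) \<le> D k" if "A k" "finite F" "finite U" for k F U x
    using that(1)[unfolded A_def, THEN conjunct1, rule_format, OF that(2,3)] .
  have A2: "(\<Sum>x\<in>U. S F k x u) \<le> D k" if "A k" "finite F" "finite U" for k F U u
    using that(1)[unfolded A_def, THEN conjunct2, rule_format, OF that(2,3)] .
  define B where "B = (\<lambda>k. \<forall>F x u. finite F \<longrightarrow> R k < euclid_dist x u \<longrightarrow> 0 < euclid_dist x u \<longrightarrow>
     S F k x u \<le> (\<Sum>i<k. C * (real k / euclid_dist x u) powr (real CARD('d) * split_exponent \<alpha> \<alpha>' k i) * D i * D (k - 1 - i)))"
  have AB: "B k" if IH: "\<And>j. j < k \<Longrightarrow> A j" for k
    unfolding B_def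
  proof (intro allI impI)
    fix F :: "(int ^ 'd) skeleton set" and x u :: "int ^ 'd" assume F: "finite F" and xu: "R k < euclid_dist x u" "0 < euclid_dist x u"
    have \<alpha>0: "0 \<le> \<alpha>'" "0 \<le> \<alpha>" using \<alpha> by auto
    define P where "P = (\<lambda>G V. \<forall>k x u. R k < euclid_dist x u \<longrightarrow> 0 < euclid_dist x u \<longrightarrow> S F k x u \<le>
      (\<Sum>i<k. C * (real k / euclid_dist x u) powr (real CARD('d) * split_exponent \<alpha> \<alpha>' k i) *
       (\<Sum>a\<in>V. S G i x a) * (\<Sum>b\<in>V. S G (k - 1 - i) b u)))"
    have "\<exists>G V. finite G \<and> finite V \<and> P G V"
      unfolding P_def S_def by (rule skeleton_weight_sum_le[OF F less_imp_le[OF C] \<alpha>0])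
    then obtain G V where GV: "finite G" "finite V" "P G V" by blast
    have "S F k x u \<le> (\<Sum>i<k. C * (real k / euclid_dist x u) powr (real CARD('d) * split_exponent \<alpha> \<alpha>' k i) *
       (\<Sum>a\<in>V. S G i x a) * (\<Sum>b\<in>V. S G (k - 1 - i) b u))"
      by (rule GV(3)[unfolded P_def, rule_format, OF xu])
    also have "\<dots> \<le> (\<Sum>i<k. C * (real k / euclid_dist x u) powr (real CARD('d) * split_exponent \<alpha> \<alpha>' k i) * D i * D (k - 1 - i))"
    proof (intro sum_mono mult_mono mult_nonneg_nonneg sum_nonneg S0)
      fix i assume i: "i \<in> {..<k}"
      have "i < k" "k - 1 - i < k" using i by auto
      then have A: "A i" "A (k - 1 - i)" using IH by blast+
      show *: "(\<Sum>a\<in>V. S G i x a) \<le> D i" "(\<Sum>b\<in>V. S G (k - 1 - i) b u) \<le> D (k - 1 - i)"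
        using A1[OF A(1) GV(1,2)] A2[OF A(2) GV(1,2)] .
      have "0 \<le> (\<Sum>a\<in>V. S G i x a)" by (intro sum_nonneg S0)
      then show "0 \<le> D i" using *(1) by (rule order_trans)
    qed (use C in auto)
    finally show "S F k x u \<le> (\<Sum>i<k. C * (real k / euclid_dist x u) powr (real CARD('d) * split_exponent \<alpha> \<alpha>' k i) * D i * D (k - 1 - i))" .
  qed
  have Ak: "A k" for k
  proof (induction k rule: less_induct)
    case (less k)
    have Bk: "B k" by (rule AB) (rule less)
    \<comment> \<open>Within the threshold every \<open>Node\<close> has weight 0, so at most
      \<open>Leaf\<close> contributes.\<close>
    have near: "S F k x u \<le> 1" if "euclid_dist x u \<le> R k" "finite F" for F x u
    proof -
      have z: "?w t k x u = 0" if "t \<noteq> Leaf" for t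
        using that \<open>euclid_dist x u \<le> R k\<close> by (cases t) auto
      have "S F k x u \<le> S (insert Leaf F) k x u"
        unfolding S_def using that w0 by (intro sum_mono2) auto
      also have "\<dots> = (\<Sum>t\<in>{Leaf}. ?w t k x u)"
        unfolding S_def using that z by (intro sum.mono_neutral_right) auto
      also have "\<dots> \<le> 1" by simp
      finally show ?thesis .
    qed
    have Dnn: "0 \<le> D j" if "j < k" for j
    proof -
      have "A j" using less[OF that] .
      then have "(\<Sum>u\<in>{}. S {} j undefined u) \<le> D j" by (intro A1) auto
      then show ?thesis by simp
    qed
    \<comment> \<open>Stated for an abstract \<open>f\<close>, since it is applied once with the
      start fixed and once with the end fixed; the distance is symmetric.\<close>
    have key: "(\<Sum>u\<in>U. f u) \<le> D k"
      if fU: "finite U" and f1: "\<And>u. euclid_dist x u \<le> R k \<Longrightarrow> f u \<le> 1"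
        and f2: "\<And>u. R k < euclid_dist x u \<Longrightarrow> 0 < euclid_dist x u \<Longrightarrow> f u \<le>
          (\<Sum>i<k. C * (real k / euclid_dist x u) powr (real CARD('d) * split_exponent \<alpha> \<alpha>' k i) * D i * D (k - 1 - i))"
      for U x and f :: "int ^ 'd \<Rightarrow> real"
    proof (cases "k = 0")
      case True
      have e: "f u \<le> (if u = x then 1 else 0)" for u
      proof (cases "u = x")
        case True
        then show ?thesis using f1[of u] R \<open>k = 0\<close> by simp
      next
        case False
        then have "1 \<le> euclid_dist x u" by (intro euclid_dist_ge_1) simp
        then have "f u \<le> 0" using f2[of u] R \<open>k = 0\<close> by simp
        then show ?thesis using False by simp
      qed
      have "(\<Sum>u\<in>U. f u) \<le> (\<Sum>u\<in>U. if u = x then 1 else 0)" using e by (rule sum_mono)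
      also have "\<dots> \<le> 1" using fU by simp
      finally show ?thesis using D0 True by simp
    next
      case False
      then have k: "1 \<le> k" by simp
      note Rk = R(2)[OF k]
      define e where "e = split_exponent \<alpha> \<alpha>' k"
      let ?U1 = "{u\<in>U. euclid_dist x u \<le> R k}" and ?U2 = "{u\<in>U. R k < euclid_dist x u}"
      have "(\<Sum>u\<in>U. f u) = (\<Sum>u\<in>?U1. f u) + (\<Sum>u\<in>?U2. f u)"
      proof -
        have "U = ?U1 \<union> ?U2" by auto
        then have "(\<Sum>u\<in>U. f u) = sum f (?U1 \<union> ?U2)" by (rule arg_cong)
        also have "\<dots> = (\<Sum>u\<in>?U1. f u) + (\<Sum>u\<in>?U2. f u)"
          using fU by (intro sum.union_disjoint) auto
        finally show ?thesis .
      qed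
      also have "(\<Sum>u\<in>?U1. f u) \<le> (3 * R k) ^ CARD('d)"
      proof -
        have "(\<Sum>u\<in>?U1. f u) \<le> (\<Sum>u\<in>?U1. 1)" using f1 by (intro sum_mono) auto
        also have "\<dots> = real (card ?U1)" by simp
        also have "\<dots> \<le> real (card (euclid_ball x (R k)))"
          using finite_euclid_ball[OF Rk] by (intro of_nat_mono card_mono) (auto simp: euclid_ball_def)
        also have "\<dots> \<le> (3 * R k) ^ CARD('d)" by (rule card_euclid_ball_le[OF Rk])
        finally show ?thesis .
      qed
      also have "(\<Sum>u\<in>?U2. f u) \<le> (\<Sum>u\<in>?U2. \<Sum>i<k. C * (real k / euclid_dist x u) powr (real CARD('d) * e i) * D i * D (k - 1 - i))"
        unfolding e_def using Rk by (intro sum_mono f2) auto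
      also have "\<dots> = (\<Sum>i<k. C * real k powr (real CARD('d) * e i) * D i * D (k - 1 - i) *
           (\<Sum>u\<in>?U2. euclid_dist x u powr (- (real CARD('d) * e i))))"
        proof (subst sum.swap, intro sum.cong refl, unfold sum_distrib_left, intro sum.cong refl)
        fix i u
        have "(real k / euclid_dist x u) powr (real CARD('d) * e i)
          = real k powr (real CARD('d) * e i) * euclid_dist x u powr (- (real CARD('d) * e i))"
          by (simp only: powr_divide euclid_dist_nonneg of_nat_0_le_iff powr_minus) (simp only: divide_inverse)
        then show "C * (real k / euclid_dist x u) powr (real CARD('d) * e i) * D i * D (k - 1 - i)
          = C * real k powr (real CARD('d) * e i) * D i * D (k - 1 - i) * euclid_dist x u powr (- (real CARD('d) * e i))"
          by simp
      qed
      also have "\<dots> \<le> (\<Sum>i<k. C * real k powr (real CARD('d) * e i) * D i * D (k - 1 - i) *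
           (K * R k powr (- (real CARD('d) * (e i - 1)))))"
      proof (intro sum_mono mult_left_mono mult_nonneg_nonneg Dnn)
        fix i assume i: "i \<in> {..<k}"
        show "(\<Sum>u\<in>?U2. euclid_dist x u powr (- (real CARD('d) * e i))) \<le> K * R k powr (- (real CARD('d) * (e i - 1)))"
          by (rule lat) (use fU Rk in \<open>auto simp: e_def\<close>)
      qed (use C in auto)
      finally show ?thesis using D[OF k e_def] by linarith
    qed
    show ?case unfolding A_def
    proof (intro conjI allI impI)
      fix F :: "(int ^ 'd) skeleton set" and U :: "(int ^ 'd) set" and x :: "int ^ 'd" assume "finite F" "finite U"
      then show "(\<Sum>u\<in>U. S F k x u) \<le> D k"
        using near Bk[unfolded B_def, rule_format, of F x] by (intro key[of U x]) blast+
    next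
      fix F :: "(int ^ 'd) skeleton set" and U :: "(int ^ 'd) set" and u :: "int ^ 'd" assume "finite F" "finite U"
      then show "(\<Sum>x\<in>U. S F k x u) \<le> D k"
        using near[of _ u F] Bk[unfolded B_def, rule_format, of F _ u]
        by (intro key[of U u]) (simp_all only: euclid_dist_commute[of u])
    qed
  qed
  show "(\<Sum>u\<in>U. \<Sum>t\<in>F. ?w t k x u) \<le> D k" if "finite F" "finite U" for F U x
    using A1[OF Ak that] unfolding S_def .
  show "(\<Sum>x\<in>U. \<Sum>t\<in>F. ?w t k x u) \<le> D k" if "finite F" "finite U" for F U u
    using A2[OF Ak that] unfolding S_def .
  show "(\<Sum>t\<in>F. ?w t k x u) \<le>
    (\<Sum>i<k. C * (real k / euclid_dist x u) powr (real CARD('d) * split_exponent \<alpha> \<alpha>' k i) * D i * D (k - 1 - i))"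
    if "finite F" "R k < euclid_dist x u" "0 < euclid_dist x u" for F x u
    by (rule AB[OF Ak, unfolded B_def S_def, rule_format]) (rule that)+
qed

section \<open>Solving the recursion for the total skeleton weight\<close>

lemma powr_sum_le_concave:
  fixes a b \<theta> :: real
  assumes "0 \<le> a" "0 \<le> b" "0 < \<theta>" "\<theta> \<le> 1"
  shows "a powr \<theta> + b powr \<theta> \<le> 2 powr (1 - \<theta>) * (a + b) powr \<theta>"
proof (cases "a = 0 \<or> b = 0")
  case True
  have "(1::real) \<le> 2 powr (1 - \<theta>)" using assms by (intro ge_one_powr_ge_zero) auto
  then have "1 * (a + b) powr \<theta> \<le> 2 powr (1 - \<theta>) * (a + b) powr \<theta>" by (intro mult_right_mono) auto
  with True assms show ?thesis by auto
next
  case False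
  then have ab: "0 < a" "0 < b" using assms by auto
  \<comment> \<open>Convexity of the power \<open>1 / \<theta>\<close> at the midpoint of
    \<open>a powr \<theta>\<close> and \<open>b powr \<theta>\<close>. Equality holds for
    \<open>a = b\<close>: the balanced split is extremal and its constant fixes the growth
    exponent.\<close>
  define x where "x = a powr \<theta>"
  define y where "y = b powr \<theta>"
  define p where "p = 1 / \<theta>"
  have p: "1 \<le> p" using assms by (simp add: p_def)
  have "((1 - 1/2) *\<^sub>R x + (1/2) *\<^sub>R y) powr p \<le> (1 - 1/2) * x powr p + (1/2) * y powr p"
    by (rule convex_onD[OF powr_convex[OF p]]) (use ab in \<open>auto simp: x_def y_def\<close>)
  also have "\<dots> = (a + b) / 2"
    using assms by (simp add: x_def y_def p_def powr_powr)
  finally have "((x + y) / 2) powr p \<le> (a + b) / 2" by (simp add: add_divide_distrib)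
  then have "(((x + y) / 2) powr p) powr \<theta> \<le> ((a + b) / 2) powr \<theta>"
    using assms by (intro powr_mono2) auto
  then have "(x + y) / 2 \<le> ((a + b) / 2) powr \<theta>"
    using assms by (simp add: powr_powr p_def x_def y_def)
  then have "x + y \<le> 2 * (a + b) powr \<theta> / 2 powr \<theta>"
    using assms by (simp add: powr_divide mult.commute)
  then show ?thesis by (simp add: x_def y_def powr_diff)
qed

lemma skeleton_radii_exist:
  fixes d :: nat
  assumes d: "1 \<le> d" and C: "0 < C" and K: "0 < K" and \<alpha>: "1 < \<alpha>'" "\<alpha>' \<le> \<alpha>" "\<alpha> < 2"
    and \<theta>: "log 2 (2 / \<alpha>) < \<theta>" "\<theta> \<le> 1"
  obtains A \<delta> where "0 < A" "0 < \<delta>" "\<delta> < 1"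
    "\<And>R D k e. R = (\<lambda>k::nat. if k = 0 then 0 else exp (A * (1 - \<delta>) * real k powr \<theta> / real d)) \<Longrightarrow>
      D = (\<lambda>k::nat. exp (A * real k powr \<theta>)) \<Longrightarrow> 1 \<le> k \<Longrightarrow>
      e = split_exponent \<alpha> \<alpha>' k \<Longrightarrow>
      (3 * R k) ^ d + (\<Sum>i<k. C * real k powr (real d * e i) * D i * D (k - 1 - i) *
        (K * R k powr (- (real d * (e i - 1))))) \<le> D k"
proof -
  have log0: "0 < log 2 (2 / \<alpha>)" using \<alpha> by simp
  have \<theta>0: "0 < \<theta>" using log0 \<theta> by linarith
  \<comment> \<open>Chosen so that \<open>2 powr (1 - \<theta>) = \<alpha> * (1 - \<delta>)\<close>.
    A balanced split then has exponent at most \<open>\<alpha> * (1 - \<delta>) * y - (1 - \<delta>)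
    * (\<alpha> - 1) * y = (1 - \<delta>) * y\<close> up to the factor \<open>A\<close>, the same as
    the volume \<open>R k ^ d\<close>. The assumption on \<open>\<theta>\<close> is what makes it
    positive.\<close>
  define \<delta> where "\<delta> = 1 - 2 powr (1 - \<theta>) / \<alpha>"
  have "1 - \<theta> < log 2 \<alpha>" using \<theta>(1) \<alpha> by (simp add: log_divide)
  then have "2 powr (1 - \<theta>) < \<alpha>" using \<alpha> by (simp add: less_log_iff)
  then have \<delta>: "0 < \<delta>" "\<delta> < 1" using \<alpha> by (auto simp: \<delta>_def)
  \<comment> \<open>The relative gain in the exponent common to all terms: \<open>\<delta>\<close>
    for the volume and the proper splits, the second entry for splits with an empty half.\<close>
  define \<eta> where "\<eta> = min \<delta> ((1 - \<delta>) * (\<alpha>' - 1))"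
  have \<eta>: "0 < \<eta>" "\<eta> \<le> \<delta>" "\<eta> \<le> (1 - \<delta>) * (\<alpha>' - 1)" using \<delta> \<alpha> by (auto simp: \<eta>_def)
  define C1 where "C1 = 3 ^ d + C * K"
  \<comment> \<open>\<open>2 * d\<close> bounds the power of \<open>k\<close> in the edge factor,
    since the exponents are at most 2; the extra 1 counts the split positions.\<close>
  define p where "p = 2 * real d + 1"
  have C1: "1 \<le> C1" using C K by (simp add: C1_def add_increasing2)
  \<comment> \<open>\<open>exp (A * \<eta> * y)\<close> has to swallow the prefactor
    \<open>C1 * k powr p\<close>; this works because
    \<open>p * ln k \<le> p / \<theta> * k powr \<theta>\<close>.\<close>
  define A where "A = (ln C1 + p / \<theta> + 1) / \<eta>"
  have p0: "0 < p" by (simp add: p_def)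
  have A: "0 < A" unfolding A_def using C1 \<theta>0 \<eta> p0 by (intro divide_pos_pos add_nonneg_pos add_nonneg_nonneg) auto
  show ?thesis
  proof (rule that[OF A \<delta>])
    fix R D :: "nat \<Rightarrow> real" and k e
    assume R: "R = (\<lambda>k. if k = 0 then 0 else exp (A * (1 - \<delta>) * real k powr \<theta> / real d))"
      and D: "D = (\<lambda>k. exp (A * real k powr \<theta>))" and k: "1 \<le> k"
      and e: "e = split_exponent \<alpha> \<alpha>' k"
    define y where "y = real k powr \<theta>"
    have y1: "1 \<le> y" using k \<theta>0 by (simp add: y_def ge_one_powr_ge_zero)
    have Rk: "R k = exp (A * (1 - \<delta>) * y / real d)" using k by (simp add: R y_def)
    have k0: "0 < real k" using k by simp
    have t1: "(3 * R k) ^ d \<le> 3 ^ d * exp (A * (1 - \<eta>) * y)"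
    proof -
      have "R k ^ d = exp (A * (1 - \<delta>) * y)"
        using d by (simp add: Rk flip: exp_of_nat_mult)
      also have "\<dots> \<le> exp (A * (1 - \<eta>) * y)"
        using A y1 \<eta> by (simp add: mult_mono)
      finally show ?thesis by (simp add: power_mult_distrib)
    qed
    have t2: "C * real k powr (real d * e i) * D i * D (k - 1 - i) * (K * R k powr (- (real d * (e i - 1))))
        \<le> C * K * real k powr (2 * real d) * exp (A * (1 - \<eta>) * y)" if i: "i < k" for i
    proof -
      have ei: "e i \<le> 2" "0 \<le> e i" using \<alpha> by (auto simp: e)
      have Rp: "R k powr (- (real d * (e i - 1))) = exp (- (A * (1 - \<delta>) * y * (e i - 1)))"
        using d by (simp add: Rk powr_def)
      have main: "real i powr \<theta> + real (k - 1 - i) powr \<theta> - (1 - \<delta>) * y * (e i - 1) \<le> (1 - \<eta>) * y"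
      \<comment> \<open>With an empty half \<open>D i * D (k - 1 - i)\<close> is almost
        \<open>D k\<close> itself. The only gain is the power of \<open>R k\<close>, and it is a
        gain because \<alpha>' exceeds 1.\<close>
      proof (cases "i = 0 \<or> Suc i = k")
        case True
        then have "real i powr \<theta> + real (k - 1 - i) powr \<theta> = real (k - 1) powr \<theta>" using \<theta>0 by auto
        also have "\<dots> \<le> y" unfolding y_def using \<theta>0 by (intro powr_mono2) auto
        finally have "real i powr \<theta> + real (k - 1 - i) powr \<theta> - (1 - \<delta>) * y * (e i - 1) \<le> y - ((1 - \<delta>) * (\<alpha>' - 1)) * y"
          using True by (simp add: e mult_ac)
        also have "\<dots> \<le> y - \<eta> * y" using \<eta>(3) y1 by (intro diff_left_mono mult_right_mono) auto
        finally show ?thesis by (simp add: algebra_simps)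
      next
        case False
        have "real i powr \<theta> + real (k - 1 - i) powr \<theta> \<le> 2 powr (1 - \<theta>) * (real i + real (k - 1 - i)) powr \<theta>"
          using \<theta>0 \<theta> by (intro powr_sum_le_concave) auto
        also have "\<dots> \<le> 2 powr (1 - \<theta>) * y"
          unfolding y_def using \<theta>0 i by (intro mult_left_mono powr_mono2) auto
        also have "2 powr (1 - \<theta>) = \<alpha> * (1 - \<delta>)" using \<alpha> by (simp add: \<delta>_def)
        finally have "real i powr \<theta> + real (k - 1 - i) powr \<theta> - (1 - \<delta>) * y * (e i - 1) \<le> (1 - \<delta>) * y"
          using False by (simp add: e algebra_simps)
        also have "\<dots> \<le> (1 - \<eta>) * y" using \<eta> y1 by (intro mult_right_mono) auto
        finally show ?thesis .
      qed
      have "C * real k powr (real d * e i) * D i * D (k - 1 - i) * (K * R k powr (- (real d * (e i - 1))))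
        = (C * K * real k powr (real d * e i)) * exp (A * (real i powr \<theta> + real (k - 1 - i) powr \<theta> - (1 - \<delta>) * y * (e i - 1)))"
        unfolding Rp D by (simp add: exp_add exp_diff exp_minus algebra_simps divide_inverse)
      also have "\<dots> \<le> (C * K * real k powr (2 * real d)) * exp (A * ((1 - \<eta>) * y))"
      proof (rule mult_mono)
        have "real d * e i \<le> 2 * real d" using mult_left_mono[OF ei(1), of "real d"] by simp
        then have "real k powr (real d * e i) \<le> real k powr (2 * real d)" using k by (intro powr_mono) auto
        then show "C * K * real k powr (real d * e i) \<le> C * K * real k powr (2 * real d)"
          using C K by (intro mult_left_mono) auto
        show "exp (A * (real i powr \<theta> + real (k - 1 - i) powr \<theta> - (1 - \<delta>) * y * (e i - 1))) \<le> exp (A * ((1 - \<eta>) * y))"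
          using A main by simp
      qed (use k C K in auto)
      finally show ?thesis by (simp add: mult.assoc)
    qed
    have "(3 * R k) ^ d + (\<Sum>i<k. C * real k powr (real d * e i) * D i * D (k - 1 - i) *
        (K * R k powr (- (real d * (e i - 1)))))
      \<le> 3 ^ d * exp (A * (1 - \<eta>) * y) + (\<Sum>i<k. C * K * real k powr (2 * real d) * exp (A * (1 - \<eta>) * y))"
      using t1 t2 by (intro add_mono sum_mono) auto
    also have "\<dots> = (3 ^ d + C * K * real k powr p) * exp (A * (1 - \<eta>) * y)"
      using k0 by (simp add: p_def powr_add algebra_simps)
    also have "\<dots> \<le> (C1 * real k powr p) * exp (A * (1 - \<eta>) * y)"
    proof (rule mult_right_mono)
      have "(1::real) \<le> real k powr p" using k p0 by (intro ge_one_powr_ge_zero) auto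
      then have "3 ^ d * 1 \<le> 3 ^ d * real k powr p" by (intro mult_left_mono) auto
      then show "3 ^ d + C * K * real k powr p \<le> C1 * real k powr p" by (simp add: C1_def algebra_simps)
    qed simp
    also have "C1 * real k powr p \<le> exp (A * \<eta> * y)"
    proof -
      have "ln (real k powr \<theta>) \<le> real k powr \<theta>" using k0 by (intro ln_bound) auto
      then have "\<theta> * ln (real k) \<le> y" using k0 by (simp add: y_def ln_powr)
      then have "p / \<theta> * (\<theta> * ln (real k)) \<le> p / \<theta> * y" using p0 \<theta>0 by (intro mult_left_mono) auto
      then have 1: "p * ln (real k) \<le> p / \<theta> * y" using \<theta>0 by simp
      have 2: "ln C1 \<le> ln C1 * y" using y1 C1 by (simp add: mult_le_cancel_left1)
      have "C1 * real k powr p = exp (ln C1 + p * ln (real k))"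
        using C1 k0 by (simp add: exp_add powr_def)
      also have "\<dots> \<le> exp ((ln C1 + p / \<theta>) * y)" using 1 2 by (simp add: algebra_simps)
      also have "\<dots> \<le> exp (A * \<eta> * y)"
        using \<eta> y1 by (simp add: A_def)
      finally show ?thesis .
    qed
    finally have "(3 * R k) ^ d + (\<Sum>i<k. C * real k powr (real d * e i) * D i * D (k - 1 - i) *
        (K * R k powr (- (real d * (e i - 1))))) \<le> exp (A * \<eta> * y) * exp (A * (1 - \<eta>) * y)"
      by (simp add: mult_right_mono)
    also have "\<dots> = D k" by (simp add: D y_def algebra_simps flip: exp_add)
    finally show "(3 * R k) ^ d + (\<Sum>i<k. C * real k powr (real d * e i) * D i * D (k - 1 - i) *
        (K * R k powr (- (real d * (e i - 1))))) \<le> D k" .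
  qed
qed

section \<open>Graph balls and weights\<close>

text \<open>Lets the union over infinitely many skeletons be bounded by the finite truncations
  alone.\<close>

lemma (in finite_measure) measure_UN_le_of_finite_sums:
  assumes I: "countable I" and A: "\<And>i. i \<in> I \<Longrightarrow> A i \<in> sets M"
    and B: "\<And>F. finite F \<Longrightarrow> F \<subseteq> I \<Longrightarrow> (\<Sum>i\<in>F. measure M (A i)) \<le> B"
  shows "measure M (\<Union>i\<in>I. A i) \<le> B"
proof (cases "I = {}")
  case True
  then show ?thesis using B[of "{}"] by simp
next
  case False
  define F where "F = (\<lambda>n. from_nat_into I ` {..<n::nat})"
  have FI: "F n \<subseteq> I" for n using from_nat_into[OF False] by (auto simp: F_def)
  define U where "U = (\<lambda>n. \<Union>i\<in>F n. A i)"
  have U: "range U \<subseteq> sets M" using FI A unfolding U_def F_def by (fastforce intro!: sets.finite_UN)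
  have incU: "incseq U" by (rule incseq_SucI) (auto simp: U_def F_def lessThan_Suc)
  have "(\<Union>n. U n) = (\<Union>i\<in>I. A i)"
  proof -
    have "(\<Union>n. F n) = range (from_nat_into I)" by (auto simp: F_def)
    also have "\<dots> = I" by (rule range_from_nat_into[OF False I])
    finally show ?thesis by (auto simp: U_def)
  qed
  moreover have "(\<lambda>n. measure M (U n)) \<longlonglongrightarrow> measure M (\<Union>n. U n)"
    using U incU by (rule finite_Lim_measure_incseq)
  moreover have "measure M (U n) \<le> B" for n
  proof -
    have "measure M (U n) \<le> (\<Sum>i\<in>F n. measure M (A i))"
      unfolding U_def using FI A by (intro finite_measure_subadditive_finite) (auto simp: F_def)
    also have "\<dots> \<le> B" using FI by (intro B) (auto simp: F_def)
    finally show ?thesis .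
  qed
  ultimately show ?thesis by (metis LIMSEQ_le_const2)
qed

text \<open>Loops are erased because self-avoidance is used twice later: it makes the skeleton
  vertices distinct, so that the expectation of their weights factorizes, and it prevents a pair
  from occurring in both orientations.\<close>

lemma relpow_imp_distinct_path:
  assumes "(x, y) \<in> E ^^ n"
  shows "\<exists>vs. vs \<noteq> [] \<and> distinct vs \<and> hd vs = x \<and> last vs = y \<and> length vs \<le> Suc n \<and> set (zip vs (tl vs)) \<subseteq> E"
  using assms
proof (induction n arbitrary: y)
  case 0
  then show ?case by (intro exI[of _ "[x]"]) auto
next
  case (Suc n)
  then obtain z where z: "(x, z) \<in> E ^^ n" "(z, y) \<in> E" by auto
  from Suc.IH[OF z(1)] obtain vs where vs: "vs \<noteq> []" "distinct vs" "hd vs = x" "last vs = z"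
    "length vs \<le> Suc n" "set (zip vs (tl vs)) \<subseteq> E" by blast
  show ?case
  proof (cases "y \<in> set vs")
    case False
    then show ?thesis
      using vs z by (intro exI[of _ "vs @ [y]"]) (auto simp: zip_tl_append simp del: tl_append2)
  next
    case True
    then obtain as bs where ab: "vs = as @ y # bs" by (auto simp: in_set_conv_decomp)
    have "set (zip (as @ [y]) (tl (as @ [y]))) \<subseteq> set (zip vs (tl vs))"
    proof (cases "bs = []")
      case False
      then have "zip ((as @ [y]) @ bs) (tl ((as @ [y]) @ bs))
          = zip (as @ [y]) (tl (as @ [y])) @ (last (as @ [y]), hd bs) # zip bs (tl bs)"
        by (intro zip_tl_append) auto
      then show ?thesis by (auto simp: ab)
    qed (simp add: ab)
    moreover have "hd (as @ [y]) = x" using vs ab by (cases as) auto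
    ultimately show ?thesis
      using vs ab by (intro exI[of _ "as @ [y]"]) auto
  qed
qed

lemma mem_graph_ball_iff: "y \<in> graph_ball E x k \<longleftrightarrow> (\<exists>n\<le>k. (x, y) \<in> E ^^ n)"
proof
  assume "y \<in> graph_ball E x k"
  then have le: "(INF n\<in>{n. (x, y) \<in> E ^^ n}. enat n) \<le> enat k"
    by (simp add: graph_ball_def graph_dist_def)
  have ne: "{n. (x, y) \<in> E ^^ n} \<noteq> {}"
  proof
    assume "{n. (x, y) \<in> E ^^ n} = {}"
    with le show False by (simp add: top_enat_def)
  qed
  then have "Inf (enat ` {n. (x, y) \<in> E ^^ n}) \<in> enat ` {n. (x, y) \<in> E ^^ n}"
    by (metis image_is_empty wellorder_InfI ex_in_conv)
  with le show "\<exists>n\<le>k. (x, y) \<in> E ^^ n" by auto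
next
  assume "\<exists>n\<le>k. (x, y) \<in> E ^^ n"
  then obtain n where n: "n \<le> k" "(x, y) \<in> E ^^ n" by blast
  then have "(INF n\<in>{n. (x, y) \<in> E ^^ n}. enat n) \<le> enat n" by (intro INF_lower) simp
  also have "\<dots> \<le> enat k" using n by simp
  finally show "y \<in> graph_ball E x k" by (simp add: graph_ball_def graph_dist_def)
qed

lemma connection_prob_nonneg: "0 < lam \<Longrightarrow> 0 \<le> connection_prob \<alpha> lam w x y"
  by (simp add: connection_prob_def)

lemma connection_prob_le_1: "connection_prob \<alpha> lam w x y \<le> 1"
  by (simp add: connection_prob_def)

lemma connection_prob_commute: "connection_prob \<alpha> lam w x y = connection_prob \<alpha> lam w y x"
  by (simp add: connection_prob_def euclid_dist_commute mult.commute)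

lemma connection_prob_mono:
  assumes "0 \<le> \<alpha>" "0 < lam" "\<And>v. 0 \<le> w v" "\<And>v. w v \<le> w' v"
  shows "connection_prob \<alpha> lam w x y \<le> connection_prob \<alpha> lam w' x y"
  unfolding connection_prob_def using assms
  by (intro min.mono order_refl mult_left_mono powr_mono2 divide_right_mono mult_mono
      divide_nonneg_nonneg mult_nonneg_nonneg) (auto intro: order_trans)

lemma connection_prob_le_powr:
  fixes a b :: "int ^ 'd"
  assumes "0 < lam" "0 < e" "e \<le> \<alpha>" "\<And>v. 1 \<le> w v" "a \<noteq> b"
  shows "connection_prob \<alpha> lam w a b
    \<le> max 1 lam * euclid_dist a b powr (- (real CARD('d) * e)) * (w a powr e * w b powr e)"
proof -
  have d1: "1 \<le> euclid_dist a b" using assms(5) by (rule euclid_dist_ge_1)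
  have w0: "0 < w v" for v using assms(4)[of v] by linarith
  define s where "s = w a * w b / euclid_dist a b ^ CARD('d)"
  have s: "0 < s" unfolding s_def using w0 d1 by (intro divide_pos_pos mult_pos_pos zero_less_power) auto
  have "connection_prob \<alpha> lam w a b \<le> max 1 lam * s powr e"
  proof (cases "s \<le> 1")
    case True
    then have "s powr \<alpha> \<le> s powr e" using s assms by (intro powr_mono') auto
    then have "lam * s powr \<alpha> \<le> max 1 lam * s powr e" using assms by (intro mult_mono) auto
    then show ?thesis by (auto simp: connection_prob_def s_def)
  next
    case False
    then have "1 \<le> s powr e" using assms by (intro ge_one_powr_ge_zero) auto
    then have "1 * 1 \<le> max 1 lam * s powr e" by (intro mult_mono) auto
    then show ?thesis by (auto simp: connection_prob_def)
  qed
  also have "s powr e = euclid_dist a b powr (- (real CARD('d) * e)) * (w a powr e * w b powr e)"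
    using w0[of a] w0[of b] d1
    by (simp add: s_def powr_divide powr_mult powr_minus powr_powr flip: powr_realpow) (simp add: divide_inverse)
  finally show ?thesis by (simp add: mult.assoc)
qed

section \<open>Moments of the weights and the probability of a single skeleton\<close>

context scale_free_percolation
begin

lemma random_variable_W [measurable]: "random_variable borel (W v)"
  using weights_indep by (simp add: indep_vars_def)

lemma AE_weights_ge_1: "AE \<omega> in M. \<forall>v. 1 \<le> W v \<omega>"
proof -
  have "AE \<omega> in M. 1 \<le> W v \<omega>" for v
  proof -
    have "prob {\<omega> \<in> space M. 1 \<le> W v \<omega>} = 1" using weights_tail[of 1 v] by simp
    then show ?thesis by (subst (asm) prob_Collect_eq_1) auto
  qed
  then show ?thesis by (subst AE_all_countable) auto
qed

lemma weight_moment: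
  assumes "0 < \<rho>" "\<rho> < \<tau> - 1"
  obtains m where "1 \<le> m" "\<And>v. integrable M (\<lambda>\<omega>. W v \<omega> powr \<rho>)" "\<And>v. (\<integral>\<omega>. W v \<omega> powr \<rho> \<partial>M) \<le> m"
proof -
  \<comment> \<open>Ratio of a geometric series: the weights between \<open>2 ^ j\<close> and
    \<open>2 ^ (j + 1)\<close> contribute at most \<open>2 powr ((j + 1) * \<rho>)\<close> times the
    tail \<open>2 powr (j * (1 - \<tau>))\<close>.\<close>
  define c where "c = 2 powr (\<rho> - (\<tau> - 1))"
  have c: "0 < c" "c < 1" using assms by (auto simp: c_def powr_less_one)
  define m where "m = max 1 (2 powr \<rho> * (1 / (1 - c)))"
  have le_suminf: "f j \<le> (\<Sum>j. f j)" for f :: "nat \<Rightarrow> ennreal" and j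
    using sum_le_suminf[of f "{j}"] by simp
  have m: "1 \<le> m" by (simp add: m_def)
  have nn: "(\<integral>\<^sup>+\<omega>. ennreal (W v \<omega> powr \<rho>) \<partial>M) \<le> ennreal m" for v
  proof -
    have "(\<integral>\<^sup>+\<omega>. ennreal (W v \<omega> powr \<rho>) \<partial>M)
      \<le> (\<integral>\<^sup>+\<omega>. (\<Sum>j. ennreal (2 powr ((real j + 1) * \<rho>)) * indicator {\<omega> \<in> space M. 2 ^ j \<le> W v \<omega>} \<omega>) \<partial>M)"
    proof (rule nn_integral_mono_AE)
      show "AE \<omega> in M. ennreal (W v \<omega> powr \<rho>)
        \<le> (\<Sum>j. ennreal (2 powr ((real j + 1) * \<rho>)) * indicator {\<omega> \<in> space M. 2 ^ j \<le> W v \<omega>} \<omega>)"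
        using AE_weights_ge_1 AE_space
      proof eventually_elim
        case (elim \<omega>)
        define w where "w = W v \<omega>"
        have w: "1 \<le> w" using elim by (simp add: w_def)
        define j where "j = nat \<lfloor>log 2 w\<rfloor>"
        have l0: "0 \<le> log 2 w" using w by simp
        have "real j \<le> log 2 w" using l0 by (simp add: j_def)
        then have "2 ^ j \<le> w" using w by (simp add: le_log_iff powr_realpow)
        moreover have "w \<le> 2 powr (real j + 1)"
        proof -
          have "log 2 w \<le> real j + 1" using l0 unfolding j_def by linarith
          then show ?thesis using w by (simp add: log_le_iff)
        qed
        then have "w powr \<rho> \<le> 2 powr ((real j + 1) * \<rho>)"
          using w assms by (simp add: powr_powr[symmetric] powr_mono2)
        ultimately have "ennreal (w powr \<rho>)
           \<le> ennreal (2 powr ((real j + 1) * \<rho>)) * indicator {\<omega> \<in> space M. 2 ^ j \<le> W v \<omega>} \<omega>"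
          using elim by (auto simp: w_def intro!: ennreal_leI)
        also have "\<dots> \<le> (\<Sum>j. ennreal (2 powr ((real j + 1) * \<rho>)) * indicator {\<omega> \<in> space M. 2 ^ j \<le> W v \<omega>} \<omega>)"
          by (rule le_suminf)
        finally show ?case by (simp add: w_def)
      qed
    qed
    also have "\<dots> = (\<Sum>j. ennreal (2 powr ((real j + 1) * \<rho>)) * emeasure M {\<omega> \<in> space M. 2 ^ j \<le> W v \<omega>})"
      by (subst nn_integral_suminf) (auto simp: nn_integral_cmult_indicator)
    also have "\<dots> = (\<Sum>j. ennreal (2 powr \<rho> * c ^ j))"
    proof (rule suminf_cong)
      fix j :: nat
      have "prob {\<omega> \<in> space M. 2 ^ j \<le> W v \<omega>} = (2 ^ j) powr (1 - \<tau>)"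
        using weights_tail[of "2 ^ j" v] by simp
      then have "emeasure M {\<omega> \<in> space M. 2 ^ j \<le> W v \<omega>} = ennreal (2 powr (real j * (1 - \<tau>)))"
        by (simp add: emeasure_eq_measure powr_powr flip: powr_realpow)
      moreover have "2 powr ((real j + 1) * \<rho>) * 2 powr (real j * (1 - \<tau>)) = 2 powr \<rho> * c ^ j"
        by (simp add: c_def powr_powr algebra_simps flip: powr_realpow powr_add)
      ultimately show "ennreal (2 powr ((real j + 1) * \<rho>)) * emeasure M {\<omega> \<in> space M. 2 ^ j \<le> W v \<omega>} = ennreal (2 powr \<rho> * c ^ j)"
        by (simp flip: ennreal_mult)
    qed
    also have "\<dots> = ennreal (2 powr \<rho> * (1 / (1 - c)))"
      using c by (subst suminf_ennreal2) (auto simp: suminf_mult suminf_geometric summable_geometric intro!: summable_mult)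
    also have "\<dots> \<le> ennreal m" by (intro ennreal_leI) (simp add: m_def)
    finally show ?thesis .
  qed
  have int: "integrable M (\<lambda>\<omega>. W v \<omega> powr \<rho>)" for v
    using nn[of v] by (intro integrableI_bounded) (auto simp: order_le_less_trans)
  have "(\<integral>\<omega>. W v \<omega> powr \<rho> \<partial>M) \<le> m" for v
    using nn[of v] m int[of v] by (simp add: nn_integral_eq_integral)
  then show ?thesis using that m int by blast
qed

lemma prob_long_edges:
  assumes "finite S" "S \<inter> S\<inverse> = {}"
  shows "prob {\<omega> \<in> space M. S \<subseteq> L \<omega>} = (\<integral>\<omega>. (\<Prod>(x, y)\<in>S. connection_prob \<alpha> lam (\<lambda>v. W v \<omega>) x y) \<partial>M)"
proof -
  let ?F = "vimage_algebra (space M) (\<lambda>\<omega> x. W x \<omega>) (Pi\<^sub>M UNIV (\<lambda>_. borel))"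
  have "(\<lambda>\<omega> x. W x \<omega>) \<in> measurable M (Pi\<^sub>M UNIV (\<lambda>_. borel))"
    by (rule measurable_PiM_single') auto
  then have "subalgebra M ?F"
    unfolding subalgebra_def by (simp add: measurable_iff_sets)
  then interpret F: sigma_finite_subalgebra M ?F
    by (rule finite_measure_subalgebra_is_sigma_finite[OF finite_measure_subalgebra.intro, OF finite_measure_axioms finite_measure_subalgebra_axioms.intro])
  have "{\<omega> \<in> space M. \<forall>e\<in>S. e \<in> L \<omega>} \<in> events"
    using assms(1) edges_measurable by (intro sets.sets_Collect_finite_All) auto
  then have A: "{\<omega> \<in> space M. S \<subseteq> L \<omega>} \<in> events" by (simp add: subset_eq)
  then have int: "integrable M (indicator {\<omega> \<in> space M. S \<subseteq> L \<omega>} :: _ \<Rightarrow> real)"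
    by (intro integrable_real_indicator) (auto simp: emeasure_eq_measure)
  have "prob {\<omega> \<in> space M. S \<subseteq> L \<omega>} = (\<integral>\<omega>. real_cond_exp M ?F (indicator {\<omega> \<in> space M. S \<subseteq> L \<omega>}) \<omega> \<partial>M)"
    using F.real_cond_exp_int(2)[OF int] A by simp
  also have "\<dots> = (\<integral>\<omega>. (\<Prod>(x, y)\<in>S. connection_prob \<alpha> lam (\<lambda>v. W v \<omega>) x y) \<partial>M)"
  proof (rule integral_cong_AE)
    show "(\<lambda>\<omega>. \<Prod>(x, y)\<in>S. connection_prob \<alpha> lam (\<lambda>v. W v \<omega>) x y) \<in> borel_measurable M"
      unfolding connection_prob_def case_prod_unfold by measurable
  qed (use edges_cond_indep[OF assms] in auto)
  finally show ?thesis .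
qed


text \<open>Given the weights, the probability is a product over edges, which
  \<open>skeleton_prod_le\<close> turns into a product of powers of weights at distinct vertices.
  Independence gives at most \<open>m\<close> per vertex: the interior vertices are absorbed into
  \<open>C\<close>, and \<open>m\<^sup>2\<close> in front pays for the two endpoints.\<close>

lemma prob_skeleton_le:
  fixes t :: "(int ^ 'd) skeleton"
  assumes sk: "skeleton_of R vs t" "distinct vs" "R 0 = 0"
    and \<alpha>': "0 < \<alpha>'" "\<alpha>' \<le> \<alpha>"
    and m: "1 \<le> m" "\<And>v. integrable M (\<lambda>\<omega>. W v \<omega> powr (\<alpha> + \<alpha>'))"
      "\<And>v. (\<integral>\<omega>. W v \<omega> powr (\<alpha> + \<alpha>') \<partial>M) \<le> m"
  shows "prob {\<omega> \<in> space M. skeleton_edges t \<subseteq> sfp_graph L \<omega>}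
    \<le> m\<^sup>2 * skeleton_weight R (max 1 lam * m\<^sup>2) \<alpha> \<alpha>' t (length vs - 1) (hd vs) (last vs)"
proof -
  define k where "k = length vs - 1"
  define C where "C = max 1 lam"
  have C: "1 \<le> C" by (simp add: C_def)
  define w where "w = skeleton_weight R C \<alpha> \<alpha>' t k (hd vs) (last vs)"
  have w0: "0 \<le> w" unfolding w_def using C by (intro skeleton_weight_nonneg) simp
  \<comment> \<open>Grid edges are present with certainty and count as 1. The power bound still
    covers them, since their length is 1 and both the constant and the weights are at least
    1.\<close>
  define q where "q = (\<lambda>\<omega> a b. if euclid_dist a b = 1 then 1 else connection_prob \<alpha> lam (\<lambda>v. W v \<omega>) a b)"
  define V where "V = skeleton_verts t k \<union> {hd vs, last vs}"
  have finV: "finite V" by (simp add: V_def)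
  have ne: "vs \<noteq> []" using sk(1) by (rule skeleton_of_nonempty)
  let ?S = "skeleton_edges t" and ?G = "{e. euclid_dist (fst e) (snd e) = 1} :: (int ^ 'd) rel"
  have anti: "(?S - ?G) \<inter> (?S - ?G)\<inverse> = {}" using skeleton_edges_antisym[OF sk(1,2)] by auto
  have lamp: "0 < lam" "0 < \<alpha>" using params by auto
  have cp0: "0 \<le> connection_prob \<alpha> lam v a b" for v a b
    using lamp by (simp add: connection_prob_nonneg)
  have "{\<omega> \<in> space M. ?S \<subseteq> sfp_graph L \<omega>} = {\<omega> \<in> space M. ?S - ?G \<subseteq> L \<omega>}"
    by (auto simp: sfp_graph_def grid_edges_def)
  then have "prob {\<omega> \<in> space M. ?S \<subseteq> sfp_graph L \<omega>}
     = (\<integral>\<omega>. (\<Prod>(x, y)\<in>?S - ?G. connection_prob \<alpha> lam (\<lambda>v. W v \<omega>) x y) \<partial>M)"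
    using prob_long_edges[OF _ anti] by simp
  also have "\<dots> \<le> (\<integral>\<omega>. w * (\<Prod>v\<in>V. W v \<omega> powr (\<alpha> + \<alpha>')) \<partial>M)"
  proof (rule integral_mono_AE)
    show "integrable M (\<lambda>\<omega>. \<Prod>(x, y)\<in>?S - ?G. connection_prob \<alpha> lam (\<lambda>v. W v \<omega>) x y)"
    proof (rule integrable_const_bound[where B = 1])
      show "(\<lambda>\<omega>. \<Prod>(x, y)\<in>?S - ?G. connection_prob \<alpha> lam (\<lambda>v. W v \<omega>) x y) \<in> borel_measurable M"
        unfolding connection_prob_def case_prod_unfold by measurable
      show "AE \<omega> in M. norm (\<Prod>(x, y)\<in>?S - ?G. connection_prob \<alpha> lam (\<lambda>v. W v \<omega>) x y) \<le> 1"
      proof (rule AE_I2)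
        fix \<omega>
        have "0 \<le> (\<Prod>(x, y)\<in>?S - ?G. connection_prob \<alpha> lam (\<lambda>v. W v \<omega>) x y)"
          using cp0 by (intro prod_nonneg) auto
        moreover have "(\<Prod>(x, y)\<in>?S - ?G. connection_prob \<alpha> lam (\<lambda>v. W v \<omega>) x y) \<le> 1"
          using cp0 connection_prob_le_1 by (intro prod_le_1) auto
        ultimately show "norm (\<Prod>(x, y)\<in>?S - ?G. connection_prob \<alpha> lam (\<lambda>v. W v \<omega>) x y) \<le> 1" by simp
      qed
    qed
    show "integrable M (\<lambda>\<omega>. w * (\<Prod>v\<in>V. W v \<omega> powr (\<alpha> + \<alpha>')))"
    proof (rule integrable_mult_right)
      have "indep_vars (\<lambda>_. borel) (\<lambda>v \<omega>. W v \<omega> powr (\<alpha> + \<alpha>')) V"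
        by (rule indep_vars_compose2[OF indep_vars_subset[OF weights_indep]]) auto
      then show "integrable M (\<lambda>\<omega>. \<Prod>v\<in>V. W v \<omega> powr (\<alpha> + \<alpha>'))"
        using finV m(2) by (intro indep_vars_integrable) auto
    qed
    show "AE \<omega> in M. (\<Prod>(x, y)\<in>?S - ?G. connection_prob \<alpha> lam (\<lambda>v. W v \<omega>) x y)
        \<le> w * (\<Prod>v\<in>V. W v \<omega> powr (\<alpha> + \<alpha>'))"
      using AE_weights_ge_1
    proof eventually_elim
      case (elim \<omega>)
      have W1: "1 \<le> W v \<omega>" for v using elim by blast
      have pw: "1 \<le> W v \<omega> powr e" if "0 \<le> e" for v e using W1 that by (intro ge_one_powr_ge_zero)
      have "(\<Prod>(x, y)\<in>?S - ?G. connection_prob \<alpha> lam (\<lambda>v. W v \<omega>) x y) = (\<Prod>(x, y)\<in>?S. q \<omega> x y)"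
        unfolding q_def by (intro prod.mono_neutral_cong_left) auto
      also have "\<dots> \<le> w * (\<Prod>v\<in>skeleton_verts t k. W v \<omega> powr (\<alpha> + \<alpha>')) *
         (if length vs = 1 then 1 else W (hd vs) \<omega> powr \<alpha>' * W (last vs) \<omega> powr \<alpha>')"
        unfolding w_def k_def
      proof (rule skeleton_prod_le[OF sk])
        fix a b :: "int ^ 'd" and e assume ab: "a \<noteq> b" and e: "e = \<alpha> \<or> e = \<alpha>'"
        show "q \<omega> a b \<le> C * euclid_dist a b powr (- (real CARD('d) * e)) * (W a \<omega> powr e * W b \<omega> powr e)"
        proof (cases "euclid_dist a b = 1")
          case True
          have "1 * 1 * (1 * 1) \<le> C * euclid_dist a b powr (- (real CARD('d) * e)) * (W a \<omega> powr e * W b \<omega> powr e)"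
            using True C pw[of e] e \<alpha>' by (intro mult_mono) auto
          then show ?thesis using True by (simp add: q_def)
        next
          case False
          then show ?thesis
            using connection_prob_le_powr[of lam e \<alpha> "\<lambda>v. W v \<omega>" a b] lamp e \<alpha>' W1 ab
            by (auto simp: q_def C_def)
        qed
      qed (use W1 \<alpha>' C cp0 in \<open>auto simp: q_def\<close>)
      also have "\<dots> \<le> w * (\<Prod>v\<in>skeleton_verts t k. W v \<omega> powr (\<alpha> + \<alpha>')) *
          (\<Prod>v\<in>{hd vs, last vs}. W v \<omega> powr (\<alpha> + \<alpha>'))"
      proof (rule mult_left_mono)
        show "(if length vs = 1 then 1 else W (hd vs) \<omega> powr \<alpha>' * W (last vs) \<omega> powr \<alpha>')
          \<le> (\<Prod>v\<in>{hd vs, last vs}. W v \<omega> powr (\<alpha> + \<alpha>'))"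
        proof (cases "length vs = 1")
          case True
          then show ?thesis using pw \<alpha>' lamp by (auto intro!: prod_ge_1)
        next
          case False
          with ne have "2 \<le> length vs" by (cases vs) (auto simp: Suc_le_eq)
          then have "hd vs \<noteq> last vs" by (rule hd_neq_last[OF sk(2)])
          moreover have "W (hd vs) \<omega> powr \<alpha>' * W (last vs) \<omega> powr \<alpha>'
            \<le> W (hd vs) \<omega> powr (\<alpha> + \<alpha>') * W (last vs) \<omega> powr (\<alpha> + \<alpha>')"
            using W1 lamp by (intro mult_mono powr_mono) auto
          ultimately show ?thesis using False by simp
        qed
      qed (use w0 in \<open>auto intro!: mult_nonneg_nonneg prod_nonneg\<close>)
      also have "\<dots> = w * (\<Prod>v\<in>V. W v \<omega> powr (\<alpha> + \<alpha>'))"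
        unfolding V_def using skeleton_verts_subset[OF sk]
        by (subst prod.union_disjoint) (auto simp: k_def mult.assoc)
      finally show ?case .
    qed
  qed
  also have "\<dots> = w * (\<Prod>v\<in>V. (\<integral>\<omega>. W v \<omega> powr (\<alpha> + \<alpha>') \<partial>M))"
  proof -
    have "indep_vars (\<lambda>_. borel) (\<lambda>v \<omega>. W v \<omega> powr (\<alpha> + \<alpha>')) V"
      by (rule indep_vars_compose2[OF indep_vars_subset[OF weights_indep]]) auto
    then show ?thesis using finV m(2) by (simp add: indep_vars_lebesgue_integral)
  qed
  also have "\<dots> \<le> w * (\<Prod>v\<in>V. m)"
    using w0 m(3) by (intro mult_left_mono prod_mono) auto
  also have "\<dots> \<le> w * m ^ (card (skeleton_verts t k) + 2)"
  proof (rule mult_left_mono[OF _ w0])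
    have "card V \<le> card (skeleton_verts t k) + card {hd vs, last vs}" unfolding V_def by (rule card_Un_le)
    also have "card {hd vs, last vs} \<le> 2" by (rule order_trans[OF card_insert_le_m1]) auto
    finally have "m ^ card V \<le> m ^ (card (skeleton_verts t k) + 2)"
      using m(1) by (intro power_increasing) auto
    then show "(\<Prod>v\<in>V. m) \<le> m ^ (card (skeleton_verts t k) + 2)"
      by (simp only: prod_constant)
  qed
  also have "\<dots> = m\<^sup>2 * (w * m ^ card (skeleton_verts t k))" by (simp add: power_add power2_eq_square mult_ac)
  also have "\<dots> \<le> m\<^sup>2 * skeleton_weight R (C * m\<^sup>2) \<alpha> \<alpha>' t k (hd vs) (last vs)"
    unfolding w_def using m(1) C by (intro mult_left_mono skeleton_weight_power) auto
  finally show ?thesis by (simp add: C_def k_def)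
qed

end

section \<open>The graph ball is not too large\<close>

lemma stretched_exp_tendsto_0:
  fixes A c a b p :: real
  assumes "0 < c" "0 < a" "a < b" "0 < A"
  shows "(\<lambda>k::nat. (real k + 1) * real k * (real k powr p * exp (A * real k powr a) * exp (- c * real k powr b))) \<longlonglongrightarrow> 0"
  using assms by real_asymp

lemma eventually_powr_dominates:
  fixes A a b :: real
  assumes "a < b"
  shows "eventually (\<lambda>k::nat. A * real k powr a \<le> real k powr b) sequentially"
  using assms by real_asymp


context scale_free_percolation
begin

lemma sets_skeleton_edges:
  assumes "finite S"
  shows "{\<omega> \<in> space M. S \<subseteq> sfp_graph L \<omega>} \<in> events"
proof -
  have "{\<omega> \<in> space M. \<forall>e\<in>S. e \<in> grid_edges \<or> e \<in> L \<omega>} \<in> events"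
    using assms edges_measurable by (intro sets.sets_Collect_finite_All sets.sets_Collect) auto
  then show ?thesis by (simp add: subset_eq sfp_graph_def)
qed

text \<open>Because \<open>r\<close> is at least every \<open>R n\<close>, a path that ends outside
  the ball of radius \<open>r\<close> has a genuine split at its root. Summing the root estimate
  over all such ends leaves a negative power of \<open>r\<close>, which must beat the two factors
  \<open>D k\<close> of the halves.\<close>

lemma prob_ball_exceeds_le:
  fixes R D :: "nat \<Rightarrow> real" and x :: "int ^ 'd"
  assumes \<alpha>': "1 < \<alpha>'" "\<alpha>' \<le> \<alpha>" "\<alpha> < 2"
    and m: "1 \<le> m" "\<And>v. integrable M (\<lambda>\<omega>. W v \<omega> powr (\<alpha> + \<alpha>'))"
      "\<And>v. (\<integral>\<omega>. W v \<omega> powr (\<alpha> + \<alpha>') \<partial>M) \<le> m"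
    and C: "C = max 1 lam * m\<^sup>2" and K: "0 < K"
    and lat: "\<And>(x::int ^ 'd) U r \<beta>. \<lbrakk>finite U; 1 \<le> r; \<And>u. u \<in> U \<Longrightarrow> r < euclid_dist x u; \<beta> = \<alpha> \<or> \<beta> = \<alpha>'\<rbrakk>
      \<Longrightarrow> (\<Sum>u\<in>U. euclid_dist x u powr (- (real CARD('d) * \<beta>))) \<le> K * r powr (- (real CARD('d) * (\<beta> - 1)))"
    and R: "R 0 = 0" "\<And>k. 1 \<le> k \<Longrightarrow> 1 \<le> R k"
    and D1: "\<And>k. 1 \<le> D k" and Dmono: "mono D"
    and D: "\<And>k e. 1 \<le> k \<Longrightarrow> e = split_exponent \<alpha> \<alpha>' k \<Longrightarrow>
      (3 * R k) ^ CARD('d) + (\<Sum>i<k. C * real k powr (real CARD('d) * e i) * D i * D (k - 1 - i) *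
        (K * R k powr (- (real CARD('d) * (e i - 1))))) \<le> D k"
    and r: "1 \<le> r" "\<And>n. n \<le> k \<Longrightarrow> R n \<le> r" and k: "1 \<le> k"
  shows "prob {\<omega> \<in> space M. \<not> graph_ball (sfp_graph L \<omega>) x k \<subseteq> euclid_ball x r}
    \<le> m\<^sup>2 * (real k + 1) * real k * (C * real k powr (2 * real CARD('d)) * (D k * D k) * (K * r powr (- (\<alpha>' - 1))))"
proof -
  let ?d = "real CARD('d)"
  have d1: "1 \<le> ?d" by (simp add: Suc_le_eq)
  have "1 \<le> m\<^sup>2" using m(1) by simp
  then have C0: "0 < C" unfolding C by (intro mult_pos_pos) (auto simp: less_max_iff_disj)
  let ?w = "skeleton_weight R C \<alpha> \<alpha>' :: (int ^ 'd) skeleton \<Rightarrow> _"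
  have w0: "0 \<le> ?w t n y u" for t n y u using C0 by (intro skeleton_weight_nonneg) simp
  have D0: "0 \<le> D n" for n using D1[of n] by linarith
  define I where "I = {(n, u, t). n \<le> k \<and> r < euclid_dist x u \<and>
    (\<exists>vs. distinct vs \<and> hd vs = x \<and> last vs = u \<and> length vs - 1 = n \<and> skeleton_of R vs t)}"
  define E where "E = (\<lambda>(n::nat, u::int ^ 'd, t). {\<omega> \<in> space M. skeleton_edges t \<subseteq> sfp_graph L \<omega>})"
  have Esets: "E i \<in> events" for i
    unfolding E_def by (cases i) (simp add: sets_skeleton_edges)
  have sub: "{\<omega> \<in> space M. \<not> graph_ball (sfp_graph L \<omega>) x k \<subseteq> euclid_ball x r} \<subseteq> (\<Union>i\<in>I. E i)"
  proof
    fix \<omega> assume "\<omega> \<in> {\<omega> \<in> space M. \<not> graph_ball (sfp_graph L \<omega>) x k \<subseteq> euclid_ball x r}"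
    then obtain u where \<omega>: "\<omega> \<in> space M" and u: "u \<in> graph_ball (sfp_graph L \<omega>) x k" "r < euclid_dist x u"
      by (auto simp: euclid_ball_def not_le[symmetric])
    then obtain n where n: "n \<le> k" "(x, u) \<in> sfp_graph L \<omega> ^^ n" by (auto simp: mem_graph_ball_iff)
    obtain vs where vs: "vs \<noteq> []" "distinct vs" "hd vs = x" "last vs = u" "length vs \<le> Suc n"
      "set (zip vs (tl vs)) \<subseteq> sfp_graph L \<omega>"
      using relpow_imp_distinct_path[OF n(2)] by blast
    obtain t where t: "skeleton_of R vs t" using skeleton_exists[OF vs(1), of R] R(1) by blast
    have "(length vs - 1, u, t) \<in> I" using vs t u n by (auto simp: I_def)
    moreover have "\<omega> \<in> E (length vs - 1, u, t)"
      using \<omega> skeleton_edges_subset[OF t] vs(6) by (auto simp: E_def)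
    ultimately show "\<omega> \<in> (\<Union>i\<in>I. E i)" by blast
  qed
  define B where "B = C * real k powr (2 * ?d) * (D k * D k) * (K * r powr (- (\<alpha>' - 1)))"
  have B0: "0 \<le> B" unfolding B_def using C0 K D0 by (intro mult_nonneg_nonneg) auto
  have layer: "(\<Sum>u\<in>U. \<Sum>t\<in>T. ?w t n x u) \<le> real k * B"
    if n: "n \<le> k" and U: "finite U" "\<And>u. u \<in> U \<Longrightarrow> r < euclid_dist x u" and T: "finite T" for n U T
  proof -
    define e where "e = split_exponent \<alpha> \<alpha>' n"
    have e: "\<alpha>' \<le> e i" "e i \<le> 2" for i using \<alpha>' by (auto simp: e_def)
    have "(\<Sum>u\<in>U. \<Sum>t\<in>T. ?w t n x u)
      \<le> (\<Sum>u\<in>U. \<Sum>i<n. C * (real n / euclid_dist x u) powr (?d * e i) * D i * D (n - 1 - i))"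
    proof (rule sum_mono)
      fix u assume "u \<in> U"
      then have "R n < euclid_dist x u" "0 < euclid_dist x u" using U(2)[of u] r(2)[OF n] r(1) by auto
      then show "(\<Sum>t\<in>T. ?w t n x u) \<le> (\<Sum>i<n. C * (real n / euclid_dist x u) powr (?d * e i) * D i * D (n - 1 - i))"
        unfolding e_def
        using \<alpha>' by (intro skeleton_weight_total(3)[OF C0 _ _ lat R(1) R(2) D1 D T]) auto
    qed
    also have "\<dots> = (\<Sum>i<n. (C * real n powr (?d * e i) * (D i * D (n - 1 - i))) *
        (\<Sum>u\<in>U. euclid_dist x u powr (- (?d * e i))))"
    proof (subst sum.swap, intro sum.cong refl, unfold sum_distrib_left, intro sum.cong refl)
      fix i u
      have "(real n / euclid_dist x u) powr (?d * e i)
        = real n powr (?d * e i) * euclid_dist x u powr (- (?d * e i))"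
        by (simp only: powr_divide euclid_dist_nonneg of_nat_0_le_iff powr_minus) (simp only: divide_inverse)
      then show "C * (real n / euclid_dist x u) powr (?d * e i) * D i * D (n - 1 - i)
        = (C * real n powr (?d * e i) * (D i * D (n - 1 - i))) * euclid_dist x u powr (- (?d * e i))"
        by simp
    qed
    also have "\<dots> \<le> (\<Sum>i<n. B)"
    proof (rule sum_mono)
      fix i assume "i \<in> {..<n}"
      then have i: "i < n" "1 \<le> n" by auto
      have "(\<Sum>u\<in>U. euclid_dist x u powr (- (?d * e i))) \<le> K * r powr (- (?d * (e i - 1)))"
        using U r(1) by (intro lat) (auto simp: e_def)
      also have "\<dots> \<le> K * r powr (- (\<alpha>' - 1))"
      proof -
        have "\<alpha>' - 1 \<le> 1 * (e i - 1)" using e(1)[of i] by simp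
        also have "\<dots> \<le> ?d * (e i - 1)" using d1 e(1)[of i] \<alpha>' by (intro mult_right_mono) auto
        finally show ?thesis using K r(1) by (intro mult_left_mono powr_mono) auto
      qed
      finally have s: "(\<Sum>u\<in>U. euclid_dist x u powr (- (?d * e i))) \<le> K * r powr (- (\<alpha>' - 1))" .
      have "real n powr (?d * e i) \<le> real k powr (?d * e i)"
        using n i e(1)[of i] \<alpha>' by (intro powr_mono2 mult_nonneg_nonneg) auto
      also have "\<dots> \<le> real k powr (2 * ?d)"
        using k e(2)[of i] mult_left_mono[OF e(2)[of i], of ?d] by (intro powr_mono) (auto simp: mult.commute)
      finally have p: "real n powr (?d * e i) \<le> real k powr (2 * ?d)" .
      have "D i \<le> D k" "D (n - 1 - i) \<le> D k"
        using i n by (auto intro!: monoD[OF Dmono])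
      then have DD: "D i * D (n - 1 - i) \<le> D k * D k" using D0 by (intro mult_mono) auto
      show "(C * real n powr (?d * e i) * (D i * D (n - 1 - i))) *
        (\<Sum>u\<in>U. euclid_dist x u powr (- (?d * e i))) \<le> B"
        unfolding B_def
        by (intro mult_mono s DD p mult_nonneg_nonneg D0 order_refl sum_nonneg) (use C0 in auto)
    qed
    also have "\<dots> \<le> real k * B" using n B0 by (simp add: mult_right_mono)
    finally show ?thesis .
  qed
  have "prob {\<omega> \<in> space M. \<not> graph_ball (sfp_graph L \<omega>) x k \<subseteq> euclid_ball x r} \<le> prob (\<Union>i\<in>I. E i)"
    using sub by (rule finite_measure_mono) (auto intro!: sets.countable_UN'' Esets)
  also have "\<dots> \<le> m\<^sup>2 * (real k + 1) * real k * B"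
  proof (rule measure_UN_le_of_finite_sums)
    fix F assume F: "finite F" "F \<subseteq> I"
    define U where "U = (\<lambda>(n, u, t). u) ` F"
    define T where "T = (\<lambda>(n, u, t). t) ` F"
    have UT: "finite U" "finite T" using F(1) by (auto simp: U_def T_def)
    have Ur: "r < euclid_dist x u" if "u \<in> U" for u using that F(2) by (auto simp: U_def I_def)
    \<comment> \<open>Any finite family of indices lies in a box, on which the sum is the iterated
      one of \<open>layer\<close>.\<close>
    have FS: "F \<subseteq> {..k} \<times> U \<times> T" using F(2) by (force simp: U_def T_def I_def)
    have "(\<Sum>i\<in>F. prob (E i)) \<le> (\<Sum>i\<in>F. m\<^sup>2 * (case i of (n, u, t) \<Rightarrow> ?w t n x u))"
    proof (rule sum_mono)
      fix i assume "i \<in> F"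
      with F(2) obtain n u t vs where i: "i = (n, u, t)" "distinct vs" "hd vs = x" "last vs = u" "length vs - 1 = n"
        "skeleton_of R vs t" by (auto simp: I_def)
      then show "prob (E i) \<le> m\<^sup>2 * (case i of (n, u, t) \<Rightarrow> ?w t n x u)"
        using prob_skeleton_le[OF i(6,2) R(1) _ \<alpha>'(2) m] \<alpha>' by (simp add: E_def C)
    qed
    also have "\<dots> = m\<^sup>2 * (\<Sum>i\<in>F. (case i of (n, u, t) \<Rightarrow> ?w t n x u))" by (simp add: sum_distrib_left)
    also have "\<dots> \<le> m\<^sup>2 * (\<Sum>i\<in>{..k} \<times> U \<times> T. (case i of (n, u, t) \<Rightarrow> ?w t n x u))"
      using UT FS w0 by (intro mult_left_mono sum_mono2) auto
    also have "(\<Sum>i\<in>{..k} \<times> U \<times> T. (case i of (n, u, t) \<Rightarrow> ?w t n x u)) = (\<Sum>n\<le>k. \<Sum>u\<in>U. \<Sum>t\<in>T. ?w t n x u)"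
      by (simp add: sum.cartesian_product')
    also have "\<dots> \<le> (\<Sum>n\<le>k. real k * B)"
      using layer UT Ur by (intro sum_mono) auto
    also have "m\<^sup>2 * \<dots> = m\<^sup>2 * (real k + 1) * real k * B" by (simp add: algebra_simps)
    finally show "(\<Sum>i\<in>F. prob (E i)) \<le> m\<^sup>2 * (real k + 1) * real k * B" by (simp add: mult_left_mono)
  qed (use Esets in auto)
  finally show ?thesis by (simp add: B_def)
qed

lemma ball_subset_limit:
  fixes x :: "int ^ 'd"
  assumes "\<alpha> < 2" "\<alpha> < \<tau> - 2" "0 < \<epsilon>"
  shows "(\<lambda>k. prob {\<omega> \<in> space M. \<not> graph_ball (sfp_graph L \<omega>) x k
      \<subseteq> euclid_ball x (exp (real k powr (log 2 (2 / \<alpha>) + \<epsilon>)))}) \<longlonglongrightarrow> 0"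
proof -
  let ?d = "CARD('d)"
  have \<alpha>1: "1 < \<alpha>" using params by simp
  \<comment> \<open>The midpoint of 1 and the smaller of \<alpha> and
    \<open>\<tau> - 1 - \<alpha>\<close>; both exceed 1, the latter by
    \<open>\<alpha> < \<tau> - 2\<close>. Hence the moment of order
    \<open>\<alpha> + \<alpha>'\<close> is finite.\<close>
  define \<alpha>' where "\<alpha>' = (1 + min \<alpha> (\<tau> - 1 - \<alpha>)) / 2"
  have \<alpha>': "1 < \<alpha>'" "\<alpha>' \<le> \<alpha>" "\<alpha> + \<alpha>' < \<tau> - 1" using \<alpha>1 assms by (auto simp: \<alpha>'_def min_def field_simps)
  obtain m where m: "1 \<le> m" "\<And>v. integrable M (\<lambda>\<omega>. W v \<omega> powr (\<alpha> + \<alpha>'))"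
    "\<And>v. (\<integral>\<omega>. W v \<omega> powr (\<alpha> + \<alpha>') \<partial>M) \<le> m"
    using weight_moment[of "\<alpha> + \<alpha>'"] \<alpha>' \<alpha>1 by auto
  define C where "C = max 1 lam * m\<^sup>2"
  have "1 \<le> m\<^sup>2" using m(1) by simp
  then have C0: "0 < C" unfolding C_def by (intro mult_pos_pos) (auto simp: less_max_iff_disj)
  obtain K1 where K1: "0 < K1" "\<And>(x::int ^ 'd) U r. \<lbrakk>finite U; 1 \<le> r; \<And>u. u \<in> U \<Longrightarrow> r < euclid_dist x u\<rbrakk>
      \<Longrightarrow> (\<Sum>u\<in>U. euclid_dist x u powr (- (real ?d * \<alpha>))) \<le> K1 * r powr (- (real ?d * (\<alpha> - 1)))"
    using lattice_sum_outside[OF \<alpha>1, where 'd = 'd] by blast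
  obtain K2 where K2: "0 < K2" "\<And>(x::int ^ 'd) U r. \<lbrakk>finite U; 1 \<le> r; \<And>u. u \<in> U \<Longrightarrow> r < euclid_dist x u\<rbrakk>
      \<Longrightarrow> (\<Sum>u\<in>U. euclid_dist x u powr (- (real ?d * \<alpha>'))) \<le> K2 * r powr (- (real ?d * (\<alpha>' - 1)))"
    using lattice_sum_outside[OF \<alpha>'(1), where 'd = 'd] by blast
  define K where "K = max K1 K2"
  have K0: "0 < K" using K1 by (simp add: K_def)
  have lat: "(\<Sum>u\<in>U. euclid_dist x u powr (- (real ?d * \<beta>))) \<le> K * r powr (- (real ?d * (\<beta> - 1)))"
    if "finite U" "1 \<le> r" "\<And>u. u \<in> U \<Longrightarrow> r < euclid_dist x u" "\<beta> = \<alpha> \<or> \<beta> = \<alpha>'" for x :: "int ^ 'd" and U r \<beta>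
  proof -
    have "K1 * y \<le> K * y" "K2 * y \<le> K * y" if "0 \<le> y" for y
      using that by (auto simp: K_def intro: mult_right_mono)
    then show ?thesis
      using K1(2)[OF that(1-3)] K2(2)[OF that(1-3)] that(4) by (meson order_trans powr_ge_zero)
  qed
  define \<theta> where "\<theta> = log 2 (2 / \<alpha>)"
  have \<theta>: "0 < \<theta>" "\<theta> < 1" using \<alpha>1 assms by (auto simp: \<theta>_def log_divide)
  \<comment> \<open>Strictly between \<open>\<theta>\<close> and
    \<open>\<theta> + \<epsilon>\<close>, so the recursion can be solved and yet \<open>D k\<close>
    is negligible against every power of the radius. The cap at 1 keeps the power concave.\<close>
  define \<theta>' where "\<theta>' = min (\<theta> + \<epsilon> / 2) 1"
  have \<theta>': "\<theta> < \<theta>'" "\<theta>' \<le> 1" "\<theta>' < \<theta> + \<epsilon>" "0 < \<theta>'" using \<theta> assms by (auto simp: \<theta>'_def)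
  obtain A \<delta> where A: "0 < A" "0 < \<delta>" "\<delta> < 1"
    "\<And>R D k e. R = (\<lambda>k::nat. if k = 0 then 0 else exp (A * (1 - \<delta>) * real k powr \<theta>' / real ?d)) \<Longrightarrow>
      D = (\<lambda>k::nat. exp (A * real k powr \<theta>')) \<Longrightarrow> 1 \<le> k \<Longrightarrow>
      e = split_exponent \<alpha> \<alpha>' k \<Longrightarrow>
      (3 * R k) ^ ?d + (\<Sum>i<k. C * real k powr (real ?d * e i) * D i * D (k - 1 - i) *
        (K * R k powr (- (real ?d * (e i - 1))))) \<le> D k"
    by (rule skeleton_radii_exist[OF _ C0 K0 \<alpha>'(1,2) assms(1), of ?d \<theta>']) (use \<theta>' in \<open>auto simp: \<theta>_def Suc_le_eq\<close>)
  define R where "R = (\<lambda>k::nat. if k = 0 then 0 else exp (A * (1 - \<delta>) * real k powr \<theta>' / real ?d))"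
  define D where "D = (\<lambda>k::nat. exp (A * real k powr \<theta>'))"
  define r where "r = (\<lambda>k::nat. exp (real k powr (\<theta> + \<epsilon>)))"
  define B where "B = (\<lambda>k. m\<^sup>2 * (real k + 1) * real k * (C * real k powr (2 * real ?d) * (D k * D k) * (K * r k powr (- (\<alpha>' - 1)))))"
  have R1: "1 \<le> R k" if "1 \<le> k" for k using that A by (simp add: R_def)
  have Dm: "mono D" using A \<theta>' by (auto simp: D_def intro!: monoI powr_mono2)
  have Rm: "R n \<le> exp (A * real k powr \<theta>')" if "n \<le> k" for n k
  proof (cases "n = 0")
    case False
    have "A * (1 - \<delta>) * real n powr \<theta>' / real ?d \<le> A * (1 - \<delta>) * real n powr \<theta>' / 1"
      using A by (intro divide_left_mono) (auto simp: Suc_le_eq)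
    also have "\<dots> \<le> A * 1 * real k powr \<theta>'"
      unfolding div_by_1 using A(1-3) that \<theta>' by (intro mult_mono powr_mono2) auto
    finally show ?thesis using False by (simp add: R_def)
  qed (simp add: R_def)
  have ev: "eventually (\<lambda>k::nat. A * real k powr \<theta>' \<le> real k powr (\<theta> + \<epsilon>)) sequentially"
    by (rule eventually_powr_dominates) (use \<theta>' in auto)
  have evB: "eventually (\<lambda>k. prob {\<omega> \<in> space M. \<not> graph_ball (sfp_graph L \<omega>) x k \<subseteq> euclid_ball x (r k)} \<le> B k) sequentially"
    using ev eventually_ge_at_top[of 1]
  proof eventually_elim
    case (elim k)
    have Rr: "R n \<le> r k" if "n \<le> k" for n using Rm[OF that] elim by (auto simp: r_def intro: order_trans)
    show ?case unfolding B_def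
    proof (rule prob_ball_exceeds_le[OF \<alpha>'(1,2) assms(1) m C_def K0 lat])
      show "(3 * R k) ^ ?d + (\<Sum>i<k. C * real k powr (real ?d * e i) * D i * D (k - 1 - i) *
        (K * R k powr (- (real ?d * (e i - 1))))) \<le> D k" if "1 \<le> k" "e = split_exponent \<alpha> \<alpha>' k" for k e
        by (rule A(4)[OF R_def D_def that])
    qed (use R1 Dm Rr elim A in \<open>auto simp: R_def D_def r_def\<close>)
  qed
  have "B = (\<lambda>k. (m\<^sup>2 * C * K) * ((real k + 1) * real k *
     (real k powr (2 * real ?d) * exp (2 * A * real k powr \<theta>') * exp (- (\<alpha>' - 1) * real k powr (\<theta> + \<epsilon>)))))"
  proof
    fix k
    have 1: "r k powr (- (\<alpha>' - 1)) = exp (- (\<alpha>' - 1) * real k powr (\<theta> + \<epsilon>))"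
      by (simp add: r_def powr_def)
    have 2: "D k * D k = exp (2 * A * real k powr \<theta>')" by (simp add: D_def flip: exp_add)
    show "B k = (m\<^sup>2 * C * K) * ((real k + 1) * real k *
     (real k powr (2 * real ?d) * exp (2 * A * real k powr \<theta>') * exp (- (\<alpha>' - 1) * real k powr (\<theta> + \<epsilon>))))"
      unfolding B_def 1 2 by (simp only: mult_ac)
  qed
  moreover have "(\<lambda>k. (m\<^sup>2 * C * K) * ((real k + 1) * real k *
     (real k powr (2 * real ?d) * exp (2 * A * real k powr \<theta>') * exp (- (\<alpha>' - 1) * real k powr (\<theta> + \<epsilon>))))) \<longlonglongrightarrow> (m\<^sup>2 * C * K) * 0"
    using \<alpha>' \<theta>' A by (intro tendsto_mult_left stretched_exp_tendsto_0) auto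
  ultimately have "B \<longlonglongrightarrow> 0" by simp
  then have "(\<lambda>k. prob {\<omega> \<in> space M. \<not> graph_ball (sfp_graph L \<omega>) x k \<subseteq> euclid_ball x (r k)}) \<longlonglongrightarrow> 0"
    by (rule tendsto_sandwich[OF _ evB tendsto_const, rotated]) (auto intro!: always_eventually)
  then show ?thesis by (simp add: r_def \<theta>_def)
qed

end

section \<open>Independent random subsets\<close>

text \<open>The default \<open>False\<close> keeps the random set inside \<open>A\<close>. As a
  finite product \<open>pmf\<close>, its restrictions to disjoint blocks are independent and again
  of this form.\<close>

definition bernoulli_subset :: "'e set \<Rightarrow> ('e \<Rightarrow> real) \<Rightarrow> 'e set pmf" where
  "bernoulli_subset A p = map_pmf (\<lambda>f. {e. f e}) (Pi_pmf A False (\<lambda>e. bernoulli_pmf (p e)))"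

lemma set_pmf_bernoulli_subset: "finite A \<Longrightarrow> set_pmf (bernoulli_subset A p) \<subseteq> Pow A"
  using set_Pi_pmf_subset[of A False "\<lambda>e. bernoulli_pmf (p e)"]
  by (auto simp: bernoulli_subset_def)

lemma bernoulli_subset_empty [simp]: "bernoulli_subset {} p = return_pmf {}"
  by (simp add: bernoulli_subset_def)

lemma bernoulli_subset_Un:
  assumes "finite A" "finite B" "A \<inter> B = {}"
  shows "bernoulli_subset (A \<union> B) p =
    map_pmf (\<lambda>(S, T). S \<union> T) (pair_pmf (bernoulli_subset A p) (bernoulli_subset B p))"
proof -
  let ?P = "\<lambda>A. Pi_pmf A False (\<lambda>e. bernoulli_pmf (p e))"
  have "bernoulli_subset (A \<union> B) p =
    map_pmf (\<lambda>(f, g). {e. if e \<in> A then f e else g e}) (pair_pmf (?P A) (?P B))"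
    unfolding bernoulli_subset_def Pi_pmf_union[OF assms] pmf.map_comp
    by (intro map_pmf_cong) auto
  also have "\<dots> = map_pmf (\<lambda>(f, g). {e. f e} \<union> {e. g e}) (pair_pmf (?P A) (?P B))"
    using set_Pi_pmf_subset[OF assms(1)] set_Pi_pmf_subset[OF assms(2)] assms(3)
    by (intro map_pmf_cong refl) (fastforce split: if_splits)
  also have "\<dots> = map_pmf (\<lambda>(S, T). S \<union> T) (pair_pmf (bernoulli_subset A p) (bernoulli_subset B p))"
    unfolding bernoulli_subset_def pair_map_pmf1 pair_map_pmf2 pmf.map_comp
    by (intro map_pmf_cong) auto
  finally show ?thesis .
qed

lemma map_pmf_Int_bernoulli_subset:
  assumes "finite A" "B \<subseteq> A"
  shows "map_pmf (\<lambda>X. X \<inter> B) (bernoulli_subset A p) = bernoulli_subset B p"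
proof -
  have fin: "finite B" "finite (A - B)" using assms by (auto intro: finite_subset)
  have "A = B \<union> (A - B)" using assms by auto
  then have "map_pmf (\<lambda>X. X \<inter> B) (bernoulli_subset A p)
    = map_pmf (\<lambda>X. X \<inter> B) (bernoulli_subset (B \<union> (A - B)) p)" by simp
  also have "\<dots> = map_pmf (\<lambda>(S, T). (S \<union> T) \<inter> B) (pair_pmf (bernoulli_subset B p) (bernoulli_subset (A - B) p))"
    using fin by (subst bernoulli_subset_Un) (auto simp: pmf.map_comp o_def case_prod_unfold)
  also have "\<dots> = map_pmf fst (pair_pmf (bernoulli_subset B p) (bernoulli_subset (A - B) p))"
    using set_pmf_bernoulli_subset[OF fin(1), of p] set_pmf_bernoulli_subset[OF fin(2), of p]
    by (intro map_pmf_cong refl) fastforce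
  also have "\<dots> = bernoulli_subset B p" by (rule map_fst_pair_pmf)
  finally show ?thesis .
qed

lemma prob_bernoulli_subset_pair:
  assumes "finite A" "B \<subseteq> A" "C \<subseteq> A" "B \<inter> C = {}"
  shows "measure_pmf.prob (bernoulli_subset A p) {X. Q (X \<inter> B) (X \<inter> C)}
    = measure_pmf.prob (pair_pmf (bernoulli_subset B p) (bernoulli_subset C p)) {(S, T). Q S T}"
proof -
  have fin: "finite B" "finite C" using assms by (auto intro: finite_subset)
  have sB: "S \<subseteq> B" if "S \<in> set_pmf (bernoulli_subset B p)" for S
    using set_pmf_bernoulli_subset[OF fin(1), of p] that by blast
  have sC: "S \<subseteq> C" if "S \<in> set_pmf (bernoulli_subset C p)" for S
    using set_pmf_bernoulli_subset[OF fin(2), of p] that by blast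
  have "measure_pmf.prob (bernoulli_subset A p) {X. Q (X \<inter> B) (X \<inter> C)}
    = measure_pmf.prob (map_pmf (\<lambda>X. X \<inter> (B \<union> C)) (bernoulli_subset A p)) {X. Q (X \<inter> B) (X \<inter> C)}"
  proof -
    have "Y \<inter> (B \<union> C) \<inter> B = Y \<inter> B" "Y \<inter> (B \<union> C) \<inter> C = Y \<inter> C" for Y by auto
    then show ?thesis by (simp add: vimage_def)
  qed
  also have "map_pmf (\<lambda>X. X \<inter> (B \<union> C)) (bernoulli_subset A p) = bernoulli_subset (B \<union> C) p"
    using assms by (intro map_pmf_Int_bernoulli_subset) auto
  also have "measure_pmf.prob (bernoulli_subset (B \<union> C) p) {X. Q (X \<inter> B) (X \<inter> C)}
    = measure_pmf.prob (pair_pmf (bernoulli_subset B p) (bernoulli_subset C p))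
        {(S, T). Q ((S \<union> T) \<inter> B) ((S \<union> T) \<inter> C)}"
    unfolding bernoulli_subset_Un[OF fin assms(4)] by (simp add: vimage_def case_prod_unfold)
  also have "\<dots> = measure_pmf.prob (pair_pmf (bernoulli_subset B p) (bernoulli_subset C p)) {(S, T). Q S T}"
  proof -
    have "(S \<union> T) \<inter> B = S \<and> (S \<union> T) \<inter> C = T"
      if "pmf (pair_pmf (bernoulli_subset B p) (bernoulli_subset C p)) (S, T) \<noteq> 0" for S T
    proof -
      have "S \<subseteq> B" "T \<subseteq> C" using that sB sC by (auto simp: pmf_pair set_pmf_iff)
      then show ?thesis using assms(4) by auto
    qed
    then show ?thesis by (intro measure_prob_cong_0) (auto split: prod.splits, metis+)
  qed
  finally show ?thesis .
qed

lemma prob_pair_pmf_le: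
  assumes "\<And>S. S \<in> set_pmf M \<Longrightarrow> measure_pmf.prob N {T. Q S T} \<le> c" and "0 \<le> c"
  shows "measure_pmf.prob (pair_pmf M N) {(S, T). Q S T} \<le> c"
proof -
  have "emeasure (measure_pmf (pair_pmf M N)) {(S, T). Q S T}
     = (\<integral>\<^sup>+ S. emeasure (measure_pmf N) {T. Q S T} \<partial>measure_pmf M)"
    unfolding pair_pmf_def
    by (simp add: map_pmf_def[symmetric] vimage_def)
  also have "\<dots> \<le> (\<integral>\<^sup>+ S. ennreal c \<partial>measure_pmf M)"
    using assms by (intro nn_integral_mono_AE AE_pmfI) (auto simp: measure_pmf.emeasure_eq_measure ennreal_leI)
  also have "\<dots> = ennreal c" by (simp add: measure_pmf.emeasure_space_1)
  finally show ?thesis using assms(2) by (simp add: measure_pmf.emeasure_eq_measure)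
qed

lemma prob_bernoulli_subset_indep:
  assumes "finite A" "B \<subseteq> A" "C \<subseteq> A" "B \<inter> C = {}"
  shows "measure_pmf.prob (bernoulli_subset A p) {X. P (X \<inter> B) \<and> Q (X \<inter> C)}
    = measure_pmf.prob (bernoulli_subset A p) {X. P (X \<inter> B)} *
      measure_pmf.prob (bernoulli_subset A p) {X. Q (X \<inter> C)}"
proof -
  have fin: "finite B" "finite C" using assms by (auto intro: finite_subset)
  have 1: "measure_pmf.prob (bernoulli_subset A p) {X. P (X \<inter> D)} = measure_pmf.prob (bernoulli_subset D p) {X. P X}"
    if "D \<subseteq> A" for D and P
    unfolding map_pmf_Int_bernoulli_subset[OF assms(1) that, of p, symmetric] by (simp add: vimage_def)
  have 2: "measure_pmf.prob (bernoulli_subset D p) {X. P X} = measure_pmf.prob (bernoulli_subset D p) ({X. P X} \<inter> Pow D)"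
    if "finite D" for D and P
    using set_pmf_bernoulli_subset[OF that, of p]
    by (intro measure_prob_cong_0) (auto simp: set_pmf_eq)
  have "measure_pmf.prob (bernoulli_subset A p) {X. P (X \<inter> B) \<and> Q (X \<inter> C)}
    = measure_pmf.prob (pair_pmf (bernoulli_subset B p) (bernoulli_subset C p)) {(S, T). P S \<and> Q T}"
    by (rule prob_bernoulli_subset_pair[OF assms])
  also have "\<dots> = measure_pmf.prob (pair_pmf (bernoulli_subset B p) (bernoulli_subset C p))
       (({X. P X} \<inter> Pow B) \<times> ({X. Q X} \<inter> Pow C))"
    using set_pmf_bernoulli_subset[OF fin(1), of p] set_pmf_bernoulli_subset[OF fin(2), of p]
    by (intro measure_prob_cong_0) (auto simp: pmf_pair set_pmf_eq)
  also have "\<dots> = measure_pmf.prob (bernoulli_subset B p) ({X. P X} \<inter> Pow B) *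
      measure_pmf.prob (bernoulli_subset C p) ({X. Q X} \<inter> Pow C)"
    using fin by (intro measure_pmf_prob_product countable_finite) auto
  also have "\<dots> = measure_pmf.prob (bernoulli_subset A p) {X. P (X \<inter> B)} *
      measure_pmf.prob (bernoulli_subset A p) {X. Q (X \<inter> C)}"
    using 1 2 fin assms by simp
  finally show ?thesis .
qed

text \<open>Reveal the block \<open>B\<close> first and bound the conditional probability for each
  outcome \<open>S\<close>. This is applied with \<open>B\<close> the edges inside two cells, which
  determine their cores, and \<open>C\<close> the edges between them.\<close>

lemma prob_bernoulli_subset_cond_le:
  assumes "finite A" "B \<subseteq> A" "C \<subseteq> A" "B \<inter> C = {}" "0 \<le> c"
    and "\<And>S. S \<subseteq> B \<Longrightarrow> measure_pmf.prob (bernoulli_subset C p) {T. Q S T} \<le> c"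
  shows "measure_pmf.prob (bernoulli_subset A p) {X. Q (X \<inter> B) (X \<inter> C)} \<le> c"
  unfolding prob_bernoulli_subset_pair[OF assms(1-4)]
  by (rule prob_pair_pmf_le[OF assms(6,5)])
    (use set_pmf_bernoulli_subset[OF finite_subset[OF assms(2,1)], of p] in auto)

lemma pmf_bernoulli_subset:
  assumes "finite A" "S \<subseteq> A" and p: "\<And>e. e \<in> A \<Longrightarrow> 0 \<le> p e \<and> p e \<le> 1"
  shows "pmf (bernoulli_subset A p) S = (\<Prod>e\<in>S. p e) * (\<Prod>e\<in>A - S. 1 - p e)"
proof -
  have "inj (\<lambda>f. {e. f e})" by (rule injI) (auto simp: set_eq_iff)
  then have "pmf (bernoulli_subset A p) {e. e \<in> S} = pmf (Pi_pmf A False (\<lambda>e. bernoulli_pmf (p e))) (\<lambda>e. e \<in> S)"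
    unfolding bernoulli_subset_def by (rule pmf_map_inj')
  also have "\<dots> = (\<Prod>e\<in>A. pmf (bernoulli_pmf (p e)) (e \<in> S))"
    using assms by (subst pmf_Pi') auto
  also have "\<dots> = (\<Prod>e\<in>S. pmf (bernoulli_pmf (p e)) (e \<in> S)) * (\<Prod>e\<in>A - S. pmf (bernoulli_pmf (p e)) (e \<in> S))"
    using assms by (subst prod.subset_diff[of S A]) (auto simp: mult.commute)
  also have "\<dots> = (\<Prod>e\<in>S. p e) * (\<Prod>e\<in>A - S. 1 - p e)"
    using assms p by (intro arg_cong2[of _ _ _ _ "(*)"] prod.cong) auto
  finally show ?thesis by simp
qed

lemma prob_bernoulli_subset_disjoint_le:
  assumes "finite C" "D \<subseteq> C" and p: "\<And>e. e \<in> D \<Longrightarrow> \<rho> \<le> p e" "\<And>e. e \<in> D \<Longrightarrow> 0 \<le> p e \<and> p e \<le> 1"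
  shows "measure_pmf.prob (bernoulli_subset C p) {T. T \<inter> D = {}} \<le> exp (- (\<rho> * real (card D)))"
proof -
  have fin: "finite D" using assms by (auto intro: finite_subset)
  have "measure_pmf.prob (bernoulli_subset C p) {T. T \<inter> D = {}}
     = measure_pmf.prob (map_pmf (\<lambda>X. X \<inter> D) (bernoulli_subset C p)) {{}}"
    by (simp add: vimage_def)
  also have "\<dots> = measure_pmf.prob (bernoulli_subset D p) {{}}"
    by (simp only: map_pmf_Int_bernoulli_subset[OF assms(1,2)])
  also have "\<dots> = (\<Prod>e\<in>D. 1 - p e)"
    using fin p(2) by (simp add: measure_pmf_single pmf_bernoulli_subset)
  also have "\<dots> \<le> (\<Prod>e\<in>D. exp (- \<rho>))"
  proof (rule prod_mono)
    fix e assume e: "e \<in> D"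
    have "1 - p e \<le> 1 + - \<rho>" using p e by simp
    also have "\<dots> \<le> exp (- \<rho>)" by (rule exp_ge_add_one_self)
    finally show "0 \<le> 1 - p e \<and> 1 - p e \<le> exp (- \<rho>)" using p e by simp
  qed
  also have "\<dots> = exp (- (\<rho> * real (card D)))" by (simp flip: exp_of_nat_mult add: mult.commute)
  finally show ?thesis .
qed

lemma prob_bernoulli_subset_insert:
  assumes "finite A" "e \<notin> A" "0 \<le> p e" "p e \<le> 1"
  shows "measure_pmf.prob (bernoulli_subset (insert e A) p) {X. Q X}
    = p e * measure_pmf.prob (bernoulli_subset A p) {X. Q (insert e X)} +
      (1 - p e) * measure_pmf.prob (bernoulli_subset A p) {X. Q X}"
proof -
  let ?P = "Pi_pmf A False (\<lambda>e. bernoulli_pmf (p e))"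
  have s: "bernoulli_subset (insert e A) p =
     bind_pmf (bernoulli_pmf (p e)) (\<lambda>b. map_pmf (\<lambda>X. if b then insert e X else X) (bernoulli_subset A p))"
  proof -
    have "bernoulli_subset (insert e A) p
      = bind_pmf (bernoulli_pmf (p e)) (\<lambda>b. map_pmf (\<lambda>f. {x. (f(e := b)) x}) ?P)"
      unfolding bernoulli_subset_def Pi_pmf_insert'[OF assms(1,2)]
      by (simp add: map_bind_pmf map_pmf_def[symmetric] pmf.map_comp o_def del: fun_upd_apply)
    also have "\<dots> = bind_pmf (bernoulli_pmf (p e)) (\<lambda>b. map_pmf (\<lambda>X. if b then insert e X else X) (bernoulli_subset A p))"
      unfolding bernoulli_subset_def pmf.map_comp
    proof (intro bind_pmf_cong map_pmf_cong refl)
      fix b f assume "f \<in> set_pmf ?P"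
      then have "f \<in> {f. \<forall>x. x \<notin> A \<longrightarrow> f x = False}"
        by (rule subsetD[OF set_Pi_pmf_subset[OF assms(1)]])
      then have "\<not> f e" using assms(2) by simp
      then show "{x. (f(e := b)) x} = ((\<lambda>X. if b then insert e X else X) \<circ> (\<lambda>f. {e. f e})) f" by auto
    qed
    finally show ?thesis .
  qed
  have "emeasure (measure_pmf (bernoulli_subset (insert e A) p)) {X. Q X}
     = emeasure (measure_pmf (bernoulli_subset A p)) {X. Q (insert e X)} * ennreal (p e)
     + emeasure (measure_pmf (bernoulli_subset A p)) {X. Q X} * ennreal (1 - p e)"
    unfolding s emeasure_bind_pmf using assms by (subst nn_integral_bernoulli_pmf) (auto simp: vimage_def)
  then show ?thesis
    using assms by (simp add: measure_pmf.emeasure_eq_measure mult.commute flip: ennreal_mult ennreal_plus)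
qed

text \<open>One coordinate at a time: conditioned on the status of \<open>e\<close>, the probability
  is an average with weights \<open>p e\<close> and \<open>1 - p e\<close>. As \<open>Q\<close> is
  increasing, the term with \<open>e\<close> present is the larger one, so raising
  \<open>p e\<close> helps.\<close>

lemma prob_bernoulli_subset_mono:
  assumes "finite A" and p: "\<And>e. e \<in> A \<Longrightarrow> 0 \<le> p e \<and> p e \<le> p' e \<and> p' e \<le> 1"
    and Q: "\<And>S T. S \<subseteq> T \<Longrightarrow> Q S \<Longrightarrow> Q T"
  shows "measure_pmf.prob (bernoulli_subset A p) {X. Q X} \<le> measure_pmf.prob (bernoulli_subset A p') {X. Q X}"
  using assms
proof (induction A arbitrary: Q)
  case empty
  then show ?case by simp
next
  case (insert e A)
  let ?a = "\<lambda>p. measure_pmf.prob (bernoulli_subset A p) {X. Q (insert e X)}"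
  let ?b = "\<lambda>p. measure_pmf.prob (bernoulli_subset A p) {X. Q X}"
  have pe: "0 \<le> p e" "p e \<le> p' e" "p' e \<le> 1" using insert.prems(1)[of e] by auto
  have a: "?a p \<le> ?a p'"
  proof (rule insert.IH)
    show "Q (insert e T)" if "S \<subseteq> T" "Q (insert e S)" for S T
      using insert.prems(2)[of "insert e S" "insert e T"] that by blast
  qed (use insert.prems(1) in auto)
  have b: "?b p \<le> ?b p'"
    by (rule insert.IH) (use insert.prems(1) in auto, rule insert.prems(2))
  have ba: "?b p' \<le> ?a p'"
    using insert.prems(2)[OF subset_insertI] by (intro measure_pmf.finite_measure_mono) auto
  have "p e * ?a p + (1 - p e) * ?b p \<le> p e * ?a p' + (1 - p e) * ?b p'"
    using a b pe by (intro add_mono mult_left_mono) auto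
  also have "\<dots> = ?b p' + p e * (?a p' - ?b p')" by (simp add: algebra_simps)
  also have "\<dots> \<le> ?b p' + p' e * (?a p' - ?b p')" using ba pe by (intro add_left_mono mult_right_mono) auto
  also have "\<dots> = p' e * ?a p' + (1 - p' e) * ?b p'" by (simp add: algebra_simps)
  finally show ?case
    using insert.hyps pe by (simp add: prob_bernoulli_subset_insert)
qed

section \<open>Domination of independent edges\<close>

text \<open>The edge relation consists of ordered pairs while the independent model uses unordered
  ones. A fixed representative of each doubleton yields sets without reversed pairs, for which the
  product formula is assumed.\<close>

definition orientation :: "'v set \<Rightarrow> 'v \<times> 'v" where
  "orientation e = (SOME p. e = {fst p, snd p})"

lemma orientation:
  assumes "card e = 2"
  shows "e = {fst (orientation e), snd (orientation e)}" "fst (orientation e) \<noteq> snd (orientation e)"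
proof -
  obtain a b where ab: "e = {a, b}" using assms by (auto simp: card_2_iff)
  then have "\<exists>p. e = {fst p, snd p}" by (intro exI[of _ "(a, b)"]) simp
  then show e: "e = {fst (orientation e), snd (orientation e)}"
    unfolding orientation_def by (rule someI_ex)
  show "fst (orientation e) \<noteq> snd (orientation e)"
  proof
    assume "fst (orientation e) = snd (orientation e)"
    with e have "card e = card {snd (orientation e)}" by auto
    with assms show False by simp
  qed
qed

definition pair_prob :: "real \<Rightarrow> real \<Rightarrow> (int ^ 'd \<Rightarrow> real) \<Rightarrow> (int ^ 'd) set \<Rightarrow> real" where
  "pair_prob \<alpha> lam w e = connection_prob \<alpha> lam w (fst (orientation e)) (snd (orientation e))"

lemma pair_prob_doubleton:
  assumes "a \<noteq> b" shows "pair_prob \<alpha> lam w {a, b} = connection_prob \<alpha> lam w a b"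
proof -
  have "{a, b} = {fst (orientation {a, b}), snd (orientation {a, b})}"
    by (rule orientation(1)) (simp add: assms)
  then show ?thesis
    unfolding pair_prob_def by (auto simp: doubleton_eq_iff connection_prob_commute)
qed

definition undirected :: "'v rel \<Rightarrow> 'v set set" where
  "undirected R = {e. \<exists>a b. e = {a, b} \<and> (a, b) \<in> R}"

lemma mem_undirected_iff:
  assumes "sym R" "card e = 2"
  shows "e \<in> undirected R \<longleftrightarrow> orientation e \<in> R"
proof
  assume "e \<in> undirected R"
  then obtain a b where "e = {a, b}" "(a, b) \<in> R" by (auto simp: undirected_def)
  with orientation(1)[OF assms(2)] symD[OF assms(1)] show "orientation e \<in> R"
    by (cases "orientation e") (auto simp: doubleton_eq_iff)
next
  assume "orientation e \<in> R"
  then show "e \<in> undirected R"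
    using orientation(1)[OF assms(2)] unfolding undirected_def
    by (intro CollectI exI[of _ "fst (orientation e)"] exI[of _ "snd (orientation e)"]) auto
qed

context scale_free_percolation
begin

lemma pair_prob_bounds: "0 \<le> pair_prob \<alpha> lam w e" "pair_prob \<alpha> lam w e \<le> 1"
  using params by (auto simp: pair_prob_def connection_prob_nonneg connection_prob_le_1)

lemma borel_measurable_pair_prob [measurable]: "(\<lambda>\<omega>. pair_prob \<alpha> lam (\<lambda>v. W v \<omega>) e) \<in> borel_measurable M"
  unfolding pair_prob_def connection_prob_def by measurable

lemma integrable_pair_prob_prod:
  "integrable M (\<lambda>\<omega>. (\<Prod>e\<in>S. pair_prob \<alpha> lam (\<lambda>v. W v \<omega>) e) * (\<Prod>e\<in>T. 1 - pair_prob \<alpha> lam (\<lambda>v. W v \<omega>) e))"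
proof (rule integrable_const_bound[where B = 1])
  show "AE \<omega> in M. norm ((\<Prod>e\<in>S. pair_prob \<alpha> lam (\<lambda>v. W v \<omega>) e) * (\<Prod>e\<in>T. 1 - pair_prob \<alpha> lam (\<lambda>v. W v \<omega>) e)) \<le> 1"
  proof (rule AE_I2)
    fix \<omega>
    let ?p = "\<lambda>e. pair_prob \<alpha> lam (\<lambda>v. W v \<omega>) e"
    have "0 \<le> prod ?p S" "prod ?p S \<le> 1" "0 \<le> (\<Prod>e\<in>T. 1 - ?p e)" "(\<Prod>e\<in>T. 1 - ?p e) \<le> 1"
      using pair_prob_bounds by (auto intro!: prod_nonneg prod_le_1)
    then show "norm (prod ?p S * (\<Prod>e\<in>T. 1 - ?p e)) \<le> 1" by (auto simp: abs_mult intro: mult_le_one)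
  qed
qed measurable

lemma sets_undirected:
  assumes "finite S" "finite T" "\<And>e. e \<in> S \<union> T \<Longrightarrow> card e = 2"
  shows "{\<omega> \<in> space M. S \<subseteq> undirected (L \<omega>) \<and> T \<inter> undirected (L \<omega>) = {}} \<in> events"
proof -
  have "{\<omega> \<in> space M. (\<forall>e\<in>S. orientation e \<in> L \<omega>) \<and> (\<forall>e\<in>T. \<not> orientation e \<in> L \<omega>)} \<in> events"
    using assms(1,2) edges_measurable
    by (intro sets.sets_Collect_conj sets.sets_Collect_finite_All sets.sets_Collect_neg)
      (metis (no_types) prod.exhaust_sel)+
  also have "{\<omega> \<in> space M. (\<forall>e\<in>S. orientation e \<in> L \<omega>) \<and> (\<forall>e\<in>T. \<not> orientation e \<in> L \<omega>)}
    = {\<omega> \<in> space M. S \<subseteq> undirected (L \<omega>) \<and> T \<inter> undirected (L \<omega>) = {}}"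
    using mem_undirected_iff[OF edges_sym] assms(3) by (auto simp: subset_eq disjoint_iff)
  finally show ?thesis .
qed

lemma prob_undirected_subset:
  assumes "finite S" "\<And>e. e \<in> S \<Longrightarrow> card e = 2"
  shows "prob {\<omega> \<in> space M. S \<subseteq> undirected (L \<omega>)} = (\<integral>\<omega>. (\<Prod>e\<in>S. pair_prob \<alpha> lam (\<lambda>v. W v \<omega>) e) \<partial>M)"
proof -
  have inj: "inj_on orientation S"
    using orientation(1) assms(2) by (metis inj_onI)
  have anti: "orientation ` S \<inter> (orientation ` S)\<inverse> = {}"
  proof -
    have False if "e \<in> S" "e' \<in> S" "orientation e = (a, b)" "orientation e' = (b, a)" for e e' a b
    proof -
      have "e = {a, b}" "e' = {b, a}" "a \<noteq> b"
        using orientation[of e] orientation(1)[of e'] assms(2) that by auto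
      then have "e = e'" by auto
      then show False using that \<open>a \<noteq> b\<close> by simp
    qed
    note contra = this
    show ?thesis
    proof (rule equals0I)
      fix p assume p: "p \<in> orientation ` S \<inter> (orientation ` S)\<inverse>"
      obtain a b where ab: "p = (a, b)" by (cases p)
      have "(a, b) \<in> orientation ` S" "(b, a) \<in> orientation ` S" using p by (auto simp: ab)
      then obtain e e' where "e \<in> S" "e' \<in> S" "(a, b) = orientation e" "(b, a) = orientation e'"
        by (elim imageE) blast
      then show False using contra by metis
    qed
  qed
  have "{\<omega> \<in> space M. S \<subseteq> undirected (L \<omega>)} = {\<omega> \<in> space M. orientation ` S \<subseteq> L \<omega>}"
    using mem_undirected_iff[OF edges_sym] assms(2) by (auto simp: subset_eq)
  then have "prob {\<omega> \<in> space M. S \<subseteq> undirected (L \<omega>)}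
    = (\<integral>\<omega>. (\<Prod>(x, y)\<in>orientation ` S. connection_prob \<alpha> lam (\<lambda>v. W v \<omega>) x y) \<partial>M)"
    using prob_long_edges[OF _ anti] assms(1) by simp
  also have "\<dots> = (\<integral>\<omega>. (\<Prod>e\<in>S. pair_prob \<alpha> lam (\<lambda>v. W v \<omega>) e) \<partial>M)"
    by (simp add: prod.reindex[OF inj] pair_prob_def case_prod_unfold)
  finally show ?thesis .
qed

text \<open>The model prescribes only the probabilities that edges are present. Absent edges are
  added one by one, subtracting the event that the new edge is present.\<close>

lemma prob_undirected:
  assumes "finite S" "finite T" "S \<inter> T = {}" "\<And>e. e \<in> S \<union> T \<Longrightarrow> card e = 2"
  shows "prob {\<omega> \<in> space M. S \<subseteq> undirected (L \<omega>) \<and> T \<inter> undirected (L \<omega>) = {}}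
    = (\<integral>\<omega>. (\<Prod>e\<in>S. pair_prob \<alpha> lam (\<lambda>v. W v \<omega>) e) * (\<Prod>e\<in>T. 1 - pair_prob \<alpha> lam (\<lambda>v. W v \<omega>) e) \<partial>M)"
  using assms(2,1,3,4)
proof (induction T arbitrary: S rule: finite_induct)
  case empty
  then show ?case using prob_undirected_subset[of S] by simp
next
  case (insert e T)
  let ?p = "\<lambda>\<omega> e. pair_prob \<alpha> lam (\<lambda>v. W v \<omega>) e"
  let ?A = "\<lambda>S T. {\<omega> \<in> space M. S \<subseteq> undirected (L \<omega>) \<and> T \<inter> undirected (L \<omega>) = {}}"
  have eS: "e \<notin> S" using insert.prems by auto
  have "?A S (insert e T) = ?A S T - ?A (insert e S) T" by auto
  moreover have "?A S T \<in> events" "?A (insert e S) T \<in> events"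
    using insert.prems insert.hyps by (intro sets_undirected; auto)+
  moreover have "?A (insert e S) T \<subseteq> ?A S T" by auto
  ultimately have "prob (?A S (insert e T)) = prob (?A S T) - prob (?A (insert e S) T)"
    by (simp only: finite_measure_Diff)
  also have "prob (?A S T) = (\<integral>\<omega>. (\<Prod>e\<in>S. ?p \<omega> e) * (\<Prod>e\<in>T. 1 - ?p \<omega> e) \<partial>M)"
    using insert.prems by (intro insert.IH) auto
  also have "prob (?A (insert e S) T) = (\<integral>\<omega>. (\<Prod>e\<in>insert e S. ?p \<omega> e) * (\<Prod>e\<in>T. 1 - ?p \<omega> e) \<partial>M)"
    using insert.prems insert.hyps by (intro insert.IH) auto
  also have "(\<integral>\<omega>. (\<Prod>e\<in>S. ?p \<omega> e) * (\<Prod>e\<in>T. 1 - ?p \<omega> e) \<partial>M) - \<dots>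
     = (\<integral>\<omega>. (\<Prod>e\<in>S. ?p \<omega> e) * (\<Prod>e\<in>T. 1 - ?p \<omega> e) - (\<Prod>e\<in>insert e S. ?p \<omega> e) * (\<Prod>e\<in>T. 1 - ?p \<omega> e) \<partial>M)"
    by (rule Bochner_Integration.integral_diff[symmetric]) (rule integrable_pair_prob_prod)+
  also have "\<dots> = (\<integral>\<omega>. (\<Prod>e\<in>S. ?p \<omega> e) * (\<Prod>e\<in>insert e T. 1 - ?p \<omega> e) \<partial>M)"
    using insert.prems insert.hyps eS by (intro Bochner_Integration.integral_cong refl) (simp add: algebra_simps)
  finally show ?case .
qed

text \<open>
  All weights are at least \<open>1\<close>, so the long-range edges dominate independent edges with
  probabilities \<open>pair_prob \<alpha> lam (\<lambda>_. 1)\<close>.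
\<close>

lemma prob_increasing_ge:
  assumes E: "finite E" "\<And>e. e \<in> E \<Longrightarrow> card e = 2"
    and Q: "\<And>S T. S \<subseteq> T \<Longrightarrow> Q S \<Longrightarrow> Q T"
  shows "measure_pmf.prob (bernoulli_subset E (pair_prob \<alpha> lam (\<lambda>_. 1))) {X. Q X}
    \<le> prob {\<omega> \<in> space M. Q (undirected (L \<omega>) \<inter> E)}"
proof -
  let ?p = "\<lambda>\<omega> e. pair_prob \<alpha> lam (\<lambda>v. W v \<omega>) e"
  let ?P = "{S. S \<subseteq> E \<and> Q S}"
  \<comment> \<open>\<open>?A S\<close> says that the long-range edges within \<open>E\<close> are
    exactly \<open>S\<close>. Its probability is the expectation of the mass at \<open>S\<close> of
    independent edges with the random probabilities \<open>?p \<omega>\<close>, which dominate those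
    for weights 1.\<close>
  let ?A = "\<lambda>S. {\<omega> \<in> space M. S \<subseteq> undirected (L \<omega>) \<and> (E - S) \<inter> undirected (L \<omega>) = {}}"
  have finP: "finite ?P" using E(1) by simp
  have A: "?A S \<in> events" if "S \<in> ?P" for S
    using that E by (intro sets_undirected) (auto intro: finite_subset)
  have "measure_pmf.prob (bernoulli_subset E (pair_prob \<alpha> lam (\<lambda>_. 1))) {X. Q X}
     = (\<integral>\<omega>. measure_pmf.prob (bernoulli_subset E (pair_prob \<alpha> lam (\<lambda>_. 1))) {X. Q X} \<partial>M)"
    by (simp add: prob_space)
  also have "\<dots> \<le> (\<integral>\<omega>. (\<Sum>S\<in>?P. (\<Prod>e\<in>S. ?p \<omega> e) * (\<Prod>e\<in>E - S. 1 - ?p \<omega> e)) \<partial>M)"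
  proof (rule integral_mono_AE)
    show "integrable M (\<lambda>\<omega>. \<Sum>S\<in>?P. (\<Prod>e\<in>S. ?p \<omega> e) * (\<Prod>e\<in>E - S. 1 - ?p \<omega> e))"
      by (intro Bochner_Integration.integrable_sum integrable_pair_prob_prod)
    show "AE \<omega> in M. measure_pmf.prob (bernoulli_subset E (pair_prob \<alpha> lam (\<lambda>_. 1))) {X. Q X}
       \<le> (\<Sum>S\<in>?P. (\<Prod>e\<in>S. ?p \<omega> e) * (\<Prod>e\<in>E - S. 1 - ?p \<omega> e))"
      using AE_weights_ge_1
    proof eventually_elim
      case (elim \<omega>)
      have "measure_pmf.prob (bernoulli_subset E (pair_prob \<alpha> lam (\<lambda>_. 1))) {X. Q X}
         \<le> measure_pmf.prob (bernoulli_subset E (?p \<omega>)) {X. Q X}"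
      proof (rule prob_bernoulli_subset_mono[OF E(1) _ Q])
        show "0 \<le> pair_prob \<alpha> lam (\<lambda>_. 1) e \<and> pair_prob \<alpha> lam (\<lambda>_. 1) e \<le> ?p \<omega> e \<and> ?p \<omega> e \<le> 1" for e
          using params elim pair_prob_bounds unfolding pair_prob_def
          by (auto intro!: connection_prob_mono)
      qed
      also have "\<dots> = measure_pmf.prob (bernoulli_subset E (?p \<omega>)) ?P"
        using set_pmf_bernoulli_subset[OF E(1), of "?p \<omega>"]
        by (intro measure_prob_cong_0) (auto simp: set_pmf_eq)
      also have "\<dots> = (\<Sum>S\<in>?P. pmf (bernoulli_subset E (?p \<omega>)) S)"
        by (rule measure_measure_pmf_finite[OF finP])
      also have "\<dots> = (\<Sum>S\<in>?P. (\<Prod>e\<in>S. ?p \<omega> e) * (\<Prod>e\<in>E - S. 1 - ?p \<omega> e))"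
        using E(1) pair_prob_bounds by (intro sum.cong refl pmf_bernoulli_subset) auto
      finally show ?case .
    qed
  qed simp
  also have "\<dots> = (\<Sum>S\<in>?P. prob (?A S))"
    using E by (subst Bochner_Integration.integral_sum[OF integrable_pair_prob_prod],
      intro sum.cong refl, subst prob_undirected) (auto intro: finite_subset)
  also have "\<dots> = prob (\<Union>S\<in>?P. ?A S)"
  proof (rule finite_measure_finite_Union[symmetric, OF finP])
    show "?A ` ?P \<subseteq> events" using A by auto
    have "S = undirected (L \<omega>) \<inter> E" if "S \<in> ?P" "\<omega> \<in> ?A S" for S \<omega> using that by blast
    then show "disjoint_family_on ?A ?P" unfolding disjoint_family_on_def by blast
  qed
  also have "(\<Union>S\<in>?P. ?A S) = {\<omega> \<in> space M. Q (undirected (L \<omega>) \<inter> E)}"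
  proof (intro equalityI subsetI)
    fix \<omega> assume "\<omega> \<in> (\<Union>S\<in>?P. ?A S)"
    then obtain S where "S \<in> ?P" "\<omega> \<in> ?A S" by blast
    moreover from this have "undirected (L \<omega>) \<inter> E = S" by blast
    ultimately show "\<omega> \<in> {\<omega> \<in> space M. Q (undirected (L \<omega>) \<inter> E)}" by simp
  next
    fix \<omega> assume "\<omega> \<in> {\<omega> \<in> space M. Q (undirected (L \<omega>) \<inter> E)}"
    then show "\<omega> \<in> (\<Union>S\<in>?P. ?A S)"
      by (intro UN_I[of "undirected (L \<omega>) \<inter> E"]) auto
  qed
  finally show ?thesis .
qed

end

section \<open>Hierarchies of cells\<close>

definition doubletons :: "'v set \<Rightarrow> 'v set set" where
  "doubletons A = {e. e \<subseteq> A \<and> card e = 2}"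

lemma finite_doubletons: "finite A \<Longrightarrow> finite (doubletons A)"
  by (simp add: doubletons_def)

lemma doubletons_mono: "A \<subseteq> B \<Longrightarrow> doubletons A \<subseteq> doubletons B"
  by (auto simp: doubletons_def)

lemma doubletons_disjoint: "A \<inter> B = {} \<Longrightarrow> doubletons A \<inter> doubletons B = {}"
  by (auto simp: doubletons_def card_2_iff)

text \<open>A cell is good if its core is nonempty; \<open>{}\<close> encodes a bad cell.\<close>

primrec core :: "(nat \<Rightarrow> 'v \<Rightarrow> 'v set) \<Rightarrow> 'v set set \<Rightarrow> nat \<Rightarrow> 'v set \<Rightarrow> 'v set" where
  "core cell X 0 Q = Q"
| "core cell X (Suc t) Q =
    (let G = {q \<in> cell t ` Q. core cell X t q \<noteq> {}} in
     if card (cell t ` Q) \<le> 2 * card G \<and>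
        (\<forall>q\<in>G. \<forall>q'\<in>G. q \<noteq> q' \<longrightarrow> (\<exists>a\<in>core cell X t q. \<exists>b\<in>core cell X t q'. {a, b} \<in> X))
     then \<Union>q\<in>G. core cell X t q else {})"

text \<open>The cells of level \<open>t\<close> partition the vertices into classes of size
  \<open>n t\<close>, and each cell of the next level consists of \<open>m t\<close> of them. Kept
  abstract because two hierarchies with different scales are used together.\<close>

locale cell_hierarchy =
  fixes cell :: "nat \<Rightarrow> 'v \<Rightarrow> 'v set" and n m :: "nat \<Rightarrow> nat"
  assumes mem_cell: "v \<in> cell t v"
    and cell_eq: "w \<in> cell t v \<Longrightarrow> cell t w = cell t v"
    and cell_Suc: "cell t v \<subseteq> cell (Suc t) v"
    and finite_cell: "finite (cell t v)"
    and card_cell: "card (cell t v) = n t"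
    and card_subcells: "card (cell t ` cell (Suc t) v) = m t"
begin

lemma cells_disjoint: "cell t v \<noteq> cell t w \<Longrightarrow> cell t v \<inter> cell t w = {}"
  using cell_eq by blast

lemma cell_mono: "s \<le> t \<Longrightarrow> cell s v \<subseteq> cell t v"
  using cell_Suc by (rule lift_Suc_mono_le[where f = "\<lambda>t. cell t v"])

lemma cell_subset: "w \<in> cell t v \<Longrightarrow> s \<le> t \<Longrightarrow> cell s w \<subseteq> cell t v"
  using cell_mono[of s t w] cell_eq[of w t v] by simp

lemma n_Suc: "n (Suc t) = m t * n t"
proof -
  obtain v :: 'v where True by simp
  have "cell (Suc t) v = (\<Union>q\<in>cell t ` cell (Suc t) v. q)"
    using mem_cell cell_subset[of _ "Suc t" v t] by auto
  then have "card (cell (Suc t) v) = card (\<Union>q\<in>cell t ` cell (Suc t) v. q)" by simp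
  also have "\<dots> = (\<Sum>q\<in>cell t ` cell (Suc t) v. card q)"
    using finite_cell cells_disjoint by (intro card_UN_disjoint) auto
  also have "\<dots> = (\<Sum>q\<in>cell t ` cell (Suc t) v. n t)"
    by (intro sum.cong) (auto simp: card_cell)
  finally show ?thesis by (simp add: card_cell card_subcells)
qed

lemma core_subset: "core cell X t (cell t v) \<subseteq> cell t v"
proof (induction t arbitrary: v)
  case (Suc t)
  have "core cell X (Suc t) (cell (Suc t) v) \<subseteq> (\<Union>q\<in>cell t ` cell (Suc t) v. core cell X t q)"
    by (auto simp: Let_def split: if_splits)
  also have "\<dots> \<subseteq> cell (Suc t) v"
  proof (rule UN_least)
    fix q assume "q \<in> cell t ` cell (Suc t) v"
    then obtain w where "w \<in> cell (Suc t) v" "q = cell t w" by blast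
    then show "core cell X t q \<subseteq> cell (Suc t) v"
      using Suc.IH[of w] cell_subset[of w "Suc t" v t] by auto
  qed
  finally show ?case .
qed simp

text \<open>At least half of the subcells of a good cell are good, so each level loses a factor of
  at most 2.\<close>

lemma card_core_ge:
  assumes "core cell X t (cell t v) \<noteq> {}"
  shows "n t \<le> 2 ^ t * card (core cell X t (cell t v))"
  using assms
proof (induction t arbitrary: v)
  case 0
  then show ?case by (simp add: card_cell)
next
  case (Suc t)
  define G where "G = {q \<in> cell t ` cell (Suc t) v. core cell X t q \<noteq> {}}"
  have finG: "finite G" unfolding G_def using finite_cell by auto
  have mG: "m t \<le> 2 * card G" and core: "core cell X (Suc t) (cell (Suc t) v) = (\<Union>q\<in>G. core cell X t q)"
    using Suc.prems by (auto simp: Let_def G_def card_subcells split: if_splits)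
  have fin: "finite (core cell X t q)" if "q \<in> G" for q
    using that finite_subset[OF core_subset finite_cell] unfolding G_def by auto
  have dis: "core cell X t q \<inter> core cell X t q' = {}" if "q \<in> G" "q' \<in> G" "q \<noteq> q'" for q q'
    using that core_subset cells_disjoint unfolding G_def by blast
  have "n (Suc t) \<le> 2 * card G * n t" using mG by (simp add: n_Suc)
  also have "\<dots> = 2 * (\<Sum>q\<in>G. n t)" by simp
  also have "\<dots> \<le> 2 * (\<Sum>q\<in>G. 2 ^ t * card (core cell X t q))"
    using Suc.IH unfolding G_def by (intro mult_left_mono sum_mono) auto
  also have "\<dots> = 2 ^ Suc t * (\<Sum>q\<in>G. card (core cell X t q))" by (simp add: sum_distrib_left mult.assoc)
  also have "(\<Sum>q\<in>G. card (core cell X t q)) = card (\<Union>q\<in>G. core cell X t q)"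
    using finG fin dis by (intro card_UN_disjoint[symmetric]) auto
  finally show ?case by (simp only: core)
qed

text \<open>The source of all independence: a core is determined by the pairs inside its own cell,
  so the cores of disjoint cells and the edges between those cells depend on disjoint sets of
  pairs.\<close>

lemma core_local:
  assumes "doubletons (cell t v) \<subseteq> Y"
  shows "core cell (X \<inter> Y) t (cell t v) = core cell X t (cell t v)"
  using assms
proof (induction t arbitrary: v)
  case (Suc t)
  have eq: "core cell (X \<inter> Y) t q = core cell X t q" if "q \<in> cell t ` cell (Suc t) v" for q
  proof -
    obtain w where w: "w \<in> cell (Suc t) v" "q = cell t w" using \<open>q \<in> _\<close> by blast
    have "doubletons (cell t w) \<subseteq> Y"
      using doubletons_mono[OF cell_subset[OF w(1), of t]] Suc.prems by auto
    then show ?thesis using Suc.IH w by simp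
  qed
  have link: "{a, b} \<in> X \<inter> Y \<longleftrightarrow> {a, b} \<in> X"
    if "q \<in> cell t ` cell (Suc t) v" "q' \<in> cell t ` cell (Suc t) v" "q \<noteq> q'"
      "a \<in> core cell X t q" "b \<in> core cell X t q'" for q q' a b
  proof -
    obtain w w' where w: "w \<in> cell (Suc t) v" "q = cell t w" "w' \<in> cell (Suc t) v" "q' = cell t w'"
      using \<open>q \<in> _\<close> \<open>q' \<in> _\<close> by blast
    have "a \<in> q" "b \<in> q'" using core_subset w that by blast+
    moreover have "q \<inter> q' = {}" using cells_disjoint w that by simp
    moreover have "q \<subseteq> cell (Suc t) v" "q' \<subseteq> cell (Suc t) v" using w cell_subset[of _ "Suc t" v t] by auto
    moreover from calculation have "a \<noteq> b" by auto
    ultimately have "{a, b} \<in> doubletons (cell (Suc t) v)" by (auto simp: doubletons_def)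
    then show ?thesis using Suc.prems by blast
  qed
  have G: "{q \<in> cell t ` cell (Suc t) v. core cell (X \<inter> Y) t q \<noteq> {}} = {q \<in> cell t ` cell (Suc t) v. core cell X t q \<noteq> {}}"
    using eq by auto
  have L: "(\<forall>q\<in>G. \<forall>q'\<in>G. q \<noteq> q' \<longrightarrow> (\<exists>a\<in>core cell (X \<inter> Y) t q. \<exists>b\<in>core cell (X \<inter> Y) t q'. {a, b} \<in> X \<inter> Y)) \<longleftrightarrow>
      (\<forall>q\<in>G. \<forall>q'\<in>G. q \<noteq> q' \<longrightarrow> (\<exists>a\<in>core cell X t q. \<exists>b\<in>core cell X t q'. {a, b} \<in> X))"
    if "G \<subseteq> cell t ` cell (Suc t) v" for G
  proof (intro ball_cong refl imp_cong)
    fix q q' assume q: "q \<in> G" "q' \<in> G" "q \<noteq> q'"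
    then have q2: "q \<in> cell t ` cell (Suc t) v" "q' \<in> cell t ` cell (Suc t) v" using that by auto
    show "(\<exists>a\<in>core cell (X \<inter> Y) t q. \<exists>b\<in>core cell (X \<inter> Y) t q'. {a, b} \<in> X \<inter> Y) \<longleftrightarrow>
       (\<exists>a\<in>core cell X t q. \<exists>b\<in>core cell X t q'. {a, b} \<in> X)"
      unfolding eq[OF q2(1)] eq[OF q2(2)] using link[OF q2 q(3)] by auto
  qed
  have U: "(\<Union>q\<in>G. core cell (X \<inter> Y) t q) = (\<Union>q\<in>G. core cell X t q)" if "G \<subseteq> cell t ` cell (Suc t) v" for G
    by (intro SUP_cong refl eq subsetD[OF that])
  show ?case
    unfolding core.simps(2) Let_def G
    by (subst L, blast, subst U, blast) (rule refl)
qed simp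

text \<open>Two subcells of a good cell are joined by one link between their cores, so a path of the
  next level is two paths and one edge. Counting vertices instead of edges turns this into an exact
  doubling, hence the form \<open>Suc l \<le> 2 ^ t * Suc D\<close>.\<close>

lemma core_path:
  assumes base: "\<And>v a b. a \<in> cell 0 v \<Longrightarrow> b \<in> cell 0 v \<Longrightarrow> \<exists>l\<le>D. (a, b) \<in> H ^^ l"
    and H: "\<And>a b. {a, b} \<in> X \<Longrightarrow> (a, b) \<in> H"
    and ab: "a \<in> core cell X t (cell t v)" "b \<in> core cell X t (cell t v)"
  shows "\<exists>l. Suc l \<le> 2 ^ t * Suc D \<and> (a, b) \<in> H ^^ l"
  using ab
proof (induction t arbitrary: v a b)
  case 0
  then show ?case using base[of a v b] by auto
next
  case (Suc t)
  define G where "G = {q \<in> cell t ` cell (Suc t) v. core cell X t q \<noteq> {}}"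
  have core: "core cell X (Suc t) (cell (Suc t) v) = (\<Union>q\<in>G. core cell X t q)"
    and link: "\<And>q q'. q \<in> G \<Longrightarrow> q' \<in> G \<Longrightarrow> q \<noteq> q' \<Longrightarrow> \<exists>c\<in>core cell X t q. \<exists>d\<in>core cell X t q'. {c, d} \<in> X"
    using Suc.prems by (auto simp: Let_def G_def split: if_splits)
  obtain q q' where q: "q \<in> G" "a \<in> core cell X t q" "q' \<in> G" "b \<in> core cell X t q'"
    using Suc.prems core by auto
  then obtain w w' where w: "q = cell t w" "q' = cell t w'" by (auto simp: G_def)
  show ?case
  proof (cases "q = q'")
    case True
    then obtain l where "Suc l \<le> 2 ^ t * Suc D" "(a, b) \<in> H ^^ l"
      using Suc.IH[of a w b] q w by auto
    then show ?thesis by (intro exI[of _ l]) auto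
  next
    case False
    then obtain c d where cd: "c \<in> core cell X t q" "d \<in> core cell X t q'" "{c, d} \<in> X"
      using link q by blast
    obtain l1 where l1: "Suc l1 \<le> 2 ^ t * Suc D" "(a, c) \<in> H ^^ l1"
      using Suc.IH[of a w c] q cd w by auto
    obtain l2 where l2: "Suc l2 \<le> 2 ^ t * Suc D" "(d, b) \<in> H ^^ l2"
      using Suc.IH[of d w' b] q cd w by auto
    have "(a, d) \<in> H ^^ Suc l1" using l1(2) H[OF cd(3)] by auto
    then have "(a, b) \<in> H ^^ (Suc l1 + l2)" using l2(2) unfolding relpow_add by (rule relcompI)
    then show ?thesis using l1(1) l2(1) by (intro exI[of _ "Suc l1 + l2"]) auto
  qed
qed

definition unlinked :: "'v set set \<Rightarrow> nat \<Rightarrow> 'v \<Rightarrow> 'v \<Rightarrow> bool" where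
  "unlinked X t v w \<longleftrightarrow> core cell X t (cell t v) \<noteq> {} \<and> core cell X t (cell t w) \<noteq> {} \<and>
    (\<forall>a\<in>core cell X t (cell t v). \<forall>b\<in>core cell X t (cell t w). {a, b} \<notin> X)"

text \<open>The two causes of failure are estimated by different means: many bad subcells through
  independence, a missing link through the number of available pairs.\<close>

lemma core_Suc_empty_cases:
  assumes "core cell X (Suc t) (cell (Suc t) v) = {}"
  shows "(\<exists>J\<subseteq>cell t ` cell (Suc t) v. m t \<le> 2 * card J \<and> (\<forall>q\<in>J. core cell X t q = {})) \<or>
    (\<exists>w\<in>cell (Suc t) v. \<exists>w'\<in>cell (Suc t) v. cell t w \<noteq> cell t w' \<and> unlinked X t w w')"
proof -
  define Ch where "Ch = cell t ` cell (Suc t) v"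
  define G where "G = {q \<in> Ch. core cell X t q \<noteq> {}}"
  have fin: "finite Ch" by (simp add: Ch_def finite_cell)
  have cm: "card Ch = m t" by (simp add: Ch_def card_subcells)
  show ?thesis
  proof (cases "m t \<le> 2 * card G")
    case False
    have "card (Ch - G) = m t - card G"
      using fin cm by (subst card_Diff_subset) (auto simp: G_def)
    then have "m t \<le> 2 * card (Ch - G)" using False by linarith
    moreover have "\<forall>q\<in>Ch - G. core cell X t q = {}" by (auto simp: G_def)
    ultimately show ?thesis unfolding Ch_def[symmetric] by blast
  next
    case True
    have ne: "G \<noteq> {}"
    proof
      assume "G = {}"
      then have "m t = 0" using True by simp
      then show False using cm fin mem_cell[of v "Suc t"] by (auto simp: Ch_def)
    qed
    have "\<not> (\<forall>q\<in>G. \<forall>q'\<in>G. q \<noteq> q' \<longrightarrow> (\<exists>a\<in>core cell X t q. \<exists>b\<in>core cell X t q'. {a, b} \<in> X))"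
    proof
      assume "\<forall>q\<in>G. \<forall>q'\<in>G. q \<noteq> q' \<longrightarrow> (\<exists>a\<in>core cell X t q. \<exists>b\<in>core cell X t q'. {a, b} \<in> X)"
      then have "core cell X (Suc t) (cell (Suc t) v) = (\<Union>q\<in>G. core cell X t q)"
        using True cm by (simp add: Let_def G_def Ch_def)
      moreover have "(\<Union>q\<in>G. core cell X t q) \<noteq> {}" using ne by (auto simp: G_def)
      ultimately show False using assms by simp
    qed
    then show ?thesis unfolding unlinked_def G_def Ch_def by blast
  qed
qed

text \<open>The core of a good cell is the union of the cores of its good subcells, so a low core
  survives to the top if nothing in between is bad. This is how vertices are led into the top
  core.\<close>

lemma core_chain:
  assumes "\<And>s w. t0 \<le> s \<Longrightarrow> s \<le> t \<Longrightarrow> w \<in> cell t v \<Longrightarrow> core cell X s (cell s w) \<noteq> {}"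
    and "t0 \<le> t" "w \<in> cell t v"
  shows "core cell X t0 (cell t0 w) \<subseteq> core cell X t (cell t v)"
  using assms
proof (induction t arbitrary: v)
  case 0
  then show ?case using cell_eq by auto
next
  case (Suc t)
  show ?case
  proof (cases "t0 = Suc t")
    case True
    then show ?thesis using Suc.prems cell_eq by auto
  next
    case False
    then have t: "t0 \<le> t" using Suc.prems by simp
    have "core cell X t0 (cell t0 w) \<subseteq> core cell X t (cell t w)"
    proof (rule Suc.IH[OF _ t mem_cell])
      fix s u assume "t0 \<le> s" "s \<le> t" "u \<in> cell t w"
      moreover from this have "u \<in> cell (Suc t) v"
        using cell_subset[OF Suc.prems(3), of t] by auto
      ultimately show "core cell X s (cell s u) \<noteq> {}" using Suc.prems(1) by auto
    qed
    also have "\<dots> \<subseteq> core cell X (Suc t) (cell (Suc t) v)"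
    proof -
      define G where "G = {q \<in> cell t ` cell (Suc t) v. core cell X t q \<noteq> {}}"
      have "core cell X (Suc t) (cell (Suc t) v) \<noteq> {}"
        using Suc.prems(1)[of "Suc t" v] Suc.prems(2) mem_cell by simp
      then have "core cell X (Suc t) (cell (Suc t) v) = (\<Union>q\<in>G. core cell X t q)"
        by (auto simp: Let_def G_def split: if_splits)
      moreover have "cell t w \<in> G"
        using Suc.prems(1)[of t w] Suc.prems(3) t by (auto simp: G_def)
      ultimately show ?thesis by blast
    qed
    finally show ?thesis .
  qed
qed

end

section \<open>Failure probabilities of a hierarchy with independent edges\<close>

context cell_hierarchy
begin

lemma m_pos: "0 < m t"
proof -
  obtain v :: 'v where True by simp
  have "cell t ` cell (Suc t) v \<noteq> {}" using mem_cell[of v "Suc t"] by auto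
  then show ?thesis using card_subcells[of t v] finite_cell by (metis card_gt_0_iff finite_imageI)
qed

text \<open>Once the edges inside the two cells are revealed, the cores are fixed and have at least
  \<open>n t / 2 ^ t\<close> vertices each. The edges between the cells are still fresh, and all
  pairs between the cores have to be absent.\<close>

lemma prob_unlinked_le:
  assumes \<Lambda>: "finite \<Lambda>" "cell t v \<subseteq> \<Lambda>" "cell t w \<subseteq> \<Lambda>" and ne: "cell t v \<noteq> cell t w"
    and p: "\<And>e. 0 \<le> p e \<and> p e \<le> 1" "0 \<le> \<rho>"
      "\<And>a b. a \<in> cell t v \<Longrightarrow> b \<in> cell t w \<Longrightarrow> \<rho> \<le> p {a, b}"
  shows "measure_pmf.prob (bernoulli_subset (doubletons \<Lambda>) p) {X. unlinked X t v w}
    \<le> exp (- (\<rho> * (real (n t) / 2 ^ t)\<^sup>2))"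
proof -
  let ?V = "cell t v" and ?W = "cell t w"
  have dis: "?V \<inter> ?W = {}" using ne by (rule cells_disjoint)
  define B where "B = doubletons ?V \<union> doubletons ?W"
  define C where "C = (\<lambda>(a, b). {a, b}) ` (?V \<times> ?W)"
  define U where "U = (\<lambda>S T. core cell S t ?V \<noteq> {} \<and> core cell S t ?W \<noteq> {} \<and>
    (\<forall>a\<in>core cell S t ?V. \<forall>b\<in>core cell S t ?W. {a, b} \<notin> T))"
  have BL: "B \<subseteq> doubletons \<Lambda>" unfolding B_def using \<Lambda>(2,3) by (intro Un_least doubletons_mono)
  have CL: "C \<subseteq> doubletons \<Lambda>"
  proof
    fix e assume "e \<in> C"
    then obtain a b where "e = {a, b}" "a \<in> ?V" "b \<in> ?W" by (auto simp: C_def)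
    moreover from this have "a \<noteq> b" using dis by auto
    ultimately show "e \<in> doubletons \<Lambda>" using \<Lambda> by (auto simp: doubletons_def)
  qed
  have BC: "B \<inter> C = {}"
  proof (rule equals0I)
    fix e assume "e \<in> B \<inter> C"
    then obtain a b where "e = {a, b}" "a \<in> ?V" "b \<in> ?W" "e \<subseteq> ?V \<or> e \<subseteq> ?W"
      by (auto simp: B_def C_def doubletons_def)
    then show False using dis by auto
  qed
  have UX: "unlinked X t v w \<longleftrightarrow> U (X \<inter> B) (X \<inter> C)" for X
  proof -
    have c: "core cell (X \<inter> B) t ?V = core cell X t ?V" "core cell (X \<inter> B) t ?W = core cell X t ?W"
      by (auto intro!: core_local simp: B_def)
    have "{a, b} \<in> C" if "a \<in> core cell X t ?V" "b \<in> core cell X t ?W" for a b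
      using that core_subset unfolding C_def by blast
    then show ?thesis unfolding unlinked_def U_def c by auto
  qed
  show ?thesis unfolding UX
  proof (rule prob_bernoulli_subset_cond_le[OF _ BL CL BC])
    fix S
    show "measure_pmf.prob (bernoulli_subset C p) {T. U S T} \<le> exp (- (\<rho> * (real (n t) / 2 ^ t)\<^sup>2))"
    proof (cases "core cell S t ?V \<noteq> {} \<and> core cell S t ?W \<noteq> {}")
      case False
      then have "{T. U S T} = {}" by (auto simp: U_def)
      then show ?thesis by simp
    next
      case True
      let ?A = "core cell S t ?V" and ?A' = "core cell S t ?W"
      have sub: "?A \<subseteq> ?V" "?A' \<subseteq> ?W" by (rule core_subset)+
      define D where "D = (\<lambda>(a, b). {a, b}) ` (?A \<times> ?A')"
      have DC: "D \<subseteq> C" using sub by (auto simp: D_def C_def)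
      have inj: "inj_on (\<lambda>(a, b). {a, b}) (?A \<times> ?A')"
        using sub dis by (auto simp: inj_on_def doubleton_eq_iff)
      have cD: "card D = card ?A * card ?A'"
        unfolding D_def by (simp add: card_image[OF inj] card_cartesian_product)
      have "measure_pmf.prob (bernoulli_subset C p) {T. U S T}
         \<le> measure_pmf.prob (bernoulli_subset C p) {T. T \<inter> D = {}}"
        by (rule measure_pmf.finite_measure_mono) (auto simp: U_def D_def)
      also have "\<dots> \<le> exp (- (\<rho> * real (card D)))"
      proof (rule prob_bernoulli_subset_disjoint_le[OF _ DC])
        show "finite C" using finite_cell by (simp add: C_def)
        show "\<rho> \<le> p e" if "e \<in> D" for e
          using that sub p(3) by (auto simp: D_def)
      qed (use p in auto)
      also have "\<dots> \<le> exp (- (\<rho> * (real (n t) / 2 ^ t)\<^sup>2))"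
      proof -
        have "real (n t) \<le> real (2 ^ t * card ?A)" "real (n t) \<le> real (2 ^ t * card ?A')"
          unfolding of_nat_le_iff
          using card_core_ge[of S t v] card_core_ge[of S t w] True by blast+
        then have "real (n t) \<le> 2 ^ t * real (card ?A)" "real (n t) \<le> 2 ^ t * real (card ?A')"
          by simp_all
        then have "real (n t) / 2 ^ t \<le> real (card ?A)" "real (n t) / 2 ^ t \<le> real (card ?A')"
          by (auto simp: divide_le_eq mult.commute)
        then have "(real (n t) / 2 ^ t)\<^sup>2 \<le> real (card D)"
          unfolding cD power2_eq_square of_nat_mult by (intro mult_mono) auto
        then show ?thesis using p(2) by (simp add: mult_left_mono)
      qed
      finally show ?thesis .
    qed
  qed (use \<Lambda> finite_doubletons in auto)
qed

text \<open>Distinct cells of one level are disjoint, so by \<open>core_local\<close> these events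
  are independent.\<close>

lemma prob_all_cores_empty_le:
  assumes \<Lambda>: "finite \<Lambda>" and J: "finite J" "J \<subseteq> range (cell t)" "\<And>q. q \<in> J \<Longrightarrow> q \<subseteq> \<Lambda>"
    and c: "\<And>q. q \<in> J \<Longrightarrow> measure_pmf.prob (bernoulli_subset (doubletons \<Lambda>) p) {X. core cell X t q = {}} \<le> c"
  shows "measure_pmf.prob (bernoulli_subset (doubletons \<Lambda>) p) {X. \<forall>q\<in>J. core cell X t q = {}} \<le> c ^ card J"
  using J c
proof (induction J rule: finite_induct)
  case empty
  then show ?case by simp
next
  case (insert q J)
  let ?P = "measure_pmf.prob (bernoulli_subset (doubletons \<Lambda>) p)"
  obtain v where v: "q = cell t v" using insert.prems(1) by auto
  have dis: "q \<inter> q' = {}" if "q' \<in> J" for q'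
  proof -
    have "q' \<in> range (cell t)" using that insert.prems(1) by blast
    then obtain w where "q' = cell t w" by blast
    moreover have "q \<noteq> q'" using that insert.hyps by auto
    ultimately show ?thesis using cells_disjoint v by auto
  qed
  define C where "C = (\<Union>q'\<in>J. doubletons q')"
  have local_q: "core cell (X \<inter> doubletons q) t q = core cell X t q" for X
    unfolding v by (rule core_local) simp
  have local_J: "core cell (X \<inter> C) t q' = core cell X t q'" if "q' \<in> J" for X q'
  proof -
    have "q' \<in> range (cell t)" using that insert.prems(1) by blast
    then obtain w where w: "q' = cell t w" by blast
    have "doubletons (cell t w) \<subseteq> C" using that w by (auto simp: C_def)
    then show ?thesis unfolding w by (rule core_local)
  qed
  have "{X. \<forall>q'\<in>insert q J. core cell X t q' = {}}
    = {X. core cell (X \<inter> doubletons q) t q = {} \<and> (\<forall>q'\<in>J. core cell (X \<inter> C) t q' = {})}"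
    using local_q local_J by auto
  also have "?P \<dots> = ?P {X. core cell (X \<inter> doubletons q) t q = {}} * ?P {X. \<forall>q'\<in>J. core cell (X \<inter> C) t q' = {}}"
  proof (rule prob_bernoulli_subset_indep[where P = "\<lambda>Y. core cell Y t q = {}" and Q = "\<lambda>Y. \<forall>q'\<in>J. core cell Y t q' = {}"])
    show "doubletons q \<subseteq> doubletons \<Lambda>" by (intro doubletons_mono insert.prems(2)) simp
    show "C \<subseteq> doubletons \<Lambda>" unfolding C_def by (intro UN_least doubletons_mono insert.prems(2)) simp
    have "doubletons q \<inter> doubletons q' = {}" if "q' \<in> J" for q'
      using dis[OF that] by (rule doubletons_disjoint)
    then show "doubletons q \<inter> C = {}" by (auto simp: C_def)
  qed (use \<Lambda> finite_doubletons in auto)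
  also have "{X. core cell (X \<inter> doubletons q) t q = {}} = {X. core cell X t q = {}}" by (simp add: local_q)
  also have "{X. \<forall>q'\<in>J. core cell (X \<inter> C) t q' = {}} = {X. \<forall>q'\<in>J. core cell X t q' = {}}"
    using local_J by auto
  also have "?P {X. core cell X t q = {}} * ?P {X. \<forall>q'\<in>J. core cell X t q' = {}} \<le> c * c ^ card J"
  proof -
    have "?P {X. core cell X t q = {}} \<le> c" using insert.prems(3) by simp
    moreover have "?P {X. \<forall>q'\<in>J. core cell X t q' = {}} \<le> c ^ card J"
      using insert.prems by (intro insert.IH) auto
    moreover have "0 \<le> c" using calculation(1) measure_nonneg order_trans by blast
    ultimately show ?thesis by (intro mult_mono) auto
  qed
  finally show ?case using insert.hyps by simp
qed

text \<open>Origin of \<open>1 / 16\<close>: at least \<open>m t / 2\<close> bad subcells have joint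
  probability at most \<open>(1 / 4) ^ m t\<close>, which leaves \<open>(1 / 2) ^ m t\<close> after
  a union bound over at most \<open>2 ^ m t\<close> choices of \<open>J\<close>.\<close>

lemma prob_half_cores_empty_le:
  assumes \<Lambda>: "finite \<Lambda>" "cell (Suc t) v \<subseteq> \<Lambda>"
    and c: "\<And>w. w \<in> cell (Suc t) v \<Longrightarrow>
      measure_pmf.prob (bernoulli_subset (doubletons \<Lambda>) p) {X. core cell X t (cell t w) = {}} \<le> 1 / 16"
  shows "measure_pmf.prob (bernoulli_subset (doubletons \<Lambda>) p)
      {X. \<exists>J\<subseteq>cell t ` cell (Suc t) v. m t \<le> 2 * card J \<and> (\<forall>q\<in>J. core cell X t q = {})} \<le> (1 / 2) ^ m t"
proof -
  let ?P = "measure_pmf.prob (bernoulli_subset (doubletons \<Lambda>) p)"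
  define Ch where "Ch = cell t ` cell (Suc t) v"
  have fin: "finite Ch" "card Ch = m t" by (auto simp: Ch_def finite_cell card_subcells)
  define \<J> where "\<J> = {J. J \<subseteq> Ch \<and> m t \<le> 2 * card J}"
  have fJ: "finite \<J>" using fin by (simp add: \<J>_def)
  have "?P {X. \<exists>J\<subseteq>Ch. m t \<le> 2 * card J \<and> (\<forall>q\<in>J. core cell X t q = {})}
    = ?P (\<Union>J\<in>\<J>. {X. \<forall>q\<in>J. core cell X t q = {}})"
    by (rule arg_cong[where f = ?P]) (auto simp: \<J>_def)
  also have "\<dots> \<le> (\<Sum>J\<in>\<J>. ?P {X. \<forall>q\<in>J. core cell X t q = {}})"
    using fJ by (intro measure_pmf.finite_measure_subadditive_finite) auto
  also have "\<dots> \<le> (\<Sum>J\<in>\<J>. (1 / 4) ^ m t)"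
  proof (rule sum_mono)
    fix J assume J: "J \<in> \<J>"
    have "?P {X. \<forall>q\<in>J. core cell X t q = {}} \<le> (1 / 16) ^ card J"
    proof (rule prob_all_cores_empty_le[OF \<Lambda>(1)])
      fix q assume "q \<in> J"
      then obtain w where w: "w \<in> cell (Suc t) v" "q = cell t w" using J by (auto simp: \<J>_def Ch_def)
      show "q \<subseteq> \<Lambda>" using w cell_subset[of w "Suc t" v t] \<Lambda>(2) by auto
      show "?P {X. core cell X t q = {}} \<le> 1 / 16" using c w by simp
    qed (use J fin in \<open>auto simp: \<J>_def Ch_def intro: finite_subset\<close>)
    also have "(1 / 16 :: real) ^ card J = (1 / 4) ^ (2 * card J)"
      by (simp add: power_mult power2_eq_square)
    also have "\<dots> \<le> (1 / 4) ^ m t" using J by (intro power_decreasing) (auto simp: \<J>_def)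
    finally show "?P {X. \<forall>q\<in>J. core cell X t q = {}} \<le> (1 / 4) ^ m t" .
  qed
  also have "\<dots> = real (card \<J>) * (1 / 4) ^ m t" by simp
  also have "\<dots> \<le> 2 ^ m t * (1 / 4) ^ m t"
  proof (rule mult_right_mono)
    have "card \<J> \<le> card (Pow Ch)" using fin by (intro card_mono) (auto simp: \<J>_def)
    then show "real (card \<J>) \<le> 2 ^ m t" using fin by (simp add: card_Pow flip: of_nat_le_iff)
  qed simp
  also have "\<dots> = (1 / 2) ^ m t" by (simp flip: power_mult_distrib)
  finally show ?thesis by (simp add: Ch_def)
qed

text \<open>Only pairs with a common parent inside the box count, since the parent controls their
  distance and hence \<open>\<rho>\<close>.\<close>

lemma prob_some_unlinked_le:
  assumes \<Lambda>: "finite \<Lambda>" and V: "V \<subseteq> \<Lambda>"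
    and p: "\<And>e. 0 \<le> p e \<and> p e \<le> 1" "0 \<le> \<rho>"
      "\<And>v a b. cell (Suc t) v \<subseteq> \<Lambda> \<Longrightarrow> a \<in> cell (Suc t) v \<Longrightarrow> b \<in> cell (Suc t) v \<Longrightarrow> a \<noteq> b \<Longrightarrow> \<rho> \<le> p {a, b}"
  shows "measure_pmf.prob (bernoulli_subset (doubletons \<Lambda>) p)
      {X. \<exists>w\<in>V. \<exists>w'\<in>V. \<exists>v. cell (Suc t) v \<subseteq> \<Lambda> \<and> w \<in> cell (Suc t) v \<and> w' \<in> cell (Suc t) v \<and>
         cell t w \<noteq> cell t w' \<and> unlinked X t w w'}
    \<le> (real (card V))\<^sup>2 * exp (- (\<rho> * (real (n t) / 2 ^ t)\<^sup>2))"
proof -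
  let ?P = "measure_pmf.prob (bernoulli_subset (doubletons \<Lambda>) p)"
  let ?x = "exp (- (\<rho> * (real (n t) / 2 ^ t)\<^sup>2))"
  define Z where "Z = {(w, w'). w \<in> V \<and> w' \<in> V \<and> (\<exists>v. cell (Suc t) v \<subseteq> \<Lambda> \<and> w \<in> cell (Suc t) v \<and> w' \<in> cell (Suc t) v \<and> cell t w \<noteq> cell t w')}"
  have finV: "finite V" using V \<Lambda> by (rule finite_subset)
  have ZV: "Z \<subseteq> V \<times> V" by (auto simp: Z_def)
  then have finZ: "finite Z" using finV by (auto intro: finite_subset)
  have "?P {X. \<exists>w\<in>V. \<exists>w'\<in>V. \<exists>v. cell (Suc t) v \<subseteq> \<Lambda> \<and> w \<in> cell (Suc t) v \<and> w' \<in> cell (Suc t) v \<and>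
         cell t w \<noteq> cell t w' \<and> unlinked X t w w'} \<le> ?P (\<Union>z\<in>Z. {X. unlinked X t (fst z) (snd z)})"
  proof (rule measure_pmf.finite_measure_mono)
    show "{X. \<exists>w\<in>V. \<exists>w'\<in>V. \<exists>v. cell (Suc t) v \<subseteq> \<Lambda> \<and> w \<in> cell (Suc t) v \<and> w' \<in> cell (Suc t) v \<and>
         cell t w \<noteq> cell t w' \<and> unlinked X t w w'} \<subseteq> (\<Union>z\<in>Z. {X. unlinked X t (fst z) (snd z)})"
    proof (rule subsetI, elim CollectE bexE exE conjE)
      fix X w w' v
      assume "w \<in> V" "w' \<in> V" "cell (Suc t) v \<subseteq> \<Lambda>" "w \<in> cell (Suc t) v" "w' \<in> cell (Suc t) v"
        "cell t w \<noteq> cell t w'" and un: "unlinked X t w w'"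
      then have "(w, w') \<in> Z" unfolding Z_def by blast
      then show "X \<in> (\<Union>z\<in>Z. {X. unlinked X t (fst z) (snd z)})" using un by (intro UN_I) auto
    qed
  qed simp
  also have "\<dots> \<le> (\<Sum>z\<in>Z. ?P {X. unlinked X t (fst z) (snd z)})"
    using finZ by (intro measure_pmf.finite_measure_subadditive_finite) auto
  also have "\<dots> \<le> (\<Sum>z\<in>Z. ?x)"
  proof (rule sum_mono)
    fix z assume "z \<in> Z"
    then obtain w w' v where z: "z = (w, w')" and v: "cell (Suc t) v \<subseteq> \<Lambda>" "w \<in> cell (Suc t) v" "w' \<in> cell (Suc t) v"
      and ne: "cell t w \<noteq> cell t w'" by (auto simp: Z_def)
    have sub: "cell t w \<subseteq> cell (Suc t) v" "cell t w' \<subseteq> cell (Suc t) v"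
      using cell_subset[of _ "Suc t" v t] v by auto
    have "?P {X. unlinked X t w w'} \<le> ?x"
    proof (rule prob_unlinked_le[OF \<Lambda> _ _ ne p(1,2)])
      fix a b assume ab: "a \<in> cell t w" "b \<in> cell t w'"
      then have "a \<noteq> b" using cells_disjoint[OF ne] by auto
      then show "\<rho> \<le> p {a, b}" using p(3)[OF v(1)] ab sub by blast
    qed (use sub v in auto)
    then show "?P {X. unlinked X t (fst z) (snd z)} \<le> ?x" by (simp add: z)
  qed
  also have "\<dots> = real (card Z) * ?x" by simp
  also have "\<dots> \<le> (real (card V))\<^sup>2 * ?x"
  proof (rule mult_right_mono)
    have "card Z \<le> card (V \<times> V)" using ZV finV by (intro card_mono) auto
    then show "real (card Z) \<le> (real (card V))\<^sup>2"
      by (simp add: card_cartesian_product power2_eq_square flip: of_nat_mult)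
  qed simp
  finally show ?thesis .
qed

text \<open>Note that \<open>\<delta> (Suc t)\<close> does not contain \<open>\<delta> t\<close>. As
  half of the subcells may be bad, their failure enters only through the threshold
  \<open>1 / 16\<close>; so the failure probabilities follow the scale instead of accumulating from
  below.\<close>

lemma prob_core_empty_le:
  assumes \<Lambda>: "finite \<Lambda>" and p: "\<And>e. 0 \<le> p e \<and> p e \<le> 1" "\<And>t. 0 \<le> \<rho> t"
      "\<And>t v a b. cell (Suc t) v \<subseteq> \<Lambda> \<Longrightarrow> a \<in> cell (Suc t) v \<Longrightarrow> b \<in> cell (Suc t) v \<Longrightarrow> a \<noteq> b \<Longrightarrow> \<rho> t \<le> p {a, b}"
    and \<delta>: "\<delta> 0 = 0" "\<And>t. \<delta> (Suc t) = (1 / 2) ^ m t + (real (n (Suc t)))\<^sup>2 * exp (- (\<rho> t * (real (n t) / 2 ^ t)\<^sup>2))"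
      "\<And>t. \<delta> t \<le> 1 / 16"
    and v: "cell t v \<subseteq> \<Lambda>"
  shows "measure_pmf.prob (bernoulli_subset (doubletons \<Lambda>) p) {X. core cell X t (cell t v) = {}} \<le> \<delta> t"
  using v
proof (induction t arbitrary: v)
  case 0
  have "cell 0 v \<noteq> {}" using mem_cell[of v 0] by auto
  then show ?case using \<delta> by simp
next
  case (Suc t)
  let ?P = "measure_pmf.prob (bernoulli_subset (doubletons \<Lambda>) p)"
  let ?J = "{X. \<exists>J\<subseteq>cell t ` cell (Suc t) v. m t \<le> 2 * card J \<and> (\<forall>q\<in>J. core cell X t q = {})}"
  let ?V = "cell (Suc t) v"
  let ?U = "{X. \<exists>w\<in>?V. \<exists>w'\<in>?V. \<exists>v. cell (Suc t) v \<subseteq> \<Lambda> \<and> w \<in> cell (Suc t) v \<and> w' \<in> cell (Suc t) v \<and>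
         cell t w \<noteq> cell t w' \<and> unlinked X t w w'}"
  have "?P {X. core cell X (Suc t) ?V = {}} \<le> ?P (?J \<union> ?U)"
  proof (rule measure_pmf.finite_measure_mono)
    show "{X. core cell X (Suc t) ?V = {}} \<subseteq> ?J \<union> ?U"
    proof (rule subsetI)
      fix X assume "X \<in> {X. core cell X (Suc t) ?V = {}}"
      then have e: "core cell X (Suc t) ?V = {}" by simp
      from core_Suc_empty_cases[OF e] show "X \<in> ?J \<union> ?U"
      proof
        assume "\<exists>J\<subseteq>cell t ` ?V. m t \<le> 2 * card J \<and> (\<forall>q\<in>J. core cell X t q = {})"
        then show ?thesis by (intro UnI1 CollectI)
      next
        assume "\<exists>w\<in>?V. \<exists>w'\<in>?V. cell t w \<noteq> cell t w' \<and> unlinked X t w w'"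
        then obtain w w' where "w \<in> ?V" "w' \<in> ?V" "cell t w \<noteq> cell t w'" "unlinked X t w w'" by blast
        then show ?thesis
          by (intro UnI2 CollectI bexI[of _ w] bexI[of _ w'] exI[of _ v] conjI Suc.prems)
      qed
    qed
  qed simp
  also have "\<dots> \<le> ?P ?J + ?P ?U" by (rule measure_Un_le) auto
  also have "?P ?J \<le> (1 / 2) ^ m t"
  proof (rule prob_half_cores_empty_le[OF \<Lambda> Suc.prems])
    fix w assume "w \<in> cell (Suc t) v"
    then have "cell t w \<subseteq> \<Lambda>" using cell_subset[of w "Suc t" v t] Suc.prems by auto
    then show "?P {X. core cell X t (cell t w) = {}} \<le> 1 / 16"
      using Suc.IH \<delta>(3) order_trans by blast
  qed
  also have "?P ?U \<le> (real (card ?V))\<^sup>2 * exp (- (\<rho> t * (real (n t) / 2 ^ t)\<^sup>2))"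
    by (rule prob_some_unlinked_le[OF \<Lambda> Suc.prems p(1) p(2)]) (rule p(3))
  finally show ?case by (simp add: \<delta>(2) card_cell)
qed

text \<open>From level \<open>t0\<close> on no cell of the box may be bad. At the least level with a
  bad cell, either this level is \<open>t0\<close>, or all its subcells are good and only a missing
  link can be the cause.\<close>

lemma prob_some_core_empty_le:
  assumes \<Lambda>: "finite \<Lambda>" and p: "\<And>e. 0 \<le> p e \<and> p e \<le> 1" "\<And>t. 0 \<le> \<rho> t"
      "\<And>t v a b. cell (Suc t) v \<subseteq> \<Lambda> \<Longrightarrow> a \<in> cell (Suc t) v \<Longrightarrow> b \<in> cell (Suc t) v \<Longrightarrow> a \<noteq> b \<Longrightarrow> \<rho> t \<le> p {a, b}"
    and c: "0 \<le> c" "\<And>v. cell t0 v \<subseteq> \<Lambda> \<Longrightarrow>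
      measure_pmf.prob (bernoulli_subset (doubletons \<Lambda>) p) {X. core cell X t0 (cell t0 v) = {}} \<le> c"
  shows "measure_pmf.prob (bernoulli_subset (doubletons \<Lambda>) p)
      {X. \<exists>s v. t0 \<le> s \<and> s \<le> T \<and> cell s v \<subseteq> \<Lambda> \<and> core cell X s (cell s v) = {}}
    \<le> real (card \<Lambda>) * c + (\<Sum>s\<in>{t0..<T}. (real (card \<Lambda>))\<^sup>2 * exp (- (\<rho> s * (real (n s) / 2 ^ s)\<^sup>2)))"
proof -
  let ?P = "measure_pmf.prob (bernoulli_subset (doubletons \<Lambda>) p)"
  define U where "U = (\<lambda>t. {X. \<exists>w\<in>\<Lambda>. \<exists>w'\<in>\<Lambda>. \<exists>v. cell (Suc t) v \<subseteq> \<Lambda> \<and> w \<in> cell (Suc t) v \<and> w' \<in> cell (Suc t) v \<and>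
         cell t w \<noteq> cell t w' \<and> unlinked X t w w'})"
  define V where "V = {v \<in> \<Lambda>. cell t0 v \<subseteq> \<Lambda>}"
  have finV: "finite V" "card V \<le> card \<Lambda>" using \<Lambda> by (auto simp: V_def intro: card_mono)
  define B where "B = (\<Union>v\<in>V. {X. core cell X t0 (cell t0 v) = {}})"
  have sub: "{X. \<exists>s v. t0 \<le> s \<and> s \<le> T \<and> cell s v \<subseteq> \<Lambda> \<and> core cell X s (cell s v) = {}} \<subseteq> B \<union> (\<Union>s\<in>{t0..<T}. U s)"
  proof
    fix X assume "X \<in> {X. \<exists>s v. t0 \<le> s \<and> s \<le> T \<and> cell s v \<subseteq> \<Lambda> \<and> core cell X s (cell s v) = {}}"
    then have ex: "\<exists>s. t0 \<le> s \<and> s \<le> T \<and> (\<exists>v. cell s v \<subseteq> \<Lambda> \<and> core cell X s (cell s v) = {})" by blast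
    define s where "s = (LEAST s. t0 \<le> s \<and> s \<le> T \<and> (\<exists>v. cell s v \<subseteq> \<Lambda> \<and> core cell X s (cell s v) = {}))"
    from LeastI_ex[OF ex] obtain v where s: "t0 \<le> s" "s \<le> T" and v: "cell s v \<subseteq> \<Lambda>" "core cell X s (cell s v) = {}"
      unfolding s_def by blast
    show "X \<in> B \<union> (\<Union>s\<in>{t0..<T}. U s)"
    proof (cases "s = t0")
      case True
      then have "v \<in> V" using v mem_cell by (auto simp: V_def)
      then show ?thesis using v True by (auto simp: B_def)
    next
      case False
      then obtain r where r: "s = Suc r" "t0 \<le> r" using s by (cases s) auto
      have child: "core cell X r (cell r w) \<noteq> {}" if "w \<in> cell s v" for w
      proof
        assume "core cell X r (cell r w) = {}"
        moreover have "cell r w \<subseteq> \<Lambda>" using cell_subset[OF that, of r] v r by auto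
        ultimately have "s \<le> r" unfolding s_def by (intro Least_le) (use r s in auto)
        then show False using r by simp
      qed
      have "\<exists>w\<in>cell (Suc r) v. \<exists>w'\<in>cell (Suc r) v. cell r w \<noteq> cell r w' \<and> unlinked X r w w'"
      proof -
        \<comment> \<open>By minimality all subcells are good, so \<open>J\<close> would be empty,
          whereas \<open>m r\<close> is positive.\<close>
        have "\<not> (\<exists>J\<subseteq>cell r ` cell (Suc r) v. m r \<le> 2 * card J \<and> (\<forall>q\<in>J. core cell X r q = {}))"
        proof
          assume "\<exists>J\<subseteq>cell r ` cell (Suc r) v. m r \<le> 2 * card J \<and> (\<forall>q\<in>J. core cell X r q = {})"
          then obtain J where J: "J \<subseteq> cell r ` cell (Suc r) v" "m r \<le> 2 * card J" "\<forall>q\<in>J. core cell X r q = {}" by blast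
          then have "J \<noteq> {}" using m_pos[of r] by auto
          then show False using J child r by blast
        qed
        then show ?thesis using core_Suc_empty_cases[OF v(2)[unfolded r(1)]] by satx
      qed
      then obtain w w' where w: "w \<in> cell (Suc r) v" "w' \<in> cell (Suc r) v" "cell r w \<noteq> cell r w'" "unlinked X r w w'"
        by blast
      have "w \<in> \<Lambda>" "w' \<in> \<Lambda>" "cell (Suc r) v \<subseteq> \<Lambda>" using v(1) w(1,2) by (auto simp: r(1))
      then have "X \<in> U r" unfolding U_def using w
        by (intro CollectI bexI[of _ w] bexI[of _ w'] exI[of _ v] conjI)
      then show ?thesis using r s by auto
    qed
  qed
  have "?P {X. \<exists>s v. t0 \<le> s \<and> s \<le> T \<and> cell s v \<subseteq> \<Lambda> \<and> core cell X s (cell s v) = {}} \<le> ?P (B \<union> (\<Union>s\<in>{t0..<T}. U s))"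
    using sub by (rule measure_pmf.finite_measure_mono) auto
  also have "\<dots> \<le> ?P B + ?P (\<Union>s\<in>{t0..<T}. U s)" by (rule measure_Un_le) auto
  also have "?P B \<le> real (card \<Lambda>) * c"
  proof -
    have "?P B \<le> (\<Sum>v\<in>V. ?P {X. core cell X t0 (cell t0 v) = {}})"
      unfolding B_def using finV by (intro measure_pmf.finite_measure_subadditive_finite) auto
    also have "\<dots> \<le> (\<Sum>v\<in>V. c)" using c by (intro sum_mono) (auto simp: V_def)
    also have "\<dots> \<le> real (card \<Lambda>) * c" using finV c by (simp add: mult_right_mono)
    finally show ?thesis .
  qed
  also have "?P (\<Union>s\<in>{t0..<T}. U s) \<le> (\<Sum>s\<in>{t0..<T}. ?P (U s))"
    by (intro measure_pmf.finite_measure_subadditive_finite) auto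
  also have "\<dots> \<le> (\<Sum>s\<in>{t0..<T}. (real (card \<Lambda>))\<^sup>2 * exp (- (\<rho> s * (real (n s) / 2 ^ s)\<^sup>2)))"
    unfolding U_def
    by (intro sum_mono prob_some_unlinked_le[OF \<Lambda> order_refl p(1) p(2)]) (rule p(3))
  finally show ?thesis by simp
qed

end

section \<open>Dyadic cells\<close>

text \<open>The offset \<open>c\<close> shifts the dyadic grid. It will be chosen to put the given
  vertex into the middle of its top cell; with a fixed grid the vertex could lie at a cell boundary
  on every scale.\<close>

definition dyadic_cell :: "int ^ 'd \<Rightarrow> nat \<Rightarrow> int ^ 'd \<Rightarrow> (int ^ 'd) set" where
  "dyadic_cell c a v = {w. \<forall>i. (w $ i - c $ i) div 2 ^ a = (v $ i - c $ i) div 2 ^ a}"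

lemma dyadic_cell_mono:
  assumes "a \<le> b" shows "dyadic_cell c a v \<subseteq> dyadic_cell c b v"
proof -
  have "y div 2 ^ b = (y div 2 ^ a) div 2 ^ (b - a)" for y :: int
    using assms by (simp add: zdiv_zmult2_eq[symmetric] flip: power_add)
  then show ?thesis by (auto simp: dyadic_cell_def)
qed

lemma int_div_eq_iff:
  assumes "0 < k" shows "(y::int) div k = q \<longleftrightarrow> y \<in> {q * k..<q * k + k}"
proof
  assume "y div k = q"
  then have "y = q * k + y mod k" using div_mult_mod_eq[of y k] by simp
  then show "y \<in> {q * k..<q * k + k}"
    using pos_mod_sign[OF assms, of y] pos_mod_bound[OF assms, of y] by simp
next
  assume "y \<in> {q * k..<q * k + k}"
  then show "y div k = q" by (intro int_div_pos_eq[of y k q "y - k * q"]) (auto simp: mult.commute)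
qed

lemma dyadic_cell_eq_box:
  "dyadic_cell c a v = {w. \<forall>i. w $ i \<in> {c $ i + (v $ i - c $ i) div 2 ^ a * 2 ^ a ..<
      c $ i + (v $ i - c $ i) div 2 ^ a * 2 ^ a + 2 ^ a}}"
  unfolding dyadic_cell_def by (simp add: int_div_eq_iff) (auto simp: algebra_simps)

lemma finite_dyadic_cell: "finite (dyadic_cell c a v)"
  unfolding dyadic_cell_eq_box by (rule finite_int_vec_box) simp

lemma card_dyadic_cell: "card (dyadic_cell c a (v :: int ^ 'd)) = 2 ^ (CARD('d) * a)"
  unfolding dyadic_cell_eq_box card_int_vec_box by (simp add: nat_power_eq power_mult[symmetric] mult.commute)

lemma dyadic_cell_component:
  assumes "w \<in> dyadic_cell c a v" "w' \<in> dyadic_cell c a v"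
  shows "\<bar>w $ i - w' $ i\<bar> < 2 ^ a"
  using assms unfolding dyadic_cell_eq_box by (auto dest!: spec[of _ i])

lemma dyadic_cell_hierarchy:
  assumes "mono e"
  shows "cell_hierarchy (\<lambda>t. dyadic_cell (c :: int ^ 'd) (e t)) (\<lambda>t. 2 ^ (CARD('d) * e t))
    (\<lambda>t. 2 ^ (CARD('d) * (e (Suc t) - e t)))"
proof
  fix v w :: "int ^ 'd" and t
  show "v \<in> dyadic_cell c (e t) v" by (simp add: dyadic_cell_def)
  show sub: "dyadic_cell c (e t) v \<subseteq> dyadic_cell c (e (Suc t)) v"
    using monoD[OF assms, of t "Suc t"] by (intro dyadic_cell_mono) simp
  show "finite (dyadic_cell c (e t) v)" by (rule finite_dyadic_cell)
  show "card (dyadic_cell c (e t) v) = 2 ^ (CARD('d) * e t)" by (rule card_dyadic_cell)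
  show "dyadic_cell c (e t) w = dyadic_cell c (e t) v" if "w \<in> dyadic_cell c (e t) v"
    using that by (simp add: dyadic_cell_def)
  let ?Q = "dyadic_cell c (e (Suc t)) v" and ?n = "2 ^ (CARD('d) * e t) :: nat"
  have le: "e t \<le> e (Suc t)" using assms by (rule monoD) simp
  have in_Q: "dyadic_cell c (e t) u \<subseteq> ?Q" if "u \<in> ?Q" for u
    using dyadic_cell_mono[OF le, of c u] that by (simp add: dyadic_cell_def)
  have "?Q = (\<Union>q\<in>dyadic_cell c (e t) ` ?Q. q)"
    using in_Q by (auto simp: dyadic_cell_def)
  then have "card ?Q = card (\<Union>q\<in>dyadic_cell c (e t) ` ?Q. q)" by simp
  also have "\<dots> = (\<Sum>q\<in>dyadic_cell c (e t) ` ?Q. card q)"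
  proof (rule card_UN_disjoint)
    show "finite (dyadic_cell c (e t) ` ?Q)" by (intro finite_imageI finite_dyadic_cell)
    show "\<forall>q\<in>dyadic_cell c (e t) ` ?Q. finite q" by (auto simp: finite_dyadic_cell)
    show "\<forall>q\<in>dyadic_cell c (e t) ` ?Q. \<forall>q'\<in>dyadic_cell c (e t) ` ?Q. q \<noteq> q' \<longrightarrow> q \<inter> q' = {}"
      by (auto simp: dyadic_cell_def)
  qed
  also have "\<dots> = (\<Sum>q\<in>dyadic_cell c (e t) ` ?Q. ?n)"
    by (intro sum.cong) (auto simp: card_dyadic_cell)
  finally have "2 ^ (CARD('d) * e (Suc t)) = card (dyadic_cell c (e t) ` ?Q) * ?n"
    by (simp add: card_dyadic_cell)
  moreover have "(2::nat) ^ (CARD('d) * e (Suc t)) = 2 ^ (CARD('d) * (e (Suc t) - e t)) * ?n"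
    using le by (simp add: diff_mult_distrib2 flip: power_add)
  ultimately show "card (dyadic_cell c (e t) ` ?Q) = 2 ^ (CARD('d) * (e (Suc t) - e t))"
    by simp
qed

lemma relpow_mono_rel:
  fixes R S :: "'v rel"
  assumes "R \<subseteq> S" shows "R ^^ l \<subseteq> S ^^ l"
proof (induction l)
  case (Suc l)
  then show ?case using assms by (simp add: relcomp_mono)
qed simp

lemma grid_path:
  "(v, w) \<in> grid_edges ^^ (\<Sum>i\<in>UNIV. nat \<bar>v $ i - (w :: int ^ 'd) $ i\<bar>)"
proof (induction "\<Sum>i\<in>UNIV. nat \<bar>v $ i - w $ i\<bar>" arbitrary: w)
  case 0
  then have "v = w" by (auto simp: vec_eq_iff sum_eq_0_iff)
  then show ?case by simp
next
  case (Suc l)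
  have "v \<noteq> w" using Suc.hyps(2) by auto
  then obtain i where i: "v $ i \<noteq> w $ i" by (auto simp: vec_eq_iff)
  define u where "u = (\<chi> j. if j = i then w $ i + sgn (v $ i - w $ i) else w $ j)"
  have "euclid_dist u w \<le> (\<Sum>j\<in>UNIV. real_of_int \<bar>u $ j - w $ j\<bar>)" by (rule euclid_dist_le_sum)
  also have "\<dots> = (\<Sum>j\<in>UNIV. if j = i then 1 else 0)"
    using i by (intro sum.cong) (auto simp: u_def sgn_if)
  also have "\<dots> = 1" by simp
  finally have "euclid_dist u w \<le> 1" .
  moreover have "u $ i \<noteq> w $ i" using i by (simp add: u_def sgn_if)
  then have "u \<noteq> w" by auto
  then have "1 \<le> euclid_dist u w" by (rule euclid_dist_ge_1)
  ultimately have e: "(u, w) \<in> grid_edges" by (simp add: grid_edges_def)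
  have "nat \<bar>v $ i - w $ i\<bar> = Suc (nat \<bar>v $ i - u $ i\<bar>)"
    using i by (auto simp: u_def sgn_if)
  moreover have "(\<Sum>j\<in>UNIV - {i}. nat \<bar>v $ j - w $ j\<bar>) = (\<Sum>j\<in>UNIV - {i}. nat \<bar>v $ j - u $ j\<bar>)"
    by (intro sum.cong) (auto simp: u_def)
  ultimately have eq: "(\<Sum>j\<in>UNIV. nat \<bar>v $ j - w $ j\<bar>) = Suc (\<Sum>j\<in>UNIV. nat \<bar>v $ j - u $ j\<bar>)"
    by (simp add: sum.remove[of UNIV i])
  then have "l = (\<Sum>j\<in>UNIV. nat \<bar>v $ j - u $ j\<bar>)" using Suc.hyps(2) by simp
  from Suc.hyps(1)[OF this] show ?case using e by (subst eq) auto
qed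

lemma grid_path_in_dyadic_cell:
  assumes "w \<in> dyadic_cell c a v" "w' \<in> dyadic_cell c a (v :: int ^ 'd)"
  shows "\<exists>l\<le>CARD('d) * 2 ^ a. (w, w') \<in> grid_edges ^^ l"
proof (intro exI conjI)
  show "(w, w') \<in> grid_edges ^^ (\<Sum>i\<in>UNIV. nat \<bar>w $ i - w' $ i\<bar>)" by (rule grid_path)
  have "nat \<bar>w $ i - w' $ i\<bar> \<le> 2 ^ a" for i
    using dyadic_cell_component[OF assms, of i] by (simp add: nat_le_iff)
  then have "(\<Sum>i\<in>UNIV. nat \<bar>w $ i - w' $ i\<bar>) \<le> (\<Sum>i\<in>(UNIV::'d set). 2 ^ a)" by (rule sum_mono)
  then show "(\<Sum>i\<in>UNIV. nat \<bar>w $ i - w' $ i\<bar>) \<le> CARD('d) * 2 ^ a" by simp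
qed

lemma pair_prob_ge_in_dyadic_cell:
  fixes a b :: "int ^ 'd"
  assumes "a \<in> dyadic_cell c r v" "b \<in> dyadic_cell c r v" "a \<noteq> b" and \<alpha>: "0 < \<alpha>" "0 < lam"
  shows "min 1 (lam * real CARD('d) powr (- (real CARD('d) * \<alpha>))) * 2 powr (- (real CARD('d) * \<alpha> * real r))
    \<le> pair_prob \<alpha> lam (\<lambda>_. 1) {a, b}"
proof -
  let ?d = "real CARD('d)"
  have d: "0 < ?d" by simp
  have "euclid_dist a b \<le> (\<Sum>i\<in>UNIV. real_of_int \<bar>a $ i - b $ i\<bar>)" by (rule euclid_dist_le_sum)
  also have "\<dots> \<le> (\<Sum>i\<in>(UNIV::'d set). 2 ^ r)"
  proof (rule sum_mono)
    fix i
    have "\<bar>a $ i - b $ i\<bar> < 2 ^ r" using assms(1,2) by (rule dyadic_cell_component)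
    then have "real_of_int \<bar>a $ i - b $ i\<bar> < real_of_int (2 ^ r)" by (rule of_int_less_iff[THEN iffD2])
    then show "real_of_int \<bar>a $ i - b $ i\<bar> \<le> 2 ^ r" by simp
  qed
  finally have le: "euclid_dist a b \<le> ?d * 2 powr real r" by (simp add: powr_realpow)
  have d1: "1 \<le> euclid_dist a b" using assms(3) by (rule euclid_dist_ge_1)
  have "?d powr (- (?d * \<alpha>)) * 2 powr (- (?d * \<alpha> * real r)) = (?d * 2 powr real r) powr (- (?d * \<alpha>))"
    by (simp add: powr_mult powr_powr mult_ac)
  also have "\<dots> \<le> euclid_dist a b powr (- (?d * \<alpha>))"
    using le d1 \<alpha> by (intro powr_mono2') auto
  also have "\<dots> = (1 * 1 / euclid_dist a b ^ CARD('d)) powr \<alpha>"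
    using d1 by (simp add: powr_divide powr_minus_divide powr_powr flip: powr_realpow)
  finally have *: "lam * (?d powr (- (?d * \<alpha>)) * 2 powr (- (?d * \<alpha> * real r)))
     \<le> lam * (1 * 1 / euclid_dist a b ^ CARD('d)) powr \<alpha>"
    using \<alpha> by (intro mult_left_mono) auto
  have "2 powr (- (?d * \<alpha> * real r)) \<le> 2 powr 0" using \<alpha> by (intro powr_mono) auto
  then have 1: "2 powr (- (?d * \<alpha> * real r)) \<le> 1" by simp
  have "min 1 (lam * ?d powr (- (?d * \<alpha>))) * 2 powr (- (?d * \<alpha> * real r))
     \<le> min 1 (lam * (?d powr (- (?d * \<alpha>)) * 2 powr (- (?d * \<alpha> * real r))))"
  proof (rule min.boundedI)
    have "min 1 (lam * ?d powr (- (?d * \<alpha>))) * 2 powr (- (?d * \<alpha> * real r)) \<le> 1 * 1"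
      using 1 \<alpha> by (intro mult_mono) auto
    then show "min 1 (lam * ?d powr (- (?d * \<alpha>))) * 2 powr (- (?d * \<alpha> * real r)) \<le> 1" by simp
    show "min 1 (lam * ?d powr (- (?d * \<alpha>))) * 2 powr (- (?d * \<alpha> * real r))
      \<le> lam * (?d powr (- (?d * \<alpha>)) * 2 powr (- (?d * \<alpha> * real r)))"
      unfolding mult.assoc[symmetric] by (intro mult_right_mono) auto
  qed
  also have "\<dots> \<le> min 1 (lam * (1 * 1 / euclid_dist a b ^ CARD('d)) powr \<alpha>)"
    using * by (intro min.mono) auto
  also have "\<dots> = pair_prob \<alpha> lam (\<lambda>_. 1) {a, b}"
    using assms(3) by (simp add: pair_prob_doubleton connection_prob_def)
  finally show ?thesis .
qed

text \<open>
  \<open>a\<close> drives a hierarchy of good cells whose cores are reached from each other cheaply, while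
  all cells of the hierarchy \<open>b\<close> are completely connected; the latter is used only to lead every
  vertex into a core.
\<close>

lemma prob_not_reached_le:
  fixes x c :: "int ^ 'd" and a b :: "nat \<Rightarrow> nat"
  assumes \<alpha>: "0 < \<alpha>" "0 < lam" and mono: "mono a" "mono b"
    and c0: "c0 = min 1 (lam * real CARD('d) powr (- (real CARD('d) * \<alpha>)))"
    and link: "\<And>e t. link e t = exp (- (c0 * 2 powr (- (real CARD('d) * \<alpha> * real (e (Suc t)))) *
        (2 ^ (CARD('d) * e t) / 2 ^ t)\<^sup>2))"
    and \<delta>: "\<delta> 0 = 0" "\<And>t. \<delta> (Suc t) = (1 / 2) ^ (2 ^ (CARD('d) * (a (Suc t) - a t))) +
        (2 ^ (CARD('d) * a (Suc t)))\<^sup>2 * link a t"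
      "\<And>t. \<delta> t \<le> 1 / 16"
    and t0: "t0 \<le> T" "a t0 \<le> b J" "b J \<le> a T"
    and \<Lambda>: "\<Lambda> = dyadic_cell c (a T) x"
    and K: "2 * (2 ^ J * Suc (CARD('d) * 2 ^ b 0)) + 2 ^ T * Suc (CARD('d) * 2 ^ a 0) \<le> K"
    and R: "\<And>X. R X = grid_edges \<union> {(v, w). {v, w} \<in> X}"
  shows "measure_pmf.prob (bernoulli_subset (doubletons \<Lambda>) (pair_prob \<alpha> lam (\<lambda>_. 1)))
      {X. \<not> (\<forall>v\<in>\<Lambda>. \<exists>l\<le>K. (x, v) \<in> R X ^^ l)}
    \<le> 2 ^ (CARD('d) * a T) * \<delta> t0 + (\<Sum>s\<in>{t0..<T}. (2 ^ (CARD('d) * a T))\<^sup>2 * link a s) +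
      (\<Sum>s\<in>{0..<J}. (2 ^ (CARD('d) * a T))\<^sup>2 * link b s)"
proof -
  let ?A = "\<lambda>t. dyadic_cell c (a t)" and ?B = "\<lambda>t. dyadic_cell c (b t)"
  interpret A: cell_hierarchy ?A "\<lambda>t. 2 ^ (CARD('d) * a t)" "\<lambda>t. 2 ^ (CARD('d) * (a (Suc t) - a t))"
    by (rule dyadic_cell_hierarchy[OF mono(1)])
  interpret B: cell_hierarchy ?B "\<lambda>t. 2 ^ (CARD('d) * b t)" "\<lambda>t. 2 ^ (CARD('d) * (b (Suc t) - b t))"
    by (rule dyadic_cell_hierarchy[OF mono(2)])
  let ?p = "pair_prob \<alpha> lam (\<lambda>_. 1) :: (int ^ 'd) set \<Rightarrow> real"
  let ?P = "measure_pmf.prob (bernoulli_subset (doubletons \<Lambda>) ?p)"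
  have fin: "finite \<Lambda>" and card\<Lambda>: "card \<Lambda> = 2 ^ (CARD('d) * a T)"
    by (simp_all add: \<Lambda> finite_dyadic_cell card_dyadic_cell)
  have p01: "0 \<le> ?p e \<and> ?p e \<le> 1" for e
    using \<alpha> by (auto simp: pair_prob_def connection_prob_nonneg connection_prob_le_1)
  define \<rho> where "\<rho> = (\<lambda>(e :: nat \<Rightarrow> nat) t. c0 * 2 powr (- (real CARD('d) * \<alpha> * real (e (Suc t)))))"
  have c00: "0 \<le> c0" unfolding c0 using \<alpha> by simp
  have \<rho>0: "0 \<le> \<rho> e t" for e t using c00 by (simp add: \<rho>_def)
  have \<rho>p: "\<rho> e t \<le> ?p {v, w}" if "v \<in> dyadic_cell c (e (Suc t)) u" "w \<in> dyadic_cell c (e (Suc t)) u" "v \<noteq> w" for e t u v w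
    unfolding \<rho>_def c0 by (rule pair_prob_ge_in_dyadic_cell[OF that \<alpha>])
  have linkA: "link e t = exp (- (\<rho> e t * (real (2 ^ (CARD('d) * e t)) / 2 ^ t)\<^sup>2))" for e t
    by (simp add: link \<rho>_def)
  define BadA where "BadA = {X. \<exists>s v. t0 \<le> s \<and> s \<le> T \<and> ?A s v \<subseteq> \<Lambda> \<and> core ?A X s (?A s v) = {}}"
  define BadB where "BadB = {X. \<exists>s v. 0 \<le> s \<and> s \<le> J \<and> ?B s v \<subseteq> \<Lambda> \<and> core ?B X s (?B s v) = {}}"
  have \<delta>0: "0 \<le> \<delta> t0" using \<delta>(1,2) link by (cases t0) (auto intro!: add_nonneg_nonneg mult_nonneg_nonneg)
  have PA: "?P BadA \<le> real (card \<Lambda>) * \<delta> t0 + (\<Sum>s\<in>{t0..<T}. (real (card \<Lambda>))\<^sup>2 * link a s)"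
    unfolding BadA_def linkA
  proof (rule A.prob_some_core_empty_le[where \<rho> = "\<rho> a" and p = ?p, OF fin p01 \<rho>0 _ \<delta>0])
    show "\<rho> a t \<le> ?p {v, w}" if "v \<in> ?A (Suc t) u" "w \<in> ?A (Suc t) u" "v \<noteq> w" for t u v w
      using that by (rule \<rho>p)
    show "?P {X. core ?A X t0 (?A t0 v) = {}} \<le> \<delta> t0" if "?A t0 v \<subseteq> \<Lambda>" for v
    proof (rule A.prob_core_empty_le[where \<delta> = \<delta> and \<rho> = "\<rho> a" and p = ?p, OF fin p01 \<rho>0 _ \<delta>(1) _ \<delta>(3) that])
      show "\<rho> a t \<le> ?p {v, w}" if "v \<in> ?A (Suc t) u" "w \<in> ?A (Suc t) u" "v \<noteq> w" for t u v w
        using that by (rule \<rho>p)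
      show "\<delta> (Suc t) = (1 / 2) ^ 2 ^ (CARD('d) * (a (Suc t) - a t)) + (real (2 ^ (CARD('d) * a (Suc t))))\<^sup>2 *
          exp (- (\<rho> a t * (real (2 ^ (CARD('d) * a t)) / 2 ^ t)\<^sup>2))" for t
        unfolding \<delta>(2) linkA by simp
    qed
  qed
  \<comment> \<open>Level 0 cells are their own cores and never bad, so hierarchy \<open>b\<close>
    can fail only through missing links, and the initial term is 0.\<close>
  have PB: "?P BadB \<le> real (card \<Lambda>) * 0 + (\<Sum>s\<in>{0..<J}. (real (card \<Lambda>))\<^sup>2 * link b s)"
    unfolding BadB_def linkA
  proof (rule B.prob_some_core_empty_le[where \<rho> = "\<rho> b" and p = ?p, OF fin p01 \<rho>0])
    show "\<rho> b t \<le> ?p {v, w}" if "v \<in> ?B (Suc t) u" "w \<in> ?B (Suc t) u" "v \<noteq> w" for t u v w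
      using that by (rule \<rho>p)
    show "?P {X. core ?B X 0 (?B 0 v) = {}} \<le> 0" for v
      using B.mem_cell[of v 0] by auto
  qed simp
  have good: "\<exists>l\<le>K. (x, v) \<in> R X ^^ l" if X: "X \<notin> BadA" "X \<notin> BadB" and v: "v \<in> \<Lambda>" for X v
  proof -
    have grid: "(v, w) \<in> R X ^^ l" if "(v, w) \<in> grid_edges ^^ l" for v w l
      using that relpow_mono_rel[of grid_edges "R X" l] by (auto simp: R)
    have H: "{v, w} \<in> X \<Longrightarrow> (v, w) \<in> R X" for v w by (simp add: R)
    have pathA: "\<exists>l. Suc l \<le> 2 ^ T * Suc (CARD('d) * 2 ^ a 0) \<and> (v, w) \<in> R X ^^ l"
      if "v \<in> core ?A X T (?A T x)" "w \<in> core ?A X T (?A T x)" for v w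
      by (rule A.core_path[OF _ H that]) (use grid_path_in_dyadic_cell grid in blast)+
    have pathB: "\<exists>l. Suc l \<le> 2 ^ J * Suc (CARD('d) * 2 ^ b 0) \<and> (v, w) \<in> R X ^^ l"
      if "v \<in> core ?B X J (?B J u)" "w \<in> core ?B X J (?B J u)" for u v w
      by (rule B.core_path[OF _ H that]) (use grid_path_in_dyadic_cell grid in blast)+
    \<comment> \<open>Both hierarchies share the offset, so \<open>a t0 \<le> b J\<close> nests the
      \<open>?A\<close>-cell of \<open>u\<close> at level \<open>t0\<close> in its
      \<open>?B\<close>-cell at level \<open>J\<close>. The core of the former contains a vertex
      \<open>z\<close> of the top core, and the latter is completely connected, hence joins
      \<open>u\<close> to \<open>z\<close>.\<close>
    have gate: "\<exists>z \<in> core ?A X T (?A T x). u \<in> core ?B X J (?B J u) \<and> z \<in> core ?B X J (?B J u)"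
      if u: "u \<in> \<Lambda>" for u
    proof -
      have Au: "?A T u = \<Lambda>" using u A.cell_eq unfolding \<Lambda> by simp
      have BJ: "?B J u \<subseteq> \<Lambda>" using dyadic_cell_mono[OF t0(3), of c u] Au by simp
      have subB: "core ?B X s (?B s w) \<noteq> {}" if "s \<le> J" "w \<in> ?B J u" for s w
      proof -
        have "?B s w \<subseteq> \<Lambda>" using B.cell_subset[OF that(2,1)] BJ by blast
        then show ?thesis using X(2) that(1) unfolding BadB_def by blast
      qed
      \<comment> \<open>No \<open>?B\<close>-cell inside is bad, so the chain can start from whole
        level 0 cells, and the core is the entire cell.\<close>
      have full: "w \<in> core ?B X J (?B J u)" if "w \<in> ?B J u" for w
      proof -
        have "core ?B X 0 (?B 0 w) \<subseteq> core ?B X J (?B J u)"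
          using subB that by (intro B.core_chain) auto
        then show ?thesis using B.mem_cell[of w 0] by auto
      qed
      have subA: "core ?A X s (?A s w) \<noteq> {}" if "t0 \<le> s" "s \<le> T" "w \<in> ?A T x" for s w
      proof -
        have "?A s w \<subseteq> \<Lambda>" using A.cell_subset[OF that(3,2)] by (simp add: \<Lambda>)
        then show ?thesis using X(1) that(1,2) unfolding BadA_def by blast
      qed
      have "core ?A X t0 (?A t0 u) \<noteq> {}" using subA[of t0 u] t0(1) u \<Lambda> by simp
      then obtain z where z: "z \<in> core ?A X t0 (?A t0 u)" by blast
      have "core ?A X t0 (?A t0 u) \<subseteq> core ?A X T (?A T x)"
        using subA t0(1) u unfolding \<Lambda> by (intro A.core_chain) auto
      moreover have "z \<in> ?B J u"
        using z A.core_subset dyadic_cell_mono[OF t0(2), of c u] by blast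
      ultimately show ?thesis using z full B.mem_cell by blast
    qed
    have x: "x \<in> \<Lambda>" using A.mem_cell by (simp add: \<Lambda>)
    obtain z where z: "z \<in> core ?A X T (?A T x)" "x \<in> core ?B X J (?B J x)" "z \<in> core ?B X J (?B J x)"
      using gate[OF x] by blast
    obtain z' where z': "z' \<in> core ?A X T (?A T x)" "v \<in> core ?B X J (?B J v)" "z' \<in> core ?B X J (?B J v)"
      using gate[OF v] by blast
    obtain l1 where l1: "Suc l1 \<le> 2 ^ J * Suc (CARD('d) * 2 ^ b 0)" "(x, z) \<in> R X ^^ l1"
      using pathB[OF z(2,3)] by blast
    obtain l2 where l2: "Suc l2 \<le> 2 ^ T * Suc (CARD('d) * 2 ^ a 0)" "(z, z') \<in> R X ^^ l2"
      using pathA[OF z(1) z'(1)] by blast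
    obtain l3 where l3: "Suc l3 \<le> 2 ^ J * Suc (CARD('d) * 2 ^ b 0)" "(z', v) \<in> R X ^^ l3"
      using pathB[OF z'(3,2)] by blast
    \<comment> \<open>Entrance within the \<open>b\<close>-cell of \<open>x\<close>, passage through
      the top core of \<open>a\<close>, exit within the \<open>b\<close>-cell of
      \<open>v\<close>.\<close>
    have "(x, v) \<in> R X ^^ (l1 + l2 + l3)"
      using l1(2) l2(2) l3(2) unfolding relpow_add by blast
    moreover have "l1 + l2 + l3 \<le> K" using l1(1) l2(1) l3(1) K by linarith
    ultimately show ?thesis by blast
  qed
  have "?P {X. \<not> (\<forall>v\<in>\<Lambda>. \<exists>l\<le>K. (x, v) \<in> R X ^^ l)} \<le> ?P (BadA \<union> BadB)"
    using good by (intro measure_pmf.finite_measure_mono) auto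
  also have "\<dots> \<le> ?P BadA + ?P BadB" by (rule measure_Un_le) auto
  finally show ?thesis using PA PB by (simp add: card\<Lambda>)
qed

section \<open>The graph ball is not too small\<close>

lemma power2_two_power: "(2 ^ m)\<^sup>2 = (2::real) powr (2 * real m)"
proof -
  have "(2 ^ m)\<^sup>2 = (2 powr real m)\<^sup>2" by (simp add: powr_realpow)
  also have "\<dots> = 2 powr (real m + real m)" by (simp only: power2_eq_square powr_add)
  finally show ?thesis by simp
qed

text \<open>The exponent bounds from below the expected number of links between two cores when the
  logarithmic scale \<open>u\<close> grows by the factor \<open>h\<close>. Rounding \<open>u\<close>
  down costs at most \<open>2 powr (- (2 * d))\<close>, and thinning of the two cores costs
  \<open>2 powr (- (2 * t))\<close>. Since \<open>\<alpha> * h \<le> 2\<close>, the factor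
  \<open>d\<close> of the main term may be dropped.\<close>

lemma level_link_le:
  fixes u :: "nat \<Rightarrow> real" and d :: nat
  assumes u: "0 \<le> u t" "u (Suc t) = h * u t" and e: "\<And>t. e t = nat \<lfloor>u t\<rfloor>"
    and h: "0 \<le> h" "0 < \<alpha>" "\<alpha> * h \<le> 2" and d: "1 \<le> d" and c0: "0 \<le> c0"
  shows "exp (- (c0 * 2 powr (- (real d * \<alpha> * real (e (Suc t)))) * (2 ^ (d * e t) / 2 ^ t)\<^sup>2))
    \<le> exp (- (c0 * 2 powr (- (2 * real d)) * 2 powr ((2 - \<alpha> * h) * u t - 2 * real t)))"
proof -
  have e1: "real (e (Suc t)) \<le> h * u t"
    using u h by (simp add: e)
  have e0: "u t - 1 \<le> real (e t)" using u unfolding e by linarith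
  have "(2 - \<alpha> * h) * u t - 2 \<le> 2 * real (e t) - \<alpha> * real (e (Suc t))"
  proof -
    have "\<alpha> * real (e (Suc t)) \<le> \<alpha> * (h * u t)" using e1 h by (intro mult_left_mono) auto
    moreover have "(2 - \<alpha> * h) * u t = 2 * u t - \<alpha> * (h * u t)" by (simp add: algebra_simps)
    ultimately show ?thesis using e0 by linarith
  qed
  then have "real d * ((2 - \<alpha> * h) * u t - 2) \<le> real d * (2 * real (e t) - \<alpha> * real (e (Suc t)))"
    by (intro mult_left_mono) auto
  moreover have "1 * ((2 - \<alpha> * h) * u t) \<le> real d * ((2 - \<alpha> * h) * u t)"
    using d h u by (intro mult_right_mono) auto
  ultimately have ex: "- (2 * real d) + ((2 - \<alpha> * h) * u t - 2 * real t)
      \<le> - (real d * \<alpha> * real (e (Suc t))) + (2 * real d * real (e t) - 2 * real t)"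
    by (simp add: algebra_simps)
  have sq: "(2 ^ (d * e t) / 2 ^ t)\<^sup>2 = (2::real) powr (2 * real d * real (e t) - 2 * real t)"
    by (simp add: power_divide powr_diff powr_realpow flip: power_mult)
      (simp add: powr_realpow[symmetric] mult_ac)
  have "2 powr (- (2 * real d)) * 2 powr ((2 - \<alpha> * h) * u t - 2 * real t)
    \<le> 2 powr (- (real d * \<alpha> * real (e (Suc t)))) * (2 ^ (d * e t) / 2 ^ t)\<^sup>2"
    unfolding sq powr_add[symmetric] using ex by (intro powr_mono) auto
  then have "c0 * (2 powr (- (2 * real d)) * 2 powr ((2 - \<alpha> * h) * u t - 2 * real t))
    \<le> c0 * (2 powr (- (real d * \<alpha> * real (e (Suc t)))) * (2 ^ (d * e t) / 2 ^ t)\<^sup>2)"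
    using c0 by (rule mult_left_mono)
  then show ?thesis by (simp add: mult.assoc)
qed

text \<open>Equivalent to \<open>\<alpha> - 1 \<le> log 2 \<alpha>\<close>, which is concavity of
  the logarithm with equality at 1 and 2.\<close>

lemma log_2_div_le:
  assumes "1 \<le> \<alpha>" "\<alpha> \<le> 2" shows "log 2 (2 / \<alpha>) \<le> 2 - \<alpha>"
proof -
  have "1 powr (2 - \<alpha>) * 2 powr (\<alpha> - 1) \<le> (2 - \<alpha>) * 1 + (\<alpha> - 1) * 2"
    by (rule Youngs_inequality_0) (use assms in auto)
  then have "2 powr (\<alpha> - 1) \<le> \<alpha>" by simp
  then have "\<alpha> - 1 \<le> log 2 \<alpha>" using assms by (simp add: le_log_iff)
  then show ?thesis using assms by (simp add: log_divide)
qed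

lemma eventually_double_exp:
  fixes A c \<beta> :: real
  assumes "0 < c" "0 < \<beta>" "0 < A"
  shows "eventually (\<lambda>u. 2 powr (A * u) \<le> exp (c * 2 powr (\<beta> * u))) at_top"
  using assms by real_asymp

lemma eventually_double_exp_small:
  fixes c \<beta> :: real
  assumes "0 < c" "0 < \<beta>"
  shows "eventually (\<lambda>u. 2 * exp (- (c * 2 powr (\<beta> * u))) \<le> 1 / 16) at_top"
  using assms by real_asymp

lemma log_le_powr:
  fixes A s :: real
  assumes "0 < s" "0 < A"
  shows "eventually (\<lambda>k::nat. A * log 2 (real k) \<le> 2 * real k powr s + 3) sequentially"
  using assms by real_asymp

text \<open>The first term is the cost of entering and leaving through cells of side
  \<open>k powr (1 - \<eta>)\<close>, the second the cost \<open>2 ^ T\<close> of the descent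
  through the main hierarchy.\<close>

lemma sublinear_budget:
  fixes A B C s \<eta> \<gamma> :: real
  assumes "0 < s" "0 < \<eta>" "\<eta> < 1" "0 < \<gamma>" "s * \<gamma> < 1" "0 < A" "0 < B" "0 < C"
  shows "eventually (\<lambda>k::nat. A * (1 + real k powr (1 - \<eta>)) + B * (C * (2 * real k powr s + 3)) powr \<gamma> \<le> real k) sequentially"
proof -
  define r where "r = s * \<gamma>"
  define D where "D = B * (C * 5) powr \<gamma>"
  have r: "0 < r" "r < 1" "0 < D" using assms by (auto simp: r_def D_def)
  define y where "y = 1 - \<eta>"
  have y: "0 < y" "y < 1" using assms by (auto simp: y_def)
  have "eventually (\<lambda>k::nat. A * (1 + real k powr y) \<le> real k / 2) sequentially"
    using assms y by real_asymp
  moreover have "eventually (\<lambda>k::nat. D * real k powr r \<le> real k / 2) sequentially"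
    using r by real_asymp
  ultimately show ?thesis using eventually_ge_at_top[of 1] unfolding y_def
  proof eventually_elim
    case (elim k)
    have "1 \<le> real k powr s" using elim assms by (intro ge_one_powr_ge_zero) auto
    then have "(C * (2 * real k powr s + 3)) powr \<gamma> \<le> (C * 5 * real k powr s) powr \<gamma>"
      using assms by (intro powr_mono2) (auto simp: mult.assoc)
    also have "\<dots> = (C * 5) powr \<gamma> * real k powr r"
      using assms by (simp add: powr_mult powr_powr r_def)
    finally have "B * (C * (2 * real k powr s + 3)) powr \<gamma> \<le> D * real k powr r"
      using assms by (simp add: D_def mult.assoc)
    then show ?case using elim by linarith
  qed
qed

lemma exp_powr_tendsto_0:
  fixes A c s p J :: real
  assumes "0 < s" "s < p" "0 < c" "0 < A"
  shows "(\<lambda>k::nat. J * (exp (A * (2 * real k powr s + 3)) * exp (- (c * real k powr p)))) \<longlonglongrightarrow> 0"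
  using assms by real_asymp


lemma long_range_reach:
  fixes x :: "int ^ 'd" and \<alpha> lam s :: real
  assumes \<alpha>: "1 < \<alpha>" "\<alpha> < 2" and lam: "0 < lam" and s: "0 < s" "s < log 2 (2 / \<alpha>)"
  shows "\<exists>f \<Lambda>. f \<longlonglongrightarrow> 0 \<and> (\<forall>\<^sub>F k in sequentially. finite (\<Lambda> k) \<and>
    euclid_ball x (exp (real k powr s)) \<subseteq> \<Lambda> k \<and>
    measure_pmf.prob (bernoulli_subset (doubletons (\<Lambda> k)) (pair_prob \<alpha> lam (\<lambda>_. 1)))
      {X. \<not> (\<forall>v\<in>\<Lambda> k. \<exists>l\<le>k. (x, v) \<in> (grid_edges \<union> {(v, w). {v, w} \<in> X}) ^^ l)} \<le> f k)"
proof -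
  let ?d = "CARD('d)"
  have d1: "1 \<le> ?d" by (simp add: Suc_le_eq)
  define \<theta> where "\<theta> = log 2 (2 / \<alpha>)"
  have s\<theta>: "s < \<theta>" using s by (simp add: \<theta>_def)
  have \<theta>1: "\<theta> \<le> 2 - \<alpha>" unfolding \<theta>_def using \<alpha> by (intro log_2_div_le) auto
  \<comment> \<open>The geometric mean of \<open>2 powr s\<close> and
    \<open>2 powr \<theta> = 2 / \<alpha>\<close>. Being below the latter it allows links; being
    above the former it makes \<open>log g 2\<close> smaller than \<open>1 / s\<close>, so that the
    doubling stays within \<open>k\<close> steps.\<close>
  define g where "g = 2 powr ((s + \<theta>) / 2)"
  have g1: "1 < g" using s s\<theta> by (simp add: g_def)
  have "g < 2 powr \<theta>" using s\<theta> by (simp add: g_def)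
  also have "2 powr \<theta> = 2 / \<alpha>" using \<alpha> by (simp add: \<theta>_def)
  finally have g\<alpha>: "\<alpha> * g < 2" using \<alpha> by (simp add: field_simps)
  define \<kappa> where "\<kappa> = 2 - \<alpha> * g"
  have \<kappa>: "0 < \<kappa>" using g\<alpha> by (simp add: \<kappa>_def)
  \<comment> \<open>Expanding gives
    \<open>p = 2 - \<alpha> - 2 * \<eta> + \<alpha> * \<eta> * \<eta>\<close>. With this
    \<open>\<eta>\<close> it exceeds \<open>s\<close> by at least \<open>2 * \<eta>\<close>.\<close>
  define \<eta> where "\<eta> = (2 - \<alpha> - s) / 4"
  have \<eta>: "0 < \<eta>" "\<eta> < 1" using s s\<theta> \<theta>1 \<alpha> by (auto simp: \<eta>_def)
  have \<eta>4: "4 * \<eta> = 2 - \<alpha> - s" by (simp add: \<eta>_def)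
  define h where "h = 1 + \<eta>"
  define p where "p = (1 - \<eta>) * (2 - \<alpha> * h)"
  have p: "s < p" "p < 1"
  proof -
    have "p = 2 - \<alpha> - 2 * \<eta> + \<alpha> * \<eta> * \<eta>" by (simp add: p_def h_def algebra_simps)
    moreover have "0 \<le> \<alpha> * \<eta> * \<eta>" using \<alpha> \<eta> by simp
    moreover have "\<alpha> * \<eta> * \<eta> \<le> 2 * \<eta> * 1" using \<alpha> \<eta> by (intro mult_mono) auto
    ultimately show "s < p" "p < 1" using \<eta>(1) \<alpha> \<eta>4 by linarith+
  qed
  have h\<alpha>: "0 < 2 - \<alpha> * h" using p s \<eta> by (metis p_def diff_gt_0_iff_gt less_trans zero_less_mult_pos)
  have h1: "1 < h" using \<eta> by (simp add: h_def)
  define c0 where "c0 = min 1 (lam * real ?d powr (- (real ?d * \<alpha>)))"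
  have c0: "0 < c0" using lam by (simp add: c0_def)
  define c1 where "c1 = c0 * 2 powr (- (2 * real ?d))"
  have c1: "0 < c1" using c0 by (simp add: c1_def)
  \<comment> \<open>\<open>g - 1\<close> is the growth rate of the number of subcells. Half of the
    link exponent \<open>\<kappa>\<close> is given away, because it must pay for the thinning
    \<open>2 * t\<close> of the cores.\<close>
  define \<beta> where "\<beta> = min (g - 1) (\<kappa> / 2)"
  have \<beta>: "0 < \<beta>" "\<beta> \<le> g - 1" "\<beta> \<le> \<kappa> / 2" using g1 \<kappa> by (auto simp: \<beta>_def min_def)
  define c where "c = min c1 (ln 2 / 2)"
  have c: "0 < c" "c \<le> c1" "c \<le> ln 2 / 2" using c1 by (auto simp: c_def min_def)
  have ev: "eventually (\<lambda>u. 2 powr (2 * real ?d * g * u) \<le> exp (c / 2 * 2 powr (\<beta> * u)) \<and>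
      2 * exp (- (c / 2 * 2 powr (\<beta> * u))) \<le> 1 / 16) at_top"
    using c \<beta> g1 d1 by (intro eventually_conj eventually_double_exp eventually_double_exp_small) auto
  then obtain u0 where u0: "\<And>u. u0 \<le> u \<Longrightarrow> 2 powr (2 * real ?d * g * u) \<le> exp (c / 2 * 2 powr (\<beta> * u)) \<and>
      2 * exp (- (c / 2 * 2 powr (\<beta> * u))) \<le> 1 / 16"
    by (auto simp: eventually_at_top_linorder)
  \<comment> \<open>Starting the scales at \<open>g ^ q\<close> makes the failure bound at most
    \<open>1 / 16\<close> from the bottom level on, and yields
    \<open>2 * t \<le> \<kappa> / 2 * u t\<close> at all levels.\<close>
  obtain q :: nat where q: "max u0 (4 / (\<kappa> * (g - 1))) < g ^ q"
    using real_arch_pow[OF g1] by blast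
  define u where "u = (\<lambda>t. g ^ (t + q))"
  define a where "a = (\<lambda>t. nat \<lfloor>u t\<rfloor>)"
  have u1: "1 \<le> u t" for t using g1 by (simp add: u_def one_le_power)
  have uS: "u (Suc t) = g * u t" for t by (simp add: u_def)
  have umono: "t \<le> t' \<Longrightarrow> u t \<le> u t'" for t t' using g1 by (simp add: u_def power_increasing)
  have uu0: "u0 \<le> u t" for t
  proof -
    have "u0 \<le> u 0" using q by (simp add: u_def)
    also have "\<dots> \<le> u t" by (rule umono) simp
    finally show ?thesis .
  qed
  have ut: "2 * real t \<le> \<kappa> / 2 * u t" for t
  proof -
    have "1 + real t * (g - 1) \<le> g ^ t" using Bernoulli_inequality[of "g - 1" t] g1 by simp
    then have "real t * (g - 1) \<le> g ^ t" by simp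
    then have t: "real t \<le> g ^ t / (g - 1)" using g1 by (simp add: field_simps)
    have "2 * real t \<le> 2 * (g ^ t / (g - 1))" using t by simp
    also have "\<dots> = \<kappa> / 2 * (4 / (\<kappa> * (g - 1))) * g ^ t" using \<kappa> by simp
    also have "\<dots> \<le> \<kappa> / 2 * g ^ q * g ^ t"
      using q g1 \<kappa> by (intro mult_right_mono mult_left_mono) auto
    finally show ?thesis by (simp add: u_def power_add mult_ac)
  qed
  have amono: "mono a" unfolding a_def by (intro monoI nat_mono floor_mono umono)
  have a_le: "real (a t) \<le> u t" for t using u1[of t] by (simp add: a_def)
  have a_ge: "u t - 1 \<le> real (a t)" for t using u1[of t] unfolding a_def by linarith
  define link where "link = (\<lambda>(e :: nat \<Rightarrow> nat) t. exp (- (c0 * 2 powr (- (real ?d * \<alpha> * real (e (Suc t)))) *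
        (2 ^ (?d * e t) / 2 ^ t)\<^sup>2)))"
  have linka: "link a t \<le> exp (- (c * 2 powr (\<beta> * u t)))" for t
  proof -
    have "link a t \<le> exp (- (c1 * 2 powr ((2 - \<alpha> * g) * u t - 2 * real t)))"
      unfolding link_def c1_def
      by (rule level_link_le[where u = u]) (use u1[of t] uS a_def g1 \<alpha> g\<alpha> d1 c0 in auto)
    also have "\<dots> \<le> exp (- (c * 2 powr (\<beta> * u t)))"
    proof -
      have "\<beta> * u t \<le> \<kappa> / 2 * u t" using \<beta>(3) u1[of t] by (intro mult_right_mono) auto
      then have "\<beta> * u t \<le> (2 - \<alpha> * g) * u t - 2 * real t"
        using ut[of t] unfolding \<kappa>_def by (simp add: algebra_simps)
      then have "c * 2 powr (\<beta> * u t) \<le> c1 * 2 powr ((2 - \<alpha> * g) * u t - 2 * real t)"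
        using c by (intro mult_mono powr_mono) auto
      then show ?thesis by simp
    qed
    finally show ?thesis .
  qed
  define \<delta> where "\<delta> = (\<lambda>t. case t of 0 \<Rightarrow> 0 | Suc t \<Rightarrow>
    (1 / 2) ^ (2 ^ (?d * (a (Suc t) - a t))) + (2 ^ (?d * a (Suc t)))\<^sup>2 * link a t)"
  \<comment> \<open>Half of \<open>c\<close> is spent on the volume factor, which is possible beyond
    \<open>u0\<close>.\<close>
  have \<delta>_le: "\<delta> (Suc t) \<le> 2 * exp (- (c / 2 * 2 powr (\<beta> * u t)))" for t
  proof -
    let ?e = "exp (- (c / 2 * 2 powr (\<beta> * u t)))"
    let ?N = "?d * (a (Suc t) - a t)"
    have 1: "(1 / 2 :: real) ^ (2 ^ ?N) \<le> ?e"
    proof -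
      have "(g - 1) * u t - 1 \<le> real (a (Suc t)) - real (a t)"
        using a_ge[of "Suc t"] a_le[of t] by (simp add: uS algebra_simps)
      also have "\<dots> = 1 * real (a (Suc t) - a t)" using monoD[OF amono, of t "Suc t"] by simp
      also have "\<dots> \<le> real ?d * real (a (Suc t) - a t)" using d1 by (intro mult_right_mono) auto
      finally have N: "(g - 1) * u t - 1 \<le> real ?N" by simp
      have "\<beta> * u t \<le> (g - 1) * u t" using \<beta> u1[of t] by (intro mult_right_mono) auto
      then have "2 powr (\<beta> * u t) \<le> 2 powr (1 + real ?N)"
        using N by (intro powr_mono) linarith+
      then have "2 powr (\<beta> * u t) / 2 \<le> 2 powr real ?N" by (simp add: powr_add)
      then have "c / 2 * 2 powr (\<beta> * u t) \<le> c * 2 powr real ?N" using c by simp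
      also have "\<dots> \<le> ln 2 * 2 powr real ?N" using c by (intro mult_right_mono) auto
      also have "2 powr real ?N = 2 ^ ?N" by (rule powr_realpow) simp
      finally have le: "c / 2 * 2 powr (\<beta> * u t) \<le> ln 2 * 2 ^ ?N" .
      have "(1 / 2 :: real) ^ (2 ^ ?N) = exp (- ln 2) ^ (2 ^ ?N)" by (simp add: exp_minus)
      also have "\<dots> = exp (- (ln 2 * 2 ^ ?N))" by (simp add: mult.commute flip: exp_of_nat_mult)
      also have "\<dots> \<le> ?e" using le by simp
      finally show ?thesis .
    qed
    have 2: "(2 ^ (?d * a (Suc t)))\<^sup>2 * link a t \<le> ?e"
    proof -
      have "(2 ^ (?d * a (Suc t)))\<^sup>2 = 2 powr (2 * real (?d * a (Suc t)))" by (rule power2_two_power)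
      also have "\<dots> = 2 powr (2 * real ?d * real (a (Suc t)))" by (simp only: of_nat_mult mult.assoc)
      also have "\<dots> \<le> 2 powr (2 * real ?d * g * u t)"
        using mult_left_mono[OF a_le[of "Suc t"], of "2 * real ?d"] by (intro powr_mono) (auto simp: uS mult_ac)
      also have "\<dots> \<le> exp (c / 2 * 2 powr (\<beta> * u t))" using u0[OF uu0] by blast
      finally have "(2 ^ (?d * a (Suc t)))\<^sup>2 * link a t \<le> exp (c / 2 * 2 powr (\<beta> * u t)) * exp (- (c * 2 powr (\<beta> * u t)))"
        using linka by (intro mult_mono) (auto simp: link_def)
      also have "\<dots> = ?e" by (simp flip: exp_add)
      finally show ?thesis .
    qed
    show ?thesis using 1 2 by (simp add: \<delta>_def)
  qed
  have \<delta>16: "\<delta> t \<le> 1 / 16" for t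
  proof (cases t)
    case (Suc t')
    then show ?thesis using order_trans[OF \<delta>_le conjunct2[OF u0[OF uu0]]] by simp
  qed (simp add: \<delta>_def)
  define C5 where "C5 = g ^ q * g ^ 2 / \<beta>"
  have C5: "0 < C5" using g1 \<beta> by (simp add: C5_def)
  \<comment> \<open>The number of levels by which \<open>b\<close> climbs from side
    \<open>k powr (1 - \<eta>)\<close> to the side of the \<open>t0\<close>-cells, which is at most
    \<open>k powr C5\<close>. It does not depend on \<open>k\<close>, so the entrance costs only a
    constant factor \<open>2 ^ J\<close>.\<close>
  obtain J :: nat where J: "C5 / (1 - \<eta>) < h ^ J" using real_arch_pow[OF h1] by blast
  define c6 where "c6 = c1 * 2 powr (- (2 * real J))"
  have c6: "0 < c6" using c1 by (simp add: c6_def)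
  define c' where "c' = min (c / 2) c6"
  have c': "0 < c'" "c' \<le> c / 2" "c' \<le> c6" using c c6 by (auto simp: c'_def min_def)
  define A where "A = 3 * real ?d * (g ^ q * g)"
  have A0: "0 < A" using g1 by (simp add: A_def)
  define f where "f = (\<lambda>k::nat. (3 + real J) * (exp (A * (2 * real k powr s + 3)) * exp (- (c' * real k powr p))))"
  have f0: "f \<longlonglongrightarrow> 0" unfolding f_def using s p c' A0 by (intro exp_powr_tendsto_0) auto
  \<comment> \<open>The top scale must satisfy \<open>exp (k powr s) < 2 ^ (a T - 1)\<close>: the
    factor 2 exceeds \<open>1 / ln 2\<close>, and the 3 covers rounding, halving the cell and
    strictness.\<close>
  define T where "T = (\<lambda>k::nat. nat \<lceil>log g (2 * real k powr s + 3)\<rceil>)"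
  \<comment> \<open>Puts \<open>x\<close> into the middle of its top cell in every
    coordinate.\<close>
  define cc where "cc = (\<lambda>k. \<chi> i. x $ i - 2 ^ (a (T k) - 1))"
  define \<Lambda> where "\<Lambda> = (\<lambda>k. dyadic_cell (cc k) (a (T k)) x)"
  define B1 where "B1 = 2 * 2 ^ J * (2 * real ?d)"
  define B2 where "B2 = 1 + real ?d * 2 ^ a 0"
  have B12: "0 < B1" "0 < B2" by (simp_all add: B1_def B2_def add_pos_nonneg)
  define \<gamma> where "\<gamma> = log g 2"
  have \<gamma>: "\<gamma> = 2 / (s + \<theta>)" using s s\<theta> by (simp add: \<gamma>_def g_def log_def)
  have s\<gamma>: "s * \<gamma> < 1" "0 < \<gamma>" using s s\<theta> by (auto simp: \<gamma> field_simps)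
  have ev1: "eventually (\<lambda>k::nat. B1 * (1 + real k powr (1 - \<eta>)) + B2 * (g * (2 * real k powr s + 3)) powr \<gamma> \<le> real k) sequentially"
    using s \<eta> s\<gamma> B12 g1 by (intro sublinear_budget) auto
  have ev2: "eventually (\<lambda>k::nat. (g ^ 2 / \<beta>) * log 2 (real k) \<le> 2 * real k powr s + 3) sequentially"
    using s g1 \<beta> by (intro log_le_powr) auto
  have ev3: "eventually (\<lambda>k::nat. h ^ J * log 2 (real k) \<le> 2 * real k powr s + 3) sequentially"
    using s h1 by (intro log_le_powr) auto
  have ev4: "eventually (\<lambda>k::nat. 2 powr \<beta> \<le> real k) sequentially" by real_asymp
  have "eventually (\<lambda>k. finite (\<Lambda> k) \<and> euclid_ball x (exp (real k powr s)) \<subseteq> \<Lambda> k \<and>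
    measure_pmf.prob (bernoulli_subset (doubletons (\<Lambda> k)) (pair_prob \<alpha> lam (\<lambda>_. 1)))
      {X. \<not> (\<forall>v\<in>\<Lambda> k. \<exists>l\<le>k. (x, v) \<in> (grid_edges \<union> {(v, w). {v, w} \<in> X}) ^^ l)} \<le> f k) sequentially"
    using ev1 ev2 ev3 ev4 eventually_ge_at_top[of 2]
  proof eventually_elim
    case (elim k)
    let ?y = "2 * real k powr s + 3" and ?T = "T k"
    have k2: "2 \<le> real k" using elim by simp
    have y3: "3 \<le> ?y" by simp
    have lg: "0 \<le> log g ?y" using g1 y3 by (intro zero_le_log_cancel_iff[THEN iffD2]) linarith+
    have gT: "?y \<le> g ^ ?T" "g ^ ?T \<le> g * ?y"
    proof -
      have "log g ?y \<le> real ?T" using lg by (simp add: T_def)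
      moreover have "0 < ?y" using y3 by linarith
      ultimately have "?y \<le> g powr real ?T" using g1 by (simp only: log_le_iff)
      then show "?y \<le> g ^ ?T" using g1 by (simp add: powr_realpow)
      have "real ?T \<le> 1 + log g ?y" using lg unfolding T_def by linarith
      then have "g powr real ?T \<le> g powr (1 + log g ?y)" using g1 by (intro powr_mono) auto
      also have "\<dots> = g powr 1 * g powr log g ?y" by (rule powr_add)
      also have "g powr log g ?y = ?y" using g1 y3 by (intro powr_log_cancel) linarith+
      also have "g powr 1 * ?y = g * ?y" using g1 by simp
      finally show "g ^ ?T \<le> g * ?y" using g1 by (simp add: powr_realpow)
    qed
    have gq1: "1 \<le> g ^ q" using g1 by (simp add: one_le_power)
    have uT: "?y \<le> u ?T" "u ?T \<le> g ^ q * g * ?y"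
    proof -
      have "1 * ?y \<le> g ^ q * g ^ ?T" using gT gq1 by (intro mult_mono) auto
      then show "?y \<le> u ?T" by (simp add: u_def power_add mult.commute)
      show "u ?T \<le> g ^ q * g * ?y"
        using mult_left_mono[OF gT(2), of "g ^ q"] gq1 by (simp add: u_def power_add mult_ac)
    qed
    have \<Lambda>k: "\<Lambda> k = dyadic_cell (cc k) (a ?T) x" by (simp add: \<Lambda>_def)
    have fin: "finite (\<Lambda> k)" by (simp add: \<Lambda>_def finite_dyadic_cell)

    have ball: "euclid_ball x (exp (real k powr s)) \<subseteq> \<Lambda> k"
    proof
      fix v assume v: "v \<in> euclid_ball x (exp (real k powr s))"
      have aT: "2 * real k powr s + 2 \<le> real (a ?T)" using a_ge[of ?T] uT(1) by simp
      then have aT1: "1 \<le> a ?T" by (smt (verit) less_one not_le of_nat_0 powr_ge_zero)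
      have "exp (real k powr s) = 2 powr (real k powr s / ln 2)" by (simp add: powr_def)
      also have "\<dots> < 2 powr (real (a ?T) - 1)"
      proof (rule powr_less_mono)
        have "1 / ln 2 \<le> (2 :: real)" using ln2_ge_two_thirds by (simp add: field_simps)
        then have "real k powr s * (1 / ln 2) \<le> real k powr s * 2" by (intro mult_left_mono) auto
        then show "real k powr s / ln 2 < real (a ?T) - 1" using aT by simp
      qed simp
      also have "\<dots> = real_of_int (2 ^ (a ?T - 1))" using aT1 by (simp add: powr_realpow[symmetric] of_nat_diff)
      finally have ex: "exp (real k powr s) < real_of_int (2 ^ (a ?T - 1))" .
      have half: "(2::int) ^ a ?T = 2 * 2 ^ (a ?T - 1)" using aT1 by (simp flip: power_Suc)
      have "(v $ i - cc k $ i) div 2 ^ a ?T = (x $ i - cc k $ i) div 2 ^ a ?T" for i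
      proof -
        have "real_of_int \<bar>x $ i - v $ i\<bar> \<le> euclid_dist x v" by (rule component_le_euclid_dist)
        also have "\<dots> < real_of_int (2 ^ (a ?T - 1))" using v ex by (simp add: euclid_ball_def)
        finally have "\<bar>x $ i - v $ i\<bar> < 2 ^ (a ?T - 1)" by (simp only: of_int_less_iff)
        then have "(v $ i - cc k $ i) div 2 ^ a ?T = 0"
          by (intro div_pos_pos_trivial) (auto simp: cc_def half)
        moreover have "(x $ i - cc k $ i) div 2 ^ a ?T = 0"
          by (intro div_pos_pos_trivial) (auto simp: cc_def half)
        ultimately show ?thesis by simp
      qed
      then show "v \<in> \<Lambda> k" by (simp add: \<Lambda>_def dyadic_cell_def)
    qed

    define lk where "lk = log 2 (real k)"
    have lk: "1 \<le> lk" "\<beta> \<le> lk" using k2 elim by (simp_all add: lk_def le_log_iff)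
    \<comment> \<open>From this level on \<open>2 powr (\<beta> * u t)\<close> is at least
      \<open>k\<close>, so failures are exponentially small in \<open>k\<close> and a union bound
      over the box is possible. As \<open>\<delta> (Suc t)\<close> is governed by
      \<open>u t\<close>, the good levels start at \<open>Suc t1\<close>.\<close>
    define t1 where "t1 = nat \<lceil>log g (lk / \<beta>)\<rceil>"
    have lb: "1 \<le> lk / \<beta>" using lk \<beta> by simp
    have lb0: "0 \<le> log g (lk / \<beta>)" using lb g1 by (intro zero_le_log_cancel_iff[THEN iffD2]) auto
    have g_t1: "lk / \<beta> \<le> g ^ t1" "g ^ t1 \<le> g * (lk / \<beta>)"
    proof -
      have "log g (lk / \<beta>) \<le> real t1" using lb0 by (simp add: t1_def)
      then have "lk / \<beta> \<le> g powr real t1" using g1 lb by (subst (asm) log_le_iff) auto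
      then show "lk / \<beta> \<le> g ^ t1" using g1 by (simp add: powr_realpow)
      have "real t1 \<le> 1 + log g (lk / \<beta>)" using lb0 unfolding t1_def by linarith
      then have "g powr real t1 \<le> g powr (1 + log g (lk / \<beta>))" using g1 by (intro powr_mono) auto
      also have "\<dots> = g powr 1 * g powr log g (lk / \<beta>)" by (rule powr_add)
      also have "\<dots> = g * (lk / \<beta>)" using g1 lb by (subst powr_log_cancel) auto
      finally show "g ^ t1 \<le> g * (lk / \<beta>)" using g1 by (simp add: powr_realpow)
    qed
    have big: "real k \<le> 2 powr (\<beta> * u t)" if "t1 \<le> t" for t
    proof -
      have "1 * (lk / \<beta>) \<le> g ^ q * g ^ t1" using g_t1 gq1 lb by (intro mult_mono) auto
      also have "\<dots> = u t1" by (simp add: u_def power_add mult.commute)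
      also have "\<dots> \<le> u t" by (rule umono[OF that])
      finally have "lk \<le> \<beta> * u t" using \<beta> by (simp add: field_simps)
      then have "2 powr lk \<le> 2 powr (\<beta> * u t)" by (intro powr_mono) auto
      then show ?thesis using k2 by (simp add: lk_def)
    qed
    let ?t0 = "Suc t1"
    \<comment> \<open>Base-2 logarithms of the sides of the entrance hierarchy. Cells of side
      \<open>k powr (1 - \<eta>)\<close> at the bottom are crossed by grid paths within the budget,
      and all links already fail with probability at most
      \<open>exp (- (c6 * k powr p))\<close>.\<close>
    define v where "v = (\<lambda>i. h ^ i * ((1 - \<eta>) * lk))"
    define b where "b = (\<lambda>i. nat \<lfloor>v i\<rfloor>)"
    have v0: "(1 - \<eta>) * lk \<le> v i" for i
      unfolding v_def using h1 \<eta> lk one_le_power[of h i]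
      by (intro mult_right_mono[of 1 "h ^ i", simplified]) auto
    have vnn: "0 \<le> v i" for i using v0[of i] \<eta> lk by (smt (verit) mult_nonneg_nonneg)
    have vmono: "i \<le> j \<Longrightarrow> v i \<le> v j" for i j
      unfolding v_def using h1 \<eta> lk by (intro mult_right_mono power_increasing) auto
    have bmono: "mono b" unfolding b_def by (intro monoI nat_mono floor_mono vmono)
    have t0T: "?t0 \<le> ?T"
    proof -
      have "g ^ ?t0 \<le> g * (g * (lk / \<beta>))"
        unfolding power_Suc using g_t1(2) g1 by (intro mult_left_mono) auto
      also have "\<dots> = g ^ 2 / \<beta> * lk" by (simp add: power2_eq_square)
      also have "\<dots> \<le> ?y" using elim by (simp add: lk_def)
      also have "\<dots> \<le> g ^ ?T" by (rule gT)
      finally show ?thesis using g1 by (simp only: power_increasing_iff)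
    qed
    have a_b: "a ?t0 \<le> b J"
    proof -
      have "u ?t0 = g ^ q * g * g ^ t1" by (simp add: u_def power_add mult_ac)
      also have "\<dots> \<le> g ^ q * g * (g * (lk / \<beta>))" using g_t1(2) gq1 g1 by (intro mult_left_mono) auto
      also have "\<dots> = C5 * lk" by (simp add: C5_def power2_eq_square)
      also have "\<dots> \<le> h ^ J * (1 - \<eta>) * lk"
        using J \<eta> lk by (intro mult_right_mono) (auto simp: field_simps)
      also have "\<dots> = v J" by (simp add: v_def)
      finally show ?thesis unfolding a_def b_def by (intro nat_mono floor_mono)
    qed
    have b_a: "b J \<le> a ?T"
    proof -
      have "v J \<le> h ^ J * (1 * lk)" unfolding v_def using h1 \<eta> lk by (intro mult_left_mono mult_right_mono) auto
      also have "\<dots> \<le> ?y" using elim by (simp add: lk_def)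
      also have "\<dots> \<le> u ?T" by (rule uT)
      finally show ?thesis unfolding a_def b_def by (intro nat_mono floor_mono)
    qed
    have linkb: "link b i \<le> exp (- (c6 * real k powr p))" if "i < J" for i
    proof -
      have "link b i \<le> exp (- (c1 * 2 powr ((2 - \<alpha> * h) * v i - 2 * real i)))"
        unfolding link_def c1_def
        by (rule level_link_le[where u = v]) (use vnn h\<alpha> h1 \<alpha> d1 c0 b_def in \<open>auto simp: v_def\<close>)
      also have "\<dots> \<le> exp (- (c6 * real k powr p))"
      proof -
        have kp: "real k powr p = 2 powr (p * lk)"
          using k2 by (simp add: lk_def powr_powr[symmetric] mult.commute[of p])
        have "p * lk = (2 - \<alpha> * h) * ((1 - \<eta>) * lk)" by (simp add: p_def)
        also have "\<dots> \<le> (2 - \<alpha> * h) * v i" using v0 h\<alpha> by (intro mult_left_mono) auto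
        finally have "2 powr (- (2 * real J) + p * lk) \<le> 2 powr ((2 - \<alpha> * h) * v i - 2 * real i)"
          using that by (intro powr_mono) auto
        then have "c1 * 2 powr (- (2 * real J) + p * lk) \<le> c1 * 2 powr ((2 - \<alpha> * h) * v i - 2 * real i)"
          using c1 by simp
        moreover have "c6 * real k powr p = c1 * 2 powr (- (2 * real J) + p * lk)"
          by (simp only: c6_def kp powr_add mult.assoc)
        ultimately show ?thesis by (simp only: exp_le_cancel_iff neg_le_iff_le)
      qed
      finally show ?thesis .
    qed

    have b0: "2 ^ b 0 \<le> real k powr (1 - \<eta>)"
    proof -
      have "real (b 0) \<le> (1 - \<eta>) * lk" using vnn[of 0] by (simp add: b_def v_def)
      then have "2 powr real (b 0) \<le> 2 powr ((1 - \<eta>) * lk)" by (intro powr_mono) auto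
      also have "\<dots> = real k powr (1 - \<eta>)"
        using k2 by (simp add: lk_def powr_powr[symmetric] mult.commute[of "1 - \<eta>"])
      finally show ?thesis by (simp add: powr_realpow)
    qed
    \<comment> \<open>\<open>2 = g powr \<gamma>\<close>, so \<open>2 ^ T\<close> is the power
      \<open>\<gamma>\<close> of the logarithmic scale.\<close>
    have T2: "2 ^ ?T \<le> (g * ?y) powr \<gamma>"
    proof -
      have "(2::real) = g powr \<gamma>" using g1 by (simp add: \<gamma>_def)
      then have "(2::real) ^ ?T = (g powr \<gamma>) ^ ?T" by simp
      also have "\<dots> = (g powr \<gamma>) powr real ?T" using g1 by (intro powr_realpow[symmetric]) simp
      also have "\<dots> = (g powr real ?T) powr \<gamma>" by (simp only: powr_powr mult.commute)
      also have "\<dots> = (g ^ ?T) powr \<gamma>" using g1 by (subst powr_realpow) auto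
      also have "\<dots> \<le> (g * ?y) powr \<gamma>" using gT(2) g1 s\<gamma> by (intro powr_mono2) auto
      finally show ?thesis .
    qed
    have K: "2 * (2 ^ J * Suc (?d * 2 ^ b 0)) + 2 ^ ?T * Suc (?d * 2 ^ a 0) \<le> k"
    proof -
      have "real (2 * (2 ^ J * Suc (?d * 2 ^ b 0)) + 2 ^ ?T * Suc (?d * 2 ^ a 0))
        = 2 * 2 ^ J * (1 + real ?d * 2 ^ b 0) + 2 ^ ?T * B2"
        by (simp only: B2_def of_nat_add of_nat_mult of_nat_power of_nat_numeral of_nat_Suc mult.assoc)
      also have "\<dots> \<le> B1 * (1 + real k powr (1 - \<eta>)) + (g * ?y) powr \<gamma> * B2"
      proof (rule add_mono)
        have "1 + real ?d * 2 ^ b 0 \<le> 2 * real ?d * 1 + 2 * real ?d * real k powr (1 - \<eta>)"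
        proof -
          have "real ?d * 2 ^ b 0 \<le> real ?d * real k powr (1 - \<eta>)" using b0 by (intro mult_left_mono) auto
          moreover have "0 \<le> real ?d * real k powr (1 - \<eta>)" by simp
          moreover have "1 \<le> real ?d" using d1 by simp
          ultimately show ?thesis by linarith
        qed
        then have "2 * 2 ^ J * (1 + real ?d * 2 ^ b 0) \<le> 2 * 2 ^ J * (2 * real ?d * 1 + 2 * real ?d * real k powr (1 - \<eta>))"
          by (intro mult_left_mono) auto
        then show "2 * 2 ^ J * (1 + real ?d * 2 ^ b 0) \<le> B1 * (1 + real k powr (1 - \<eta>))"
          by (simp add: B1_def algebra_simps)
        show "2 ^ ?T * B2 \<le> (g * ?y) powr \<gamma> * B2" using T2 B12 by (intro mult_right_mono) auto
      qed
      also have "\<dots> \<le> real k" using elim by (simp add: mult.commute)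
      finally show ?thesis by (simp only: of_nat_le_iff)
    qed

    define N where "N = (2::real) ^ (?d * a ?T)"
    define w where "w = real ?d * (g ^ q * g * ?y)"
    \<comment> \<open>The weakest of the three failure bounds, since \<open>p < 1\<close> and
      \<open>c'\<close> is the smallest constant.\<close>
    define Ex where "Ex = exp (- (c' * real k powr p))"
    have kp: "real k powr p \<le> real k" using powr_mono[of p 1 "real k"] k2 p by simp
    have Nw: "N \<le> exp w" "1 \<le> N"
    proof -
      have "N = 2 powr real (?d * a ?T)" unfolding N_def by (rule powr_realpow[symmetric]) simp
      also have "\<dots> = exp (ln 2 * (real ?d * real (a ?T)))" by (simp add: powr_def)
      also have "\<dots> \<le> exp (1 * (real ?d * (g ^ q * g * ?y)))"
      proof (subst exp_le_cancel_iff, rule mult_mono)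
        show "real ?d * real (a ?T) \<le> real ?d * (g ^ q * g * ?y)"
          using a_le[of ?T] uT(2) by (intro mult_left_mono) auto
      qed (use ln_le_minus_one[of 2] in auto)
      finally show "N \<le> exp w" by (simp add: w_def)
      show "1 \<le> N" by (simp add: N_def)
    qed
    have w0: "0 \<le> w" using g1 y3 by (simp add: w_def)
    have Nw2: "N\<^sup>2 \<le> exp (2 * w)"
      using power_mono[OF Nw(1), of 2] Nw(2) by (simp add: exp_double)
    have Tw: "real ?T \<le> exp w"
    proof -
      have "real ?T \<le> \<kappa> / 2 * u ?T" using ut[of ?T] by simp
      also have "\<dots> \<le> 1 * u ?T"
      proof (rule mult_right_mono)
        have "1 * 1 \<le> \<alpha> * g" using \<alpha> g1 by (intro mult_mono) auto
        then show "\<kappa> / 2 \<le> 1" by (simp add: \<kappa>_def)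
      qed (use u1[of ?T] in simp)
      also have "\<dots> \<le> 1 * (g ^ q * g * ?y)" using uT(2) by simp
      also have "\<dots> \<le> w" unfolding w_def using d1 g1 y3 by (intro mult_right_mono) auto
      also have "\<dots> \<le> exp w" using exp_ge_add_one_self[of w] by linarith
      finally show ?thesis .
    qed
    have E1: "exp (- (c / 2 * real k)) \<le> Ex" "exp (- (c * real k)) \<le> Ex" "exp (- (c6 * real k powr p)) \<le> Ex"
    proof -
      have 1: "c' * real k powr p \<le> c / 2 * real k" using c' c kp by (intro mult_mono) auto
      then show "exp (- (c / 2 * real k)) \<le> Ex" by (simp add: Ex_def)
      have "c / 2 * real k \<le> c * real k" using c by simp
      then show "exp (- (c * real k)) \<le> Ex" using 1 by (simp add: Ex_def)
      show "exp (- (c6 * real k powr p)) \<le> Ex" using c' by (simp add: Ex_def mult_right_mono)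
    qed
    have Ex0: "0 \<le> Ex" by (simp add: Ex_def)
    have big_w: "exp w \<le> exp (3 * w)" "exp (2 * w) \<le> exp (3 * w)" using w0 by simp_all

    have "measure_pmf.prob (bernoulli_subset (doubletons (\<Lambda> k)) (pair_prob \<alpha> lam (\<lambda>_. 1)))
      {X. \<not> (\<forall>v\<in>\<Lambda> k. \<exists>l\<le>k. (x, v) \<in> (grid_edges \<union> {(v, w). {v, w} \<in> X}) ^^ l)}
      \<le> 2 ^ (?d * a ?T) * \<delta> ?t0 + (\<Sum>s\<in>{?t0..<?T}. (2 ^ (?d * a ?T))\<^sup>2 * link a s) +
      (\<Sum>s\<in>{0..<J}. (2 ^ (?d * a ?T))\<^sup>2 * link b s)"
      by (rule prob_not_reached_le[OF _ lam amono bmono c0_def _ _ _ \<delta>16 t0T a_b b_a \<Lambda>k K])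
        (use \<alpha> in \<open>auto simp: link_def \<delta>_def\<close>)
    also have "\<dots> = N * \<delta> ?t0 + (\<Sum>s\<in>{?t0..<?T}. N\<^sup>2 * link a s) + (\<Sum>s\<in>{0..<J}. N\<^sup>2 * link b s)"
      by (simp only: N_def)
    also have "N * \<delta> ?t0 \<le> exp w * (2 * Ex)"
    proof (rule mult_mono)
      have "c / 2 * real k \<le> c / 2 * 2 powr (\<beta> * u t1)" using big[of t1] c by simp
      then have "exp (- (c / 2 * 2 powr (\<beta> * u t1))) \<le> exp (- (c / 2 * real k))" by simp
      then show "\<delta> ?t0 \<le> 2 * Ex" using \<delta>_le[of t1] E1(1) by linarith
      show "0 \<le> \<delta> ?t0" by (simp add: \<delta>_def link_def)
    qed (use Nw in auto)
    also have "(\<Sum>s\<in>{?t0..<?T}. N\<^sup>2 * link a s) \<le> (\<Sum>s\<in>{?t0..<?T}. exp (2 * w) * Ex)"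
    proof (intro sum_mono mult_mono Nw2)
      fix t assume t: "t \<in> {?t0..<?T}"
      have "c * real k \<le> c * 2 powr (\<beta> * u t)" using big[of t] t c by simp
      then have "link a t \<le> exp (- (c * real k))" using linka[of t] by (simp add: order_trans)
      then show "link a t \<le> Ex" using E1(2) by linarith
      show "0 \<le> link a t" by (simp add: link_def)
    qed auto
    also have "\<dots> = real (?T - ?t0) * (exp (2 * w) * Ex)" by simp
    also have "\<dots> \<le> exp w * (exp (2 * w) * Ex)"
      using Tw Ex0 by (intro mult_right_mono) auto
    also have "\<dots> = exp (3 * w) * Ex" by (simp add: mult.assoc[symmetric] flip: exp_add)
    also have "(\<Sum>s\<in>{0..<J}. N\<^sup>2 * link b s) \<le> (\<Sum>s\<in>{0..<J}. exp (2 * w) * Ex)"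
    proof (intro sum_mono mult_mono Nw2)
      fix i assume "i \<in> {0..<J}"
      then show "link b i \<le> Ex" using linkb[of i] E1(3) by simp
      show "0 \<le> link b i" by (simp add: link_def)
    qed auto
    also have "\<dots> = real J * (exp (2 * w) * Ex)" by simp
    \<comment> \<open>Volume factors and the number of levels together are at most
      \<open>exp (3 * w)\<close>, with \<open>w\<close> of order \<open>k powr s\<close>;
      \<open>Ex\<close> beats this because \<open>s < p\<close>.\<close>
    also have "exp w * (2 * Ex) + exp (3 * w) * Ex + real J * (exp (2 * w) * Ex)
      \<le> exp (3 * w) * (2 * Ex) + exp (3 * w) * Ex + real J * (exp (3 * w) * Ex)"
      using big_w Ex0 by (intro add_mono mult_right_mono mult_left_mono) auto
    also have "\<dots> = (3 + real J) * (exp (3 * w) * Ex)" by (simp add: algebra_simps)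
    also have "3 * w = A * ?y" by (simp add: w_def A_def)
    finally have "measure_pmf.prob (bernoulli_subset (doubletons (\<Lambda> k)) (pair_prob \<alpha> lam (\<lambda>_. 1)))
      {X. \<not> (\<forall>v\<in>\<Lambda> k. \<exists>l\<le>k. (x, v) \<in> (grid_edges \<union> {(v, w). {v, w} \<in> X}) ^^ l)} \<le> f k"
      by (simp add: f_def Ex_def)
    then show ?case using fin ball by blast
  qed
  with f0 show ?thesis by blast
qed

section \<open>The main theorem\<close>

lemma eventually_card_bound:
  fixes a b :: real and d :: nat
  assumes "0 < a" "a < b"
  shows "eventually (\<lambda>k::nat. (3 * exp (real k powr a)) ^ d \<le> exp (real k powr b)) sequentially"
proof -
  have "eventually (\<lambda>k::nat. real d * 2 + real d * real k powr a \<le> real k powr b) sequentially"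
    using assms by real_asymp
  then show ?thesis
  proof eventually_elim
    case (elim k)
    have "(3::real) \<le> exp 2" using exp_ge_add_one_self[of 2] by simp
    then have "(3 * exp (real k powr a)) ^ d \<le> (exp 2 * exp (real k powr a)) ^ d"
      by (intro power_mono mult_right_mono) auto
    also have "\<dots> = exp (real d * 2 + real d * real k powr a)"
      by (simp add: power_mult_distrib exp_add exp_of_nat_mult)
    also have "\<dots> \<le> exp (real k powr b)" using elim by simp
    finally show ?case .
  qed
qed

text \<open>A finite set over a countable type takes only countably many values. Finiteness is part
  of the event, since \<open>card\<close> is 0 on infinite sets.\<close>

lemma (in prob_space) sets_Collect_finite_card:
  fixes B :: "'a \<Rightarrow> 'v::countable set"
  assumes "\<And>y. {\<omega> \<in> space M. y \<in> B \<omega>} \<in> events"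
  shows "{\<omega> \<in> space M. finite (B \<omega>) \<and> P (card (B \<omega>))} \<in> events"
proof -
  have "{\<omega> \<in> space M. finite (B \<omega>) \<and> P (card (B \<omega>))}
    = (\<Union>F\<in>{F. finite F \<and> P (card F)}. {\<omega> \<in> space M. \<forall>y. y \<in> B \<omega> \<longleftrightarrow> y \<in> F})"
    by (auto simp: set_eq_iff[symmetric])
  also have "\<dots> \<in> events"
  proof (rule sets.countable_UN'')
    show "countable {F :: 'v set. finite F \<and> P (card F)}"
      by (rule countable_subset[OF _ countable_Collect_finite]) auto
    show "{\<omega> \<in> space M. \<forall>y. y \<in> B \<omega> \<longleftrightarrow> y \<in> F} \<in> events" for F
    proof (rule sets.sets_Collect_countable_All)
      fix y
      show "{\<omega> \<in> space M. y \<in> B \<omega> \<longleftrightarrow> y \<in> F} \<in> events"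
        using assms[of y] sets.sets_Collect_neg[OF assms[of y]] by (cases "y \<in> F") auto
    qed
  qed
  finally show ?thesis .
qed

lemma (in prob_space) prob_tendsto_1:
  fixes E N N' :: "nat \<Rightarrow> 'a set"
  assumes "\<And>k. E k \<in> events" "\<And>k. N k \<in> events" "\<And>k. N' k \<in> events"
    and "(\<lambda>k. prob (N k)) \<longlonglongrightarrow> 0" "(\<lambda>k. prob (N' k)) \<longlonglongrightarrow> 0"
    and "eventually (\<lambda>k. space M - E k \<subseteq> N k \<union> N' k) sequentially"
  shows "(\<lambda>k. prob (E k)) \<longlonglongrightarrow> 1"
proof (rule tendsto_sandwich[of "\<lambda>k. 1 - (prob (N k) + prob (N' k))" _ _ "\<lambda>_. 1"])
  show "\<forall>\<^sub>F k in sequentially. 1 - (prob (N k) + prob (N' k)) \<le> prob (E k)"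
    using assms(6)
  proof eventually_elim
    case (elim k)
    have "1 - prob (E k) = prob (space M - E k)" using assms(1) by (simp add: prob_compl)
    also have "\<dots> \<le> prob (N k \<union> N' k)" using elim assms by (intro finite_measure_mono) auto
    also have "\<dots> \<le> prob (N k) + prob (N' k)" using assms by (intro measure_Un_le) auto
    finally show ?case by linarith
  qed
  show "(\<lambda>k. 1 - (prob (N k) + prob (N' k))) \<longlonglongrightarrow> 1"
    using tendsto_diff[OF tendsto_const[of 1] tendsto_add[OF assms(4,5)]] by simp
qed auto

section \<open>Measurability of the ball events and transfer of the lower estimate\<close>

context scale_free_percolation
begin

lemma sets_edge: "{\<omega> \<in> space M. (y, z) \<in> sfp_graph L \<omega>} \<in> events"
  using sets_skeleton_edges[of "{(y, z)}"] by simp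

lemma sets_relpow: "{\<omega> \<in> space M. (x, y) \<in> sfp_graph L \<omega> ^^ n} \<in> events"
proof (induction n arbitrary: y)
  case 0
  then show ?case by (cases "x = y") auto
next
  case (Suc n)
  have "{\<omega> \<in> space M. \<exists>z. (x, z) \<in> sfp_graph L \<omega> ^^ n \<and> (z, y) \<in> sfp_graph L \<omega>} \<in> events"
    by (intro sets.sets_Collect_countable_Ex sets.sets_Collect_conj Suc sets_edge)
  then show ?case by (simp add: relcomp_unfold)
qed

lemma sets_mem_graph_ball: "{\<omega> \<in> space M. y \<in> graph_ball (sfp_graph L \<omega>) x k} \<in> events"
proof -
  have "{\<omega> \<in> space M. y \<in> graph_ball (sfp_graph L \<omega>) x k}
    = (\<Union>n\<in>{..k}. {\<omega> \<in> space M. (x, y) \<in> sfp_graph L \<omega> ^^ n})"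
    by (auto simp: mem_graph_ball_iff)
  also have "\<dots> \<in> events" using sets_relpow by (intro sets.finite_UN) auto
  finally show ?thesis .
qed

lemma sets_subset_graph_ball: "{\<omega> \<in> space M. A \<subseteq> graph_ball (sfp_graph L \<omega>) x k} \<in> events"
proof -
  have "{\<omega> \<in> space M. y \<in> A \<longrightarrow> y \<in> graph_ball (sfp_graph L \<omega>) x k} \<in> events" for y
    using sets_mem_graph_ball[of y x k] by (cases "y \<in> A") auto
  then have "{\<omega> \<in> space M. \<forall>y. y \<in> A \<longrightarrow> y \<in> graph_ball (sfp_graph L \<omega>) x k} \<in> events"
    by (rule sets.sets_Collect_countable_All)
  then show ?thesis by (simp only: subset_iff)
qed

lemma sets_graph_ball_subset: "{\<omega> \<in> space M. graph_ball (sfp_graph L \<omega>) x k \<subseteq> A} \<in> events"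
proof -
  have "{\<omega> \<in> space M. y \<in> graph_ball (sfp_graph L \<omega>) x k \<longrightarrow> y \<in> A} \<in> events" for y
    using sets.sets_Collect_neg[OF sets_mem_graph_ball[of y x k]] by (cases "y \<in> A") auto
  then have "{\<omega> \<in> space M. \<forall>y. y \<in> graph_ball (sfp_graph L \<omega>) x k \<longrightarrow> y \<in> A} \<in> events"
    by (rule sets.sets_Collect_countable_All)
  then show ?thesis by (simp only: subset_iff)
qed

text \<open>Reaching all vertices of the box is increasing in the set of long-range edges, so
  \<open>prob_increasing_ge\<close> carries the estimate over from independent edges.\<close>

lemma subset_ball_limit:
  fixes x :: "int ^ 'd"
  assumes \<alpha>2: "\<alpha> < 2" and s: "0 < s" "s < log 2 (2 / \<alpha>)"
  shows "(\<lambda>k. prob {\<omega> \<in> space M. \<not> euclid_ball x (exp (real k powr s)) \<subseteq> graph_ball (sfp_graph L \<omega>) x k}) \<longlonglongrightarrow> 0"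
proof -
  obtain f \<Lambda> where f: "f \<longlonglongrightarrow> 0" and ev: "\<forall>\<^sub>F k in sequentially. finite (\<Lambda> k) \<and>
    euclid_ball x (exp (real k powr s)) \<subseteq> \<Lambda> k \<and>
    measure_pmf.prob (bernoulli_subset (doubletons (\<Lambda> k)) (pair_prob \<alpha> lam (\<lambda>_. 1)))
      {X. \<not> (\<forall>v\<in>\<Lambda> k. \<exists>l\<le>k. (x, v) \<in> (grid_edges \<union> {(v, w). {v, w} \<in> X}) ^^ l)} \<le> f k"
    using long_range_reach[OF params(1) \<alpha>2 params(3) s, of x] by blast
  have "\<forall>\<^sub>F k in sequentially. prob {\<omega> \<in> space M. \<not> euclid_ball x (exp (real k powr s)) \<subseteq> graph_ball (sfp_graph L \<omega>) x k} \<le> f k"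
    using ev
  proof eventually_elim
    case (elim k)
    define Q where "Q = (\<lambda>X. \<forall>v\<in>\<Lambda> k. \<exists>l\<le>k. (x, v) \<in> (grid_edges \<union> {(v, w). {v, w} \<in> X}) ^^ l)"
    let ?E = "doubletons (\<Lambda> k)"
    let ?\<nu> = "bernoulli_subset ?E (pair_prob \<alpha> lam (\<lambda>_. 1))"
    let ?S = "{\<omega> \<in> space M. euclid_ball x (exp (real k powr s)) \<subseteq> graph_ball (sfp_graph L \<omega>) x k}"
    have "1 - f k \<le> 1 - measure_pmf.prob ?\<nu> {X. \<not> Q X}" using elim by (simp add: Q_def)
    also have "\<dots> = measure_pmf.prob ?\<nu> {X. Q X}"
      by (subst measure_pmf.prob_compl[symmetric]) (auto intro: arg_cong[where f = "measure_pmf.prob ?\<nu>"])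
    also have "\<dots> \<le> prob {\<omega> \<in> space M. Q (undirected (L \<omega>) \<inter> ?E)}"
    proof (rule prob_increasing_ge)
      show "finite ?E" using elim by (intro finite_doubletons) auto
      show "card e = 2" if "e \<in> ?E" for e using that by (simp add: doubletons_def)
      show "Q Y" if "X \<subseteq> Y" "Q X" for X Y
      proof -
        have "(grid_edges \<union> {(v, w). {v, w} \<in> X}) ^^ l \<subseteq> (grid_edges \<union> {(v, w). {v, w} \<in> Y}) ^^ l" for l
          using that(1) by (intro relpow_mono_rel) auto
        then show ?thesis using that(2) unfolding Q_def by (meson subsetD)
      qed
    qed
    also have "\<dots> \<le> prob ?S"
    proof (rule finite_measure_mono[OF _ sets_subset_graph_ball])
      show "{\<omega> \<in> space M. Q (undirected (L \<omega>) \<inter> ?E)} \<subseteq> ?S"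
      proof
        fix \<omega> assume "\<omega> \<in> {\<omega> \<in> space M. Q (undirected (L \<omega>) \<inter> ?E)}"
        then have \<omega>: "\<omega> \<in> space M" and q: "Q (undirected (L \<omega>) \<inter> ?E)" by auto
        have "grid_edges \<union> {(v, w). {v, w} \<in> undirected (L \<omega>) \<inter> ?E} \<subseteq> sfp_graph L \<omega>"
          using symD[OF edges_sym[OF \<omega>]] by (auto simp: sfp_graph_def undirected_def doubleton_eq_iff)
        then have "(grid_edges \<union> {(v, w). {v, w} \<in> undirected (L \<omega>) \<inter> ?E}) ^^ l \<subseteq> sfp_graph L \<omega> ^^ l" for l
          by (rule relpow_mono_rel)
        then have "v \<in> graph_ball (sfp_graph L \<omega>) x k" if "v \<in> \<Lambda> k" for v
          using q that unfolding Q_def mem_graph_ball_iff by (meson subsetD)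
        then show "\<omega> \<in> ?S" using \<omega> elim by auto
      qed
    qed
    finally have "1 - f k \<le> prob ?S" .
    moreover have "prob {\<omega> \<in> space M. \<not> euclid_ball x (exp (real k powr s)) \<subseteq> graph_ball (sfp_graph L \<omega>) x k} = 1 - prob ?S"
      by (rule prob_neg[OF sets_subset_graph_ball])
    ultimately show ?case by linarith
  qed
  then show ?thesis
    by (rule tendsto_sandwich[OF _ _ tendsto_const f, rotated]) (auto intro!: always_eventually)
qed

end

theorem theorem1p7:
  fixes M :: "'a measure" and \<alpha> \<tau> lam \<epsilon> :: real
    and W :: "int ^ 'd \<Rightarrow> 'a \<Rightarrow> real" and L :: "'a \<Rightarrow> (int ^ 'd) rel" and x :: "int ^ 'd"
  assumes "scale_free_percolation M \<alpha> \<tau> lam W L"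
    and "1 < \<alpha>" and "\<alpha> < 2" and "0 < lam" and "\<alpha> < \<tau> - 2" and "0 < \<epsilon>"
  shows "((\<lambda>k::nat. measure M {\<omega> \<in> space M.
            euclid_ball x (exp (real k powr (1 / Delta \<alpha> - \<epsilon>))) \<subseteq> graph_ball (sfp_graph L \<omega>) x k \<and>
            graph_ball (sfp_graph L \<omega>) x k \<subseteq> euclid_ball x (exp (real k powr (1 / Delta \<alpha> + \<epsilon>)))})
          \<longlonglongrightarrow> 1) \<and>
         ((\<lambda>k::nat. measure M {\<omega> \<in> space M.
            finite (graph_ball (sfp_graph L \<omega>) x k) \<and>
            exp (real k powr (1 / Delta \<alpha> - \<epsilon>)) \<le> real (card (graph_ball (sfp_graph L \<omega>) x k)) \<and>
            real (card (graph_ball (sfp_graph L \<omega>) x k)) \<le> exp (real k powr (1 / Delta \<alpha> + \<epsilon>))})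
          \<longlonglongrightarrow> 1)"
proof -
  interpret scale_free_percolation M \<alpha> \<tau> lam W L by (rule assms(1))
  define \<theta> where "\<theta> = log 2 (2 / \<alpha>)"
  have \<theta>: "1 / Delta \<alpha> = \<theta>" "0 < \<theta>" using assms by (simp_all add: Delta_def \<theta>_def)
  \<comment> \<open>The maximum with \<open>\<theta> / 2\<close> keeps the exponent positive when
    \<epsilon> is at least \<open>\<theta>\<close>; a larger \<open>s\<close> only enlarges the
    Euclidean ball to be covered.\<close>
  define s where "s = max (\<theta> - \<epsilon>) (\<theta> / 2)"
  have s: "0 < s" "s < \<theta>" "\<theta> - \<epsilon> \<le> s" using \<theta> assms by (auto simp: s_def)
  let ?B = "\<lambda>\<omega> k. graph_ball (sfp_graph L \<omega>) x k"
  let ?low = "\<lambda>k::nat. {\<omega> \<in> space M. \<not> euclid_ball x (exp (real k powr s)) \<subseteq> ?B \<omega> k}"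
  let ?upp = "\<lambda>\<epsilon> (k::nat). {\<omega> \<in> space M. \<not> ?B \<omega> k \<subseteq> euclid_ball x (exp (real k powr (\<theta> + \<epsilon>)))}"
  have low: "(\<lambda>k. prob (?low k)) \<longlonglongrightarrow> 0"
    using s assms by (intro subset_ball_limit) (auto simp: \<theta>_def)
  have upp: "(\<lambda>k. prob (?upp \<epsilon>' k)) \<longlonglongrightarrow> 0" if "0 < \<epsilon>'" for \<epsilon>'
    using ball_subset_limit[of \<epsilon>' x] assms that by (simp add: \<theta>_def)
  have ev_low: "\<forall>\<^sub>F k in sequentially. exp (real k powr (\<theta> - \<epsilon>)) \<le> exp (real k powr s)"
    using eventually_ge_at_top[of 1]
  proof eventually_elim
    case (elim k)
    then show ?case using s(3) by (simp add: powr_mono)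
  qed
  have low_events: "?low k \<in> events" for k
    by (rule sets.sets_Collect_neg[OF sets_subset_graph_ball])
  have upp_events: "?upp \<epsilon>' k \<in> events" for \<epsilon>' k
    by (rule sets.sets_Collect_neg[OF sets_graph_ball_subset])
  show ?thesis
    unfolding \<theta>(1)
  proof
    let ?E = "\<lambda>k::nat. {\<omega> \<in> space M. euclid_ball x (exp (real k powr (\<theta> - \<epsilon>))) \<subseteq> ?B \<omega> k \<and>
        ?B \<omega> k \<subseteq> euclid_ball x (exp (real k powr (\<theta> + \<epsilon>)))}"
    show "(\<lambda>k. prob (?E k)) \<longlonglongrightarrow> 1"
    proof (rule prob_tendsto_1[OF _ low_events upp_events low upp[OF assms(6)]])
      show "?E k \<in> events" for k
        by (intro sets.sets_Collect_conj sets_subset_graph_ball sets_graph_ball_subset)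
      show "\<forall>\<^sub>F k in sequentially. space M - ?E k \<subseteq> ?low k \<union> ?upp \<epsilon> k"
        using ev_low
      proof eventually_elim
        case (elim k)
        then have "euclid_ball x (exp (real k powr (\<theta> - \<epsilon>))) \<subseteq> euclid_ball x (exp (real k powr s))"
          by (auto simp: euclid_ball_def simp del: exp_le_cancel_iff intro: order_trans)
        from subset_trans[OF this] show ?case by auto
      qed
    qed
  next
    let ?E = "\<lambda>k::nat. {\<omega> \<in> space M. finite (?B \<omega> k) \<and> exp (real k powr (\<theta> - \<epsilon>)) \<le> real (card (?B \<omega> k)) \<and>
        real (card (?B \<omega> k)) \<le> exp (real k powr (\<theta> + \<epsilon>))}"
    \<comment> \<open>Containment with \<open>\<epsilon> / 2\<close> leaves room for the passage
      from the radius to the volume \<open>(3 * r) ^ d\<close>.\<close>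
    have half: "0 < \<epsilon> / 2" using assms by simp
    show "(\<lambda>k. prob (?E k)) \<longlonglongrightarrow> 1"
    proof (rule prob_tendsto_1[OF _ low_events upp_events low upp[OF half]])
      show "?E k \<in> events" for k
        by (rule sets_Collect_finite_card[OF sets_mem_graph_ball])
      have ev_upp: "\<forall>\<^sub>F k in sequentially. (3 * exp (real k powr (\<theta> + \<epsilon> / 2))) ^ CARD('d) \<le> exp (real k powr (\<theta> + \<epsilon>))"
        using \<theta> assms by (intro eventually_card_bound) auto
      show "\<forall>\<^sub>F k in sequentially. space M - ?E k \<subseteq> ?low k \<union> ?upp (\<epsilon> / 2) k"
        using ev_low ev_upp
      proof eventually_elim
        case (elim k)
        show ?case
        proof (rule subsetI, rule ccontr)
          fix \<omega> assume \<omega>: "\<omega> \<in> space M - ?E k" and "\<omega> \<notin> ?low k \<union> ?upp (\<epsilon> / 2) k"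
          then have lo: "euclid_ball x (exp (real k powr s)) \<subseteq> ?B \<omega> k"
            and up: "?B \<omega> k \<subseteq> euclid_ball x (exp (real k powr (\<theta> + \<epsilon> / 2)))" by auto
          have e1: "1 \<le> exp (real k powr s)" "1 \<le> exp (real k powr (\<theta> + \<epsilon> / 2))" by simp_all
          have fin: "finite (?B \<omega> k)" using up finite_euclid_ball[OF e1(2)] by (rule finite_subset)
          have "exp (real k powr (\<theta> - \<epsilon>)) \<le> exp (real k powr s)" using elim by blast
          also have "\<dots> \<le> real (card (euclid_ball x (exp (real k powr s))))" by (rule card_euclid_ball_ge[OF e1(1)])
          also have "\<dots> \<le> real (card (?B \<omega> k))" using card_mono[OF fin lo] by simp
          finally have c1: "exp (real k powr (\<theta> - \<epsilon>)) \<le> real (card (?B \<omega> k))" .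
          have "real (card (?B \<omega> k)) \<le> real (card (euclid_ball x (exp (real k powr (\<theta> + \<epsilon> / 2)))))"
            using card_mono[OF finite_euclid_ball[OF e1(2)] up] by simp
          also have "\<dots> \<le> (3 * exp (real k powr (\<theta> + \<epsilon> / 2))) ^ CARD('d)" by (rule card_euclid_ball_le[OF e1(2)])
          also have "\<dots> \<le> exp (real k powr (\<theta> + \<epsilon>))" using elim by blast
          finally have c2: "real (card (?B \<omega> k)) \<le> exp (real k powr (\<theta> + \<epsilon>))" .
          show False using \<omega> fin c1 c2 by simp
        qed
      qed
    qed
  qed
qed

end
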